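(* Let $\mathbf{E},\mathbf{X},\mathbf{Y}$ be sets of topological spaces, $\mathbf{G}$ a set of topological groups, and $\mathbf{B}$ a set of protobundles $(E,X,Y,G,\pi,\rho)$ with $E\in\mathbf{E}$, $X\in\mathbf{X}$, $Y\in\mathbf{Y}$, $G\in\mathbf{G}$. Let $\mathcal{M}=(\mathcal{E},\mathcal{XYG\rho},\mathcal{X},\mathcal{Y},\mathcal{G})$ where $\mathcal{E},\mathcal{X},\mathcal{Y},\mathcal{G}$ are model categories and $\mathcal{XYG\rho}$ is a $G$-$\rho$-model category, and suppose that $\mathcal{T}riv(\mathbf{E})$, $\mathcal{T}riv^{\mathrm{Bun}}(\mathbf{B})$, $\mathcal{T}riv(\mathbf{X})$, $\mathcal{T}riv(\mathbf{Y})$, $\mathcal{T}riv(\mathbf{G})$ are full subcategories of $\mathcal{E},\mathcal{XYG\rho},\mathcal{X},\mathcal{Y},\mathcal{G}$ respectively. For $B=(E,X,Y,G,\pi,\rho)\in\mathbf{B}$ with group operation $\star:G\times G\to G$, and $A$ a maximal $\pi$-$G$-$\rho$-bundle atlas of $E$ in the coordinate space $X\times Y$, put $$M_B=\bigl(\mathrm{Triv}(E),\mathrm{Triv}^{G,\rho}(X,Y),X,Y,G\bigr),\quad F_B=(\pi,\pi_X,\pi_Y,\star,\rho),\quad \Sigma=\bigl((0,2),(1,2),(1,3),(4,4,4),(3,4,3)\bigr),$$ where $\pi_X,\pi_Y$ are the projections of $X\times Y$ onto $X$ and $Y$, and let $\mathcal{S}_B$ be the sequence of the singleton categories of the five members of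 $M_B$. Put $$\mathcal{F}(A,B)=(\mathcal{S}_B,M_B,A,F_B,\Sigma),\qquad \mathcal{F}^{\mathcal{M}}(A,B)=(\mathcal{M},M_B,A,F_B,\Sigma).$$ For a bundle map $f=(f_E,f_X,f_Y,f_G)$ from $(A^1,B^1)$ to $(A^2,B^2)$ put $\mathcal{F}(f,(A^1,B^1),(A^2,B^2))=\bigl((f_E,f_X\times f_Y,f_X,f_Y,f_G),\mathcal{F}(A^1,B^1),\mathcal{F}(A^2,B^2)\bigr)$, and define $\mathcal{F}^{\mathcal{M}}$ on morphisms in the same way with $\mathcal{F}^{\mathcal{M}}(A^i,B^i)$ in place of $\mathcal{F}(A^i,B^i)$. Let $\mathrm{LCS}^{\mathrm{Bun}}\mathbf{B}$ (respectively $\mathrm{LCS}^{\mathrm{Bun},\mathcal{M}}\mathbf{B}$) have as objects and morphisms the values of $\mathcal{F}$ (respectively $\mathcal{F}^{\mathcal{M}}$) on the objects and morphisms of $\mathrm{Bun}\,\mathbf{B}$, composed componentwise. Then: 1. $\mathcal{F}(A,B)$ is a local $\mathcal{S}_B$-$\Sigma$ coordinate space and $\mathcal{F}^{\mathcal{M}}(A,B)$ is a local $\mathcal{M}$-$\Sigma$ coordinate space. 2. $\mathrm{LCS}^{\mathrm{Bun}}\mathbf{B}$ and $\mathrm{LCS}^{\mathrm{Bun},\mathcal{M}}\mathbf{B}$ are categories, and the identity morphism of an object $L$ (equal to $\mathcal{F}(A,B)$, respectively $\mathcal{F}^{\mathcal{M}}(A,B)$) is $\bigl((\mathrm{Id}_E,\mathrm{Id}_{X\times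 Y},\mathrm{Id}_X,\mathrm{Id}_Y,\mathrm{Id}_G),L,L\bigr)$. 3. For every bundle map $f$ from $(A^1,B^1)$ to $(A^2,B^2)$, $\mathcal{F}(f,(A^1,B^1),(A^2,B^2))$ is a morphism of local coordinate spaces from $\mathcal{F}(A^1,B^1)$ to $\mathcal{F}(A^2,B^2)$, and $\mathcal{F}^{\mathcal{M}}(f,(A^1,B^1),(A^2,B^2))$ is a strict morphism from $\mathcal{F}^{\mathcal{M}}(A^1,B^1)$ to $\mathcal{F}^{\mathcal{M}}(A^2,B^2)$. 4. $\mathcal{F}$ is a functor from $\mathrm{Bun}\,\mathbf{B}$ to $\mathrm{LCS}^{\mathrm{Bun}}\mathbf{B}$ and $\mathcal{F}^{\mathcal{M}}$ is a functor from $\mathrm{Bun}\,\mathbf{B}$ to $\mathrm{LCS}^{\mathrm{Bun},\mathcal{M}}\mathbf{B}$.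
   Context: **Model spaces.** A model space is a pair $(S,\mathcal{S})$ where $S$ is a topological space and $\mathcal{S}$ is a small category whose objects are open subsets of $S$ and whose morphisms are continuous functions (composed as functions), such that: (1) $\mathrm{Ob}(\mathcal{S})$ is an open cover of $S$; (2) $\mathrm{Ob}(\mathcal{S})$ is closed under finite intersections; (3) if $f:A\to B$ is a morphism, $A'\subseteq A$ and $B'\subseteq B$ are objects and $f[A']\subseteq B'$, then $f|_{A'}:A'\to B'$ is a morphism; (4) inclusions $A'\hookrightarrow A$ of objects are morphisms; (5) if $f_\alpha:U_\alpha\to V_\alpha$ are morphisms, $U=\bigcup_\alpha U_\alpha$ and $V=\bigcup_\alpha V_\alpha$ are objects, and $f:U\to V$ is continuous and agrees with $f_\alpha$ on each $U_\alpha$, then $f$ is a morphism. Objects of $\mathcal{S}$ are model neighborhoods; each is itself regarded as a model space with the full subcategory of the model neighborhoods it contains. A model function is a continuous function such that inverse images of model neighborhoods are model neighborhoods and the image of every model neighborhood is contained in a model neighborhood; a model homeomorphism is an invertible model function whose inverse is a model function. $(X,\mathcal{X})$ is a model subspace of $(Y,\mathcal{Y})$ iff $X$ is a subspace of $Y$, $\mathcal{X}$ is a full subcategory of $\mathcal{Y}$, and every object of $\mathcal{Y}$ contained in $X$ is an object of $\mathcal{X}$. A model category is a small category whose objects are model spaces, whose morphisms are model functions, whose composition is composition of functions, which contains every model subspace of each of its objects together with the inclusion map, and such that if $(S^1,\mathcal{S}^1),(S^2,\mathcal{S}^2)$ are model subspaces of an object $(S,\mathcal{S})$ and $f:S^1\to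 S^2$ is a morphism of $\mathcal{S}$, then $f$ is a morphism of the model category. A topological category is a small subcategory of the category of topological spaces. The singleton category of a topological space $S$ has the single object $S$ and all continuous functions $S\to S$; the singleton category of a model space $(S,\mathcal{S})$ has that single object and all model functions $f$ from it to itself that are locally morphisms (each $u\in S$ has model neighborhoods $U\ni u$, $V\ni f(u)$ with $f[U]\subseteq V$ and $f:U\to V$ a morphism of $\mathcal{S}$). $\mathrm{Triv}(S)$, for a topological space $S$, is the model space $(S,\text{all continuous functions between open sets of }S)$. For a set $\mathbf{S}$ of topological spaces, $\mathcal{T}riv(\mathbf{S})$ is the category with objects $\mathrm{Triv}(S)$, $S\in\mathbf{S}$, and all continuous functions between them; this is applied to $\mathbf{E},\mathbf{X},\mathbf{Y}$ and (with the underlying spaces of the groups) $\mathbf{G}$. Where a topological space or group $X$, $Y$ or $G$ is said to be an object of a model category, it is identified with its trivial model space. **Protobundles and $G$-$\rho$ model spaces.** A protobundle is $(E,X,Y,G,\pi,\rho)$ with $E,X,Y$ topological spaces, $G$ a topological group, $\pi:E\to X$ a continuous surjection and $\rho:Y\times G\to Y$ a continuous effective right action, written $y\star g=\rho(y,g)$ and $(x,y)\star g=(x,y\star g)$. A $G$-$\rho$ model space of $X\times Y$ is a model space $(X\times Y,\mathcal{XY})$ whose objects are of the form $V\times Y$, $V\subseteq X$ non-empty open, and whose morphisms are fiber-preserving automorphisms generated by the group action, i.e. homeomorphisms $V\times Y\to V\times Y$ of the form $(x,y)\mapsto(x,y\star g(x))$ for some function $g:V\to G$. A $G^1$-$G^2$-$\rho^1$-$\rho^2$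 morphism between a $G^1$-$\rho^1$ model space of $X^1\times Y^1$ and a $G^2$-$\rho^2$ model space of $X^2\times Y^2$ is a model function $f_C$ for which there is a continuous homomorphism $f_G:G^1\to G^2$ with $f_C((x,y)\star g)=f_C(x,y)\star f_G(g)$ for all $x,y,g$. Given any family of topological spaces $X^\alpha,Y^\alpha$, topological groups $G^\alpha$, effective actions $\rho^\alpha$ of $G^\alpha$ on $Y^\alpha$ and $G^\alpha$-$\rho^\alpha$ model spaces $\mathbf{XY}^\alpha$ of $X^\alpha\times Y^\alpha$, consider the category whose objects are the tuples $(X^\alpha,Y^\alpha,G^\alpha,\rho^\alpha)$, each standing for the model space $\mathbf{XY}^\alpha$, and whose morphisms are all $G^\alpha$-$G^\beta$-$\rho^\alpha$-$\rho^\beta$ morphisms $f_C:X^\alpha\times Y^\alpha\to X^\beta\times Y^\beta$ from $\mathbf{XY}^\alpha$ to $\mathbf{XY}^\beta$; any subcategory of such a category is called a $G$-$\rho$-model category. The trivial model space $\mathrm{Triv}^{G,\rho}(X,Y)$ is $X\times Y$ with objects all $V\times Y$ ($V\subseteq X$ non-empty open) and morphisms all homeomorphisms $V\times Y\to V\times Y$ of the form $(x,y)\mapsto(x,y\star g(x))$, $g:V\to G$ a function. $\mathcal{T}riv^{\mathrm{Bun}}(\mathbf{B})$: objects $\mathrm{Triv}^{G,\rho}(X,Y)$ for $(E,X,Y,G,\pi,\rho)\in\mathbf{B}$, morphisms all $G^1$-$G^2$-$\rho^1$-$\rho^2$ morphisms between them. **Bundle atlases and $\mathrm{Bun}\,\mathbf{B}$.**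 A $Y$-$\pi$-bundle chart of $E$ in $X\times Y$ is $(U,V\times Y,\phi)$ with $U\subseteq E$ open, $V\times Y\subseteq X\times Y$ open and $\phi:U\to V\times Y$ a homeomorphism with $\pi_1\circ\phi=\pi$ ($\pi_1$ the projection onto the first factor). Two charts, indexed $\mu,\nu$, are $G$-$\rho$-compatible iff $U^\mu\cap U^\nu=\emptyset$ or there is a continuous $g:\pi_1[\phi^\nu[U^\mu\cap U^\nu]]\to G$ with $\phi^\mu\circ(\phi^\nu)^{-1}(x,y)=(x,y\star g(x))$ on $\phi^\nu[U^\mu\cap U^\nu]$. A $\pi$-$G$-$\rho$-bundle atlas is a set of mutually $G$-$\rho$-compatible charts whose domains cover $E$; it is maximal iff it cannot be extended by adding another $G$-$\rho$-compatible chart. Objects of $\mathrm{Bun}\,\mathbf{B}$ (fiber bundles) are pairs $(A,B)$, $B\in\mathbf{B}$, $A$ a maximal $\pi$-$G$-$\rho$-bundle atlas. A bundle map $(A^1,B^1)\to(A^2,B^2)$ is a quadruple of continuous functions $f_E:E^1\to E^2$, $f_X:X^1\to X^2$, $f_Y:Y^1\to Y^2$, $f_G:G^1\to G^2$ with $f_G$ a homomorphism, $\pi^2\circ f_E=f_X\circ\pi^1$, $f_Y(y)\star^2 f_G(g)=f_Y(y\star^1 g)$, and such that, with $f_1=f_X\times f_Y$, for all $(U^i,V^i,\phi^i)\in A^i$ and $x\in I:=U^1\cap f_E^{-1}[U^2]$ there are open $U'^1\subseteq I$, $V'^1\subseteq V^1$, $U'^2\subseteq U^2$, objects $V'^2\subseteq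 V^2$ and $\hat V'^2$ of the category of $\mathrm{Triv}^{G^2,\rho^2}(X^2,Y^2)$ and an isomorphism $\hat f:V'^2\to\hat V'^2$ of that category with $x\in U'^1$, $f_1(\phi^1(x))\in\hat V'^2$, $f_E[U'^1]\subseteq U'^2$, $\phi^1[U'^1]\subseteq V'^1$, $f_1[V'^1]\subseteq\hat V'^2$, $\phi^2[U'^2]\subseteq V'^2$, $\hat f\circ\phi^2\circ f_E=f_1\circ\phi^1$ on $U'^1$. Morphisms of $\mathrm{Bun}\,\mathbf{B}$ are triples $(f,(A^1,B^1),(A^2,B^2))$ with $f$ a bundle map, composed componentwise. **Local coordinate spaces.** For a sequence of categories $\mathcal{N}=(\mathcal{N}_0,\dots,\mathcal{N}_4)$, $(\mathcal{N},M,A,F,\Sigma)$ (with no truth-valued constraint functions in $F$, as is the case here) is a local $\mathcal{N}$-$\Sigma$ coordinate space iff each $\mathcal{N}_\alpha$ is a topological or a model category, $\mathcal{N}_1$ is a model category, $M_\alpha\in\mathrm{Ob}(\mathcal{N}_\alpha)$ for all $\alpha$, the functions in $F$ are continuous with signatures given by $\Sigma$ (a signature $(\alpha_0,\dots,\alpha_n)$ means a function $M_{\alpha_0}\times\dots\times M_{\alpha_{n-1}}\to M_{\alpha_n}$), and $A$ is a maximal m-atlas of $M_0$ in the coordinate space $M_1$. (For model spaces $M_0,M_1$, m-charts are triples $(U,V,\phi)$ with $U,V$ model neighborhoods of $M_0,M_1$ and $\phi:U\to V$ a model homeomorphism; two are m-compatible iff the domains are disjoint or $\phi'\circ\phi^{-1}:\phi[U\cap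 U']\to\phi'[U\cap U']$ is an isomorphism of the category of the model space $M_1$; an m-atlas is a set of mutually m-compatible m-charts whose domains cover $M_0$, maximal iff no further m-compatible m-chart can be added.) A morphism from $(\mathcal{N}^1,M^1,A^1,F^1,\Sigma)$ to $(\mathcal{N}^2,M^2,A^2,F^2,\Sigma)$ is a sequence $(f_\alpha:M^1_\alpha\to M^2_\alpha)$ of continuous functions (model functions when $M^1_\alpha,M^2_\alpha$ are model spaces) such that for each signature $(\alpha_0,\dots,\alpha_n)$ in $\Sigma$ and corresponding $F^1_\gamma,F^2_\gamma$, $f_{\alpha_n}\circ F^1_\gamma=F^2_\gamma\circ(f_{\alpha_0}\times\dots\times f_{\alpha_{n-1}})$, and $(f_0,f_1)$ is an m-atlas morphism: for all $(U^i,V^i,\phi^i)\in A^i$ and $x\in I:=U^1\cap f_0^{-1}[U^2]$ there are model neighborhoods $U'^1\subseteq I$, $V'^1\subseteq V^1$, $U'^2\subseteq U^2$, $V'^2\subseteq V^2$, $\hat V'^2\subseteq M^2_1$ and an isomorphism $\hat f:V'^2\to\hat V'^2$ of the category of $M^2_1$ satisfying the seven conditions above with $f_0$ in place of $f_E$. If $\mathcal{N}^1=\mathcal{N}^2=\mathcal{N}$, it is strict iff each $f_\alpha$ is a morphism of $\mathcal{N}_\alpha$.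
   Formalization: Repaired: G-ρ spaces allow empty V and inclusions; Triv^{G,ρ} uses continuous g; an m-chart's inverse need only be continuous; m-compatible: transition restricts an isomorphism; local coordinate spaces allow model-space categories not closed under subspaces. *)

theory Defs
  imports "HOL-Analysis.Analysis" "HOL-Algebra.Group"
begin

section \<open>Categories\<close>

text \<open>
  Every morphism is a triple \<open>(f, a, b)\<close> carrying its source and its target. Functions are extensional
  in the sense of \<open>FuncSet\<close>, so that equality of functions is equality of graphs and composition
  is \<open>compose\<close>. Categories are sets of objects and of arrows, hence small.
\<close>

type_synonym ('o, 'm) arrow = "'m \<times> 'o \<times> 'o"

record ('o, 'm) cat =
  Ob :: "'o set"
  Ar :: "('o, 'm) arrow set"

type_synonym ('o, 'm) composition = "('o, 'm) arrow \<Rightarrow> ('o, 'm) arrow \<Rightarrow> ('o, 'm) arrow"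

definition identity_arrow ::
  "('o, 'm) composition \<Rightarrow> ('o, 'm) cat \<Rightarrow> 'o \<Rightarrow> ('o, 'm) arrow \<Rightarrow> bool" where
  "identity_arrow cmp C a i \<longleftrightarrow>
     i \<in> Ar C \<and> (\<exists>e. i = (e, a, a)) \<and>
     (\<forall>f b. (f, a, b) \<in> Ar C \<longrightarrow> cmp (f, a, b) i = (f, a, b)) \<and>
     (\<forall>f b. (f, b, a) \<in> Ar C \<longrightarrow> cmp i (f, b, a) = (f, b, a))"

definition category :: "('o, 'm) composition \<Rightarrow> ('o, 'm) cat \<Rightarrow> bool" where
  "category cmp C \<longleftrightarrow>
     (\<forall>f a b. (f, a, b) \<in> Ar C \<longrightarrow> a \<in> Ob C \<and> b \<in> Ob C) \<and>
     (\<forall>f g a b c. (f, a, b) \<in> Ar C \<longrightarrow> (g, b, c) \<in> Ar C \<longrightarrow>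
        (\<exists>h. cmp (g, b, c) (f, a, b) = (h, a, c) \<and> (h, a, c) \<in> Ar C)) \<and>
     (\<forall>f g h a b c d. (f, a, b) \<in> Ar C \<longrightarrow> (g, b, c) \<in> Ar C \<longrightarrow> (h, c, d) \<in> Ar C \<longrightarrow>
        cmp (h, c, d) (cmp (g, b, c) (f, a, b)) = cmp (cmp (h, c, d) (g, b, c)) (f, a, b)) \<and>
     (\<forall>a \<in> Ob C. \<exists>i. identity_arrow cmp C a i)"

definition is_functor ::
  "('o, 'm) composition \<Rightarrow> ('o, 'm) cat \<Rightarrow> ('p, 'n) composition \<Rightarrow> ('p, 'n) cat \<Rightarrow>
   ('o \<Rightarrow> 'p) \<Rightarrow> (('o, 'm) arrow \<Rightarrow> ('p, 'n) arrow) \<Rightarrow> bool" where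
  "is_functor cmpC C cmpD D Fo Fa \<longleftrightarrow>
     category cmpC C \<and> category cmpD D \<and>
     (\<forall>a \<in> Ob C. Fo a \<in> Ob D) \<and>
     (\<forall>f a b. (f, a, b) \<in> Ar C \<longrightarrow>
        Fa (f, a, b) \<in> Ar D \<and> (\<exists>f'. Fa (f, a, b) = (f', Fo a, Fo b))) \<and>
     (\<forall>a \<in> Ob C. \<forall>i. identity_arrow cmpC C a i \<longrightarrow> identity_arrow cmpD D (Fo a) (Fa i)) \<and>
     (\<forall>f g a b c. (f, a, b) \<in> Ar C \<longrightarrow> (g, b, c) \<in> Ar C \<longrightarrow>
        Fa (cmpC (g, b, c) (f, a, b)) = cmpD (Fa (g, b, c)) (Fa (f, a, b)))"

definition image_cat ::
  "('o \<Rightarrow> 'p) \<Rightarrow> (('o, 'm) arrow \<Rightarrow> ('p, 'n) arrow) \<Rightarrow> ('o, 'm) cat \<Rightarrow> ('p, 'n) cat" where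
  "image_cat Fo Fa C = \<lparr>Ob = Fo ` Ob C, Ar = Fa ` Ar C\<rparr>"

text \<open>Categories of functions; \<open>pts a\<close> is the set of points of the object \<open>a\<close>.\<close>

definition fun_comp :: "('o \<Rightarrow> 'p set) \<Rightarrow> ('o, 'p \<Rightarrow> 'p) composition" where
  "fun_comp pts = (\<lambda>(g, b, c) (f, a, b'). (compose (pts a) g f, a, c))"

definition fun_category :: "('o \<Rightarrow> 'p set) \<Rightarrow> ('o, 'p \<Rightarrow> 'p) cat \<Rightarrow> bool" where
  "fun_category pts C \<longleftrightarrow>
     category (fun_comp pts) C \<and>
     (\<forall>f a b. (f, a, b) \<in> Ar C \<longrightarrow> f \<in> pts a \<rightarrow>\<^sub>E pts b) \<and>
     (\<forall>a \<in> Ob C. (\<lambda>x\<in>pts a. x, a, a) \<in> Ar C)"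

definition fun_iso ::
  "('o \<Rightarrow> 'p set) \<Rightarrow> ('o, 'p \<Rightarrow> 'p) cat \<Rightarrow> ('p \<Rightarrow> 'p) \<Rightarrow> 'o \<Rightarrow> 'o \<Rightarrow> bool" where
  "fun_iso pts C f a b \<longleftrightarrow>
     (f, a, b) \<in> Ar C \<and>
     (\<exists>g. (g, b, a) \<in> Ar C \<and>
        compose (pts a) g f = (\<lambda>x\<in>pts a. x) \<and> compose (pts b) f g = (\<lambda>x\<in>pts b. x))"

definition subcategory ::
  "('o \<Rightarrow> 'p set) \<Rightarrow> ('o, 'p \<Rightarrow> 'p) cat \<Rightarrow> ('o, 'p \<Rightarrow> 'p) cat \<Rightarrow> bool" where
  "subcategory pts C D \<longleftrightarrow> fun_category pts C \<and> Ob C \<subseteq> Ob D \<and> Ar C \<subseteq> Ar D"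

definition full_subcategory ::
  "('o \<Rightarrow> 'p set) \<Rightarrow> ('o, 'p \<Rightarrow> 'p) cat \<Rightarrow> ('o, 'p \<Rightarrow> 'p) cat \<Rightarrow> bool" where
  "full_subcategory pts C D \<longleftrightarrow>
     subcategory pts C D \<and>
     (\<forall>f a b. (f, a, b) \<in> Ar D \<longrightarrow> a \<in> Ob C \<longrightarrow> b \<in> Ob C \<longrightarrow> (f, a, b) \<in> Ar C)"


section \<open>Model spaces\<close>

record 'p mspace =
  spc :: "'p topology"
  nbs :: "('p set, 'p \<Rightarrow> 'p) cat"

text \<open>
  An object of the category of a model space is its own set of points, so \<open>pts\<close> is the
  identity \<open>\<lambda>U. U\<close>. ``Closed under finite intersections'' is read as closed under binary ones;
  the whole space need not be a model neighborhood.
\<close>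

definition model_space :: "'p mspace \<Rightarrow> bool" where
  "model_space S \<longleftrightarrow>
     fun_category (\<lambda>U. U) (nbs S) \<and>
     (\<forall>U \<in> Ob (nbs S). openin (spc S) U) \<and>
     (\<forall>f U V. (f, U, V) \<in> Ar (nbs S) \<longrightarrow>
        continuous_map (subtopology (spc S) U) (subtopology (spc S) V) f) \<and>
     \<Union> (Ob (nbs S)) = topspace (spc S) \<and>
     (\<forall>U \<in> Ob (nbs S). \<forall>V \<in> Ob (nbs S). U \<inter> V \<in> Ob (nbs S)) \<and>
     (\<forall>f U V U' V'. (f, U, V) \<in> Ar (nbs S) \<longrightarrow> U' \<in> Ob (nbs S) \<longrightarrow> V' \<in> Ob (nbs S) \<longrightarrow>
        U' \<subseteq> U \<longrightarrow> V' \<subseteq> V \<longrightarrow> f ` U' \<subseteq> V' \<longrightarrow> (restrict f U', U', V') \<in> Ar (nbs S)) \<and>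
     (\<forall>U \<in> Ob (nbs S). \<forall>U' \<in> Ob (nbs S). U' \<subseteq> U \<longrightarrow> (\<lambda>x\<in>U'. x, U', U) \<in> Ar (nbs S)) \<and>
     (\<forall>\<F> f U V. \<F> \<subseteq> Ar (nbs S) \<longrightarrow>
        U = (\<Union>(h, U', V')\<in>\<F>. U') \<longrightarrow> V = (\<Union>(h, U', V')\<in>\<F>. V') \<longrightarrow>
        U \<in> Ob (nbs S) \<longrightarrow> V \<in> Ob (nbs S) \<longrightarrow>
        f \<in> extensional U \<longrightarrow>
        continuous_map (subtopology (spc S) U) (subtopology (spc S) V) f \<longrightarrow>
        (\<forall>(h, U', V')\<in>\<F>. \<forall>x\<in>U'. f x = h x) \<longrightarrow>
        (f, U, V) \<in> Ar (nbs S))"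

definition nb_space :: "'p mspace \<Rightarrow> 'p set \<Rightarrow> 'p mspace" where
  "nb_space S A =
     \<lparr>spc = subtopology (spc S) A,
      nbs = \<lparr>Ob = {U \<in> Ob (nbs S). U \<subseteq> A},
             Ar = {(f, U, V). (f, U, V) \<in> Ar (nbs S) \<and> U \<subseteq> A \<and> V \<subseteq> A}\<rparr>\<rparr>"

definition model_function :: "'p mspace \<Rightarrow> 'p mspace \<Rightarrow> ('p \<Rightarrow> 'p) \<Rightarrow> bool" where
  "model_function S T f \<longleftrightarrow>
     f \<in> extensional (topspace (spc S)) \<and>
     continuous_map (spc S) (spc T) f \<and>
     (\<forall>V \<in> Ob (nbs T). {x \<in> topspace (spc S). f x \<in> V} \<in> Ob (nbs S)) \<and>
     (\<forall>U \<in> Ob (nbs S). \<exists>V \<in> Ob (nbs T). f ` U \<subseteq> V)"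

definition local_morphism :: "'p mspace \<Rightarrow> ('p \<Rightarrow> 'p) \<Rightarrow> bool" where
  "local_morphism S f \<longleftrightarrow>
     (\<forall>u \<in> topspace (spc S). \<exists>U \<in> Ob (nbs S). \<exists>V \<in> Ob (nbs S).
        u \<in> U \<and> f u \<in> V \<and> f ` U \<subseteq> V \<and> (restrict f U, U, V) \<in> Ar (nbs S))"

definition model_subspace :: "'p mspace \<Rightarrow> 'p mspace \<Rightarrow> bool" where
  "model_subspace S T \<longleftrightarrow>
     model_space S \<and>
     topspace (spc S) \<subseteq> topspace (spc T) \<and>
     spc S = subtopology (spc T) (topspace (spc S)) \<and>
     full_subcategory (\<lambda>U. U) (nbs S) (nbs T) \<and>
     (\<forall>U \<in> Ob (nbs T). U \<subseteq> topspace (spc S) \<longrightarrow> U \<in> Ob (nbs S))"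

definition triv :: "'p topology \<Rightarrow> 'p mspace" where
  "triv T =
     \<lparr>spc = T,
      nbs = \<lparr>Ob = {U. openin T U},
             Ar = {(f, U, V). openin T U \<and> openin T V \<and> f \<in> extensional U \<and>
                     continuous_map (subtopology T U) (subtopology T V) f}\<rparr>\<rparr>"


section \<open>Product spaces, topological groups and actions\<close>

text \<open>
  The members of the sequences below (total space, coordinate space \<open>X \<times> Y\<close>, base, fiber, group)
  must have points of one type. That type is closed under ordered pairs, and the product of two
  spaces is the library's \<open>prod_topology\<close> transported along \<open>Tup\<close>. Every set of spaces
  embeds via \<open>Atom\<close>.
\<close>

datatype 'a point = Atom 'a | Tup (pfst: "'a point") (psnd: "'a point")

definition ptimes :: "'a point set \<Rightarrow> 'a point set \<Rightarrow> 'a point set" where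
  "ptimes A B = (\<lambda>(x, y). Tup x y) ` (A \<times> B)"

definition pprod :: "'a point topology \<Rightarrow> 'a point topology \<Rightarrow> 'a point topology" where
  "pprod X Y =
     pullback_topology (ptimes (topspace X) (topspace Y)) (\<lambda>p. (pfst p, psnd p)) (prod_topology X Y)"

definition pmap ::
  "'a point topology \<Rightarrow> 'a point topology \<Rightarrow> ('a point \<Rightarrow> 'a point) \<Rightarrow> ('a point \<Rightarrow> 'a point) \<Rightarrow>
   'a point \<Rightarrow> 'a point" where
  "pmap X Y f g = (\<lambda>p\<in>ptimes (topspace X) (topspace Y). Tup (f (pfst p)) (g (psnd p)))"

record 'p tgroup =
  gtop :: "'p topology"
  grp :: "'p monoid"

definition topological_group :: "'p tgroup \<Rightarrow> bool" where
  "topological_group G \<longleftrightarrow>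
     group (grp G) \<and> carrier (grp G) = topspace (gtop G) \<and>
     continuous_map (prod_topology (gtop G) (gtop G)) (gtop G) (\<lambda>(g, h). g \<otimes>\<^bsub>grp G\<^esub> h) \<and>
     continuous_map (gtop G) (gtop G) (\<lambda>g. inv\<^bsub>grp G\<^esub> g)"

definition cont_hom :: "'p tgroup \<Rightarrow> 'p tgroup \<Rightarrow> ('p \<Rightarrow> 'p) \<Rightarrow> bool" where
  "cont_hom G H f \<longleftrightarrow> f \<in> hom (grp G) (grp H) \<and> continuous_map (gtop G) (gtop H) f"

definition effective_action :: "'p topology \<Rightarrow> 'p tgroup \<Rightarrow> ('p \<times> 'p \<Rightarrow> 'p) \<Rightarrow> bool" where
  "effective_action Y G \<rho> \<longleftrightarrow>
     \<rho> \<in> extensional (topspace Y \<times> topspace (gtop G)) \<and>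
     continuous_map (prod_topology Y (gtop G)) Y \<rho> \<and>
     (\<forall>y \<in> topspace Y. \<rho> (y, \<one>\<^bsub>grp G\<^esub>) = y) \<and>
     (\<forall>y \<in> topspace Y. \<forall>g \<in> topspace (gtop G). \<forall>h \<in> topspace (gtop G).
        \<rho> (\<rho> (y, g), h) = \<rho> (y, g \<otimes>\<^bsub>grp G\<^esub> h)) \<and>
     (\<forall>g \<in> topspace (gtop G). (\<forall>y \<in> topspace Y. \<rho> (y, g) = y) \<longrightarrow> g = \<one>\<^bsub>grp G\<^esub>)"

text \<open>\<open>act \<rho> (Tup x y) g\<close> is \<open>(x, y) \<star> g = (x, y \<star> g)\<close>.\<close>

definition act :: "('a point \<times> 'a point \<Rightarrow> 'a point) \<Rightarrow> 'a point \<Rightarrow> 'a point \<Rightarrow> 'a point" where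
  "act \<rho> p g = Tup (pfst p) (\<rho> (psnd p, g))"


section \<open>Objects of topological categories, model categories and G-rho-model categories\<close>

text \<open>
  An object is a topological space, a model space, or a tuple \<open>(X, Y, G, \<rho>)\<close> standing for the
  model space \<open>S\<close> of \<open>X \<times> Y\<close>. A topological space regarded as an object of a model category is
  identified with its trivial model space.
\<close>

datatype 'a obj =
    TopObj "'a point topology"
  | ModObj "'a point mspace"
  | ActObj "'a point topology" "'a point topology" "'a point tgroup"
      "'a point \<times> 'a point \<Rightarrow> 'a point" "'a point mspace"

fun msp :: "'a obj \<Rightarrow> 'a point mspace" where
  "msp (TopObj T) = triv T"
| "msp (ModObj S) = S"
| "msp (ActObj X Y G \<rho> S) = S"

fun is_top :: "'a obj \<Rightarrow> bool" where
  "is_top (TopObj T) = True"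
| "is_top (ModObj S) = False"
| "is_top (ActObj X Y G \<rho> S) = False"

fun triv_ident :: "'a obj \<Rightarrow> 'a obj" where
  "triv_ident (TopObj T) = ModObj (triv T)"
| "triv_ident (ModObj S) = ModObj S"
| "triv_ident (ActObj X Y G \<rho> S) = ActObj X Y G \<rho> S"

definition top_of :: "'a obj \<Rightarrow> 'a point topology" where
  "top_of a = spc (msp a)"

definition pts :: "'a obj \<Rightarrow> 'a point set" where
  "pts a = topspace (top_of a)"

type_synonym 'a ocat = "('a obj, 'a point \<Rightarrow> 'a point) cat"

definition topological_category :: "'a ocat \<Rightarrow> bool" where
  "topological_category C \<longleftrightarrow>
     fun_category pts C \<and> (\<forall>a \<in> Ob C. is_top a) \<and>
     (\<forall>f a b. (f, a, b) \<in> Ar C \<longrightarrow> continuous_map (top_of a) (top_of b) f)"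

text \<open>
  A category of model spaces and model functions need not contain the model subspaces of its
  objects; a model category does.
\<close>

definition model_function_category :: "'a ocat \<Rightarrow> bool" where
  "model_function_category C \<longleftrightarrow>
     fun_category pts C \<and> (\<forall>a \<in> Ob C. \<not> is_top a \<and> model_space (msp a)) \<and>
     (\<forall>f a b. (f, a, b) \<in> Ar C \<longrightarrow> model_function (msp a) (msp b) f)"

definition model_category :: "'a ocat \<Rightarrow> bool" where
  "model_category C \<longleftrightarrow>
     model_function_category C \<and> Ob C \<subseteq> range ModObj \<and>
     (\<forall>S T. ModObj S \<in> Ob C \<longrightarrow> model_subspace T S \<longrightarrow>
        ModObj T \<in> Ob C \<and> (\<lambda>x\<in>topspace (spc T). x, ModObj T, ModObj S) \<in> Ar C) \<and>
     (\<forall>S S1 S2 f. ModObj S \<in> Ob C \<longrightarrow> model_subspace S1 S \<longrightarrow> model_subspace S2 S \<longrightarrow>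
        (f, topspace (spc S1), topspace (spc S2)) \<in> Ar (nbs S) \<longrightarrow>
        (f, ModObj S1, ModObj S2) \<in> Ar C)"

definition singleton_cat :: "'a obj \<Rightarrow> 'a ocat" where
  "singleton_cat a =
     \<lparr>Ob = {a},
      Ar = {(f, b, c). b = a \<and> c = a \<and>
              (if is_top a
               then f \<in> extensional (pts a) \<and> continuous_map (top_of a) (top_of a) f
               else model_function (msp a) (msp a) f \<and> local_morphism (msp a) f)}\<rparr>"

definition triv_cat :: "'a point topology set \<Rightarrow> 'a ocat" where
  "triv_cat \<S> =
     \<lparr>Ob = (\<lambda>T. ModObj (triv T)) ` \<S>,
      Ar = {(f, ModObj (triv S), ModObj (triv T)) | f S T.
              S \<in> \<S> \<and> T \<in> \<S> \<and> f \<in> extensional (topspace S) \<and> continuous_map S T f}\<rparr>"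


section \<open>Protobundles and G-rho model spaces\<close>

record 'a protobundle =
  bE :: "'a point topology"
  bX :: "'a point topology"
  bY :: "'a point topology"
  bG :: "'a point tgroup"
  bpi :: "'a point \<Rightarrow> 'a point"
  brho :: "'a point \<times> 'a point \<Rightarrow> 'a point"

definition protobundle :: "'a protobundle \<Rightarrow> bool" where
  "protobundle B \<longleftrightarrow>
     topological_group (bG B) \<and>
     bpi B \<in> extensional (topspace (bE B)) \<and>
     continuous_map (bE B) (bX B) (bpi B) \<and>
     bpi B ` topspace (bE B) = topspace (bX B) \<and>
     effective_action (bY B) (bG B) (brho B)"

text \<open>
  A G-rho model space is required to be a model space. Its objects \<open>V \<times> Y\<close> therefore include the
  empty one (intersections, and inverse images under model functions, may be empty), and its
  morphisms are the group-generated automorphisms \<open>V \<times> Y \<rightarrow> V \<times> Y\<close> followed by inclusions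
  \<open>V \<times> Y \<hookrightarrow> W \<times> Y\<close>: inclusions of objects are morphisms, and morphisms compose. The morphisms
  with \<open>V = W\<close>, and in particular all isomorphisms, are exactly the automorphisms.
\<close>

definition group_shift ::
  "'a point topology \<Rightarrow> 'a point topology \<Rightarrow> ('a point \<times> 'a point \<Rightarrow> 'a point) \<Rightarrow>
   'a point set \<Rightarrow> ('a point \<Rightarrow> 'a point) \<Rightarrow> ('a point \<Rightarrow> 'a point) \<Rightarrow> bool" where
  "group_shift X Y \<rho> V g f \<longleftrightarrow>
     f = (\<lambda>p\<in>ptimes V (topspace Y). act \<rho> p (g (pfst p))) \<and>
     homeomorphic_map (subtopology (pprod X Y) (ptimes V (topspace Y)))
                      (subtopology (pprod X Y) (ptimes V (topspace Y))) f"

definition grho_model_space ::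
  "'a point topology \<Rightarrow> 'a point topology \<Rightarrow> 'a point tgroup \<Rightarrow>
   ('a point \<times> 'a point \<Rightarrow> 'a point) \<Rightarrow> 'a point mspace \<Rightarrow> bool" where
  "grho_model_space X Y G \<rho> S \<longleftrightarrow>
     model_space S \<and> spc S = pprod X Y \<and>
     (\<forall>U \<in> Ob (nbs S). \<exists>V. openin X V \<and> U = ptimes V (topspace Y)) \<and>
     (\<forall>f U U'. (f, U, U') \<in> Ar (nbs S) \<longrightarrow>
        (\<exists>V W g. openin X V \<and> openin X W \<and> V \<subseteq> W \<and>
           U = ptimes V (topspace Y) \<and> U' = ptimes W (topspace Y) \<and>
           g \<in> V \<rightarrow> topspace (gtop G) \<and> group_shift X Y \<rho> V g f))"

text \<open>
  The function \<open>g\<close> is taken to be continuous, as in the compatibility of bundle charts. For groups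
  whose topology is finer than the action detects (for example a discrete group of translations)
  the shift can be a homeomorphism although \<open>g\<close> is not continuous, and a maximal bundle atlas
  would then fail to be a maximal m-atlas.
\<close>

definition triv_grho ::
  "'a point topology \<Rightarrow> 'a point topology \<Rightarrow> 'a point tgroup \<Rightarrow>
   ('a point \<times> 'a point \<Rightarrow> 'a point) \<Rightarrow> 'a point mspace" where
  "triv_grho X Y G \<rho> =
     \<lparr>spc = pprod X Y,
      nbs = \<lparr>Ob = {ptimes V (topspace Y) | V. openin X V},
             Ar = {(f, ptimes V (topspace Y), ptimes W (topspace Y)) | f V W.
                     openin X V \<and> openin X W \<and> V \<subseteq> W \<and>
                     (\<exists>g. continuous_map (subtopology X V) (gtop G) g \<and>
                          group_shift X Y \<rho> V g f)}\<rparr>\<rparr>"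

fun grho_obj :: "'a obj \<Rightarrow> bool" where
  "grho_obj (TopObj T) = False"
| "grho_obj (ModObj S) = False"
| "grho_obj (ActObj X Y G \<rho> S) =
     (topological_group G \<and> effective_action Y G \<rho> \<and> grho_model_space X Y G \<rho> S)"

fun grho_morphism :: "'a obj \<Rightarrow> 'a obj \<Rightarrow> ('a point \<Rightarrow> 'a point) \<Rightarrow> bool" where
  "grho_morphism (ActObj X1 Y1 G1 \<rho>1 S1) (ActObj X2 Y2 G2 \<rho>2 S2) f =
     (model_function S1 S2 f \<and>
      (\<exists>h. cont_hom G1 G2 h \<and>
         (\<forall>p \<in> ptimes (topspace X1) (topspace Y1). \<forall>g \<in> topspace (gtop G1).
            f (act \<rho>1 p g) = act \<rho>2 (f p) (h g))))"
| "grho_morphism _ _ f = False"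

definition grho_cat :: "'a obj set \<Rightarrow> 'a ocat" where
  "grho_cat P = \<lparr>Ob = P, Ar = {(f, a, b). a \<in> P \<and> b \<in> P \<and> grho_morphism a b f}\<rparr>"

definition grho_model_category :: "'a ocat \<Rightarrow> bool" where
  "grho_model_category C \<longleftrightarrow>
     (\<exists>P. (\<forall>a \<in> P. grho_obj a) \<and> subcategory pts C (grho_cat P))"

definition coord_obj :: "'a protobundle \<Rightarrow> 'a obj" where
  "coord_obj B =
     ActObj (bX B) (bY B) (bG B) (brho B) (triv_grho (bX B) (bY B) (bG B) (brho B))"

definition triv_bun_cat :: "'a protobundle set \<Rightarrow> 'a ocat" where
  "triv_bun_cat \<B> = grho_cat (coord_obj ` \<B>)"


section \<open>Atlases\<close>

type_synonym 'p chart = "'p set \<times> 'p set \<times> ('p \<Rightarrow> 'p)"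

definition transition :: "'p chart \<Rightarrow> 'p chart \<Rightarrow> 'p \<Rightarrow> 'p" where
  "transition = (\<lambda>(U, V, \<phi>) (U', V', \<phi>') p. \<phi> (inv_into U' \<phi>' p))"

text \<open>
  The seven conditions shared by bundle maps and m-atlas morphisms.
\<close>

definition local_square ::
  "'p \<Rightarrow> 'p set \<Rightarrow> 'p set \<Rightarrow> 'p set \<Rightarrow> 'p set \<Rightarrow> 'p set \<Rightarrow> ('p \<Rightarrow> 'p) \<Rightarrow>
   ('p \<Rightarrow> 'p) \<Rightarrow> ('p \<Rightarrow> 'p) \<Rightarrow> ('p \<Rightarrow> 'p) \<Rightarrow> ('p \<Rightarrow> 'p) \<Rightarrow> bool" where
  "local_square x U1' V1' U2' V2' V2h fh \<phi>1 \<phi>2 f0 f1 \<longleftrightarrow>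
     x \<in> U1' \<and> f1 (\<phi>1 x) \<in> V2h \<and> f0 ` U1' \<subseteq> U2' \<and> \<phi>1 ` U1' \<subseteq> V1' \<and> f1 ` V1' \<subseteq> V2h \<and>
     \<phi>2 ` U2' \<subseteq> V2' \<and> (\<forall>u \<in> U1'. fh (\<phi>2 (f0 u)) = f1 (\<phi>1 u))"

subsection \<open>m-atlases\<close>

text \<open>
  A chart is a model function that is a homeomorphism. Its inverse is not required to be a model
  function: the model neighborhoods of \<open>triv E\<close> are all open sets of \<open>E\<close>, and a bundle chart maps
  only some of them onto sets of the form \<open>V \<times> Y\<close>. Correspondingly \<open>\<phi>[U \<inter> U']\<close> need not be a
  model neighborhood, and a transition function is required to be the restriction of an isomorphism of
  the category of the coordinate space. If \<open>\<phi>[U \<inter> U']\<close> and \<open>\<phi>'[U \<inter> U']\<close> are model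
  neighborhoods, this says that it is itself an isomorphism (closure of the morphisms of a model
  space under restriction).
\<close>

definition m_chart :: "'p mspace \<Rightarrow> 'p mspace \<Rightarrow> 'p chart \<Rightarrow> bool" where
  "m_chart S T = (\<lambda>(U, V, \<phi>).
     U \<in> Ob (nbs S) \<and> V \<in> Ob (nbs T) \<and>
     model_function (nb_space S U) (nb_space T V) \<phi> \<and>
     homeomorphic_map (subtopology (spc S) U) (subtopology (spc T) V) \<phi>)"

definition m_compatible :: "'p mspace \<Rightarrow> 'p chart \<Rightarrow> 'p chart \<Rightarrow> bool" where
  "m_compatible T = (\<lambda>(U, V, \<phi>) (U', V', \<phi>').
     U \<inter> U' = {} \<or>
     (\<exists>h W W'. fun_iso (\<lambda>A. A) (nbs T) h W W' \<and>
        \<phi> ` (U \<inter> U') \<subseteq> W \<and> \<phi>' ` (U \<inter> U') \<subseteq> W' \<and>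
        (\<forall>p \<in> \<phi> ` (U \<inter> U'). h p = transition (U', V', \<phi>') (U, V, \<phi>) p)))"

definition m_atlas :: "'p mspace \<Rightarrow> 'p mspace \<Rightarrow> 'p chart set \<Rightarrow> bool" where
  "m_atlas S T A \<longleftrightarrow>
     (\<forall>c \<in> A. m_chart S T c) \<and>
     (\<forall>c \<in> A. \<forall>c' \<in> A. m_compatible T c c') \<and>
     (\<Union>(U, V, \<phi>)\<in>A. U) = topspace (spc S)"

definition maximal_m_atlas :: "'p mspace \<Rightarrow> 'p mspace \<Rightarrow> 'p chart set \<Rightarrow> bool" where
  "maximal_m_atlas S T A \<longleftrightarrow>
     m_atlas S T A \<and> (\<forall>c. m_atlas S T (insert c A) \<longrightarrow> c \<in> A)"

definition m_atlas_morphism ::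
  "'p mspace \<Rightarrow> 'p chart set \<Rightarrow> 'p mspace \<Rightarrow> 'p mspace \<Rightarrow> 'p chart set \<Rightarrow> 'p mspace \<Rightarrow>
   ('p \<Rightarrow> 'p) \<Rightarrow> ('p \<Rightarrow> 'p) \<Rightarrow> bool" where
  "m_atlas_morphism S1 A1 T1 S2 A2 T2 f0 f1 \<longleftrightarrow>
     (\<forall>(U1, V1, \<phi>1) \<in> A1. \<forall>(U2, V2, \<phi>2) \<in> A2. \<forall>x \<in> {u \<in> U1. f0 u \<in> U2}.
        \<exists>U1' \<in> Ob (nbs S1). \<exists>V1' \<in> Ob (nbs T1). \<exists>U2' \<in> Ob (nbs S2).
        \<exists>V2' \<in> Ob (nbs T2). \<exists>V2h \<in> Ob (nbs T2). \<exists>fh.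
          U1' \<subseteq> {u \<in> U1. f0 u \<in> U2} \<and> V1' \<subseteq> V1 \<and> U2' \<subseteq> U2 \<and> V2' \<subseteq> V2 \<and>
          fun_iso (\<lambda>A. A) (nbs T2) fh V2' V2h \<and>
          local_square x U1' V1' U2' V2' V2h fh \<phi>1 \<phi>2 f0 f1)"

subsection \<open>Bundle atlases\<close>

definition bundle_chart :: "'a protobundle \<Rightarrow> 'a point chart \<Rightarrow> bool" where
  "bundle_chart B = (\<lambda>(U, W, \<phi>).
     openin (bE B) U \<and>
     (\<exists>V \<subseteq> topspace (bX B). W = ptimes V (topspace (bY B))) \<and>
     openin (pprod (bX B) (bY B)) W \<and>
     \<phi> \<in> extensional U \<and>
     homeomorphic_map (subtopology (bE B) U) (subtopology (pprod (bX B) (bY B)) W) \<phi> \<and>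
     (\<forall>u \<in> U. pfst (\<phi> u) = bpi B u))"

definition grho_compatible ::
  "'a protobundle \<Rightarrow> 'a point chart \<Rightarrow> 'a point chart \<Rightarrow> bool" where
  "grho_compatible B = (\<lambda>(U, V, \<phi>) (U', V', \<phi>').
     U \<inter> U' = {} \<or>
     (\<exists>g. continuous_map (subtopology (bX B) (pfst ` \<phi>' ` (U \<inter> U'))) (gtop (bG B)) g \<and>
        (\<forall>p \<in> \<phi>' ` (U \<inter> U').
           transition (U, V, \<phi>) (U', V', \<phi>') p = act (brho B) p (g (pfst p)))))"

definition bundle_atlas :: "'a protobundle \<Rightarrow> 'a point chart set \<Rightarrow> bool" where
  "bundle_atlas B A \<longleftrightarrow>
     (\<forall>c \<in> A. bundle_chart B c) \<and>
     (\<forall>c \<in> A. \<forall>c' \<in> A. grho_compatible B c c') \<and>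
     (\<Union>(U, V, \<phi>)\<in>A. U) = topspace (bE B)"

definition maximal_bundle_atlas :: "'a protobundle \<Rightarrow> 'a point chart set \<Rightarrow> bool" where
  "maximal_bundle_atlas B A \<longleftrightarrow>
     bundle_atlas B A \<and> (\<forall>c. bundle_atlas B (insert c A) \<longrightarrow> c \<in> A)"


section \<open>The category of fiber bundles\<close>

type_synonym 'a fbundle = "'a point chart set \<times> 'a protobundle"

type_synonym 'a bmap =
  "('a point \<Rightarrow> 'a point) \<times> ('a point \<Rightarrow> 'a point) \<times> ('a point \<Rightarrow> 'a point) \<times> ('a point \<Rightarrow> 'a point)"

definition bundle_map :: "'a fbundle \<Rightarrow> 'a fbundle \<Rightarrow> 'a bmap \<Rightarrow> bool" where
  "bundle_map = (\<lambda>(A1, B1) (A2, B2) (fE, fX, fY, fG).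
     fE \<in> extensional (topspace (bE B1)) \<and> continuous_map (bE B1) (bE B2) fE \<and>
     fX \<in> extensional (topspace (bX B1)) \<and> continuous_map (bX B1) (bX B2) fX \<and>
     fY \<in> extensional (topspace (bY B1)) \<and> continuous_map (bY B1) (bY B2) fY \<and>
     fG \<in> extensional (topspace (gtop (bG B1))) \<and> cont_hom (bG B1) (bG B2) fG \<and>
     (\<forall>u \<in> topspace (bE B1). bpi B2 (fE u) = fX (bpi B1 u)) \<and>
     (\<forall>y \<in> topspace (bY B1). \<forall>g \<in> topspace (gtop (bG B1)).
        brho B2 (fY y, fG g) = fY (brho B1 (y, g))) \<and>
     (let f1 = pmap (bX B1) (bY B1) fX fY;
          T2 = nbs (triv_grho (bX B2) (bY B2) (bG B2) (brho B2))
      in \<forall>(U1, V1, \<phi>1) \<in> A1. \<forall>(U2, V2, \<phi>2) \<in> A2. \<forall>x \<in> {u \<in> U1. fE u \<in> U2}.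
           \<exists>U1' V1' U2'. \<exists>V2' \<in> Ob T2. \<exists>V2h \<in> Ob T2. \<exists>fh.
             openin (bE B1) U1' \<and> openin (pprod (bX B1) (bY B1)) V1' \<and> openin (bE B2) U2' \<and>
             U1' \<subseteq> {u \<in> U1. fE u \<in> U2} \<and> V1' \<subseteq> V1 \<and> U2' \<subseteq> U2 \<and> V2' \<subseteq> V2 \<and>
             fun_iso (\<lambda>A. A) T2 fh V2' V2h \<and>
             local_square x U1' V1' U2' V2' V2h fh \<phi>1 \<phi>2 fE f1))"

definition Bun :: "'a protobundle set \<Rightarrow> ('a fbundle, 'a bmap) cat" where
  "Bun \<B> =
     (let O_B = {(A, B). B \<in> \<B> \<and> maximal_bundle_atlas B A}
      in \<lparr>Ob = O_B, Ar = {(f, a, b). a \<in> O_B \<and> b \<in> O_B \<and> bundle_map a b f}\<rparr>)"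

definition bun_comp :: "('a fbundle, 'a bmap) composition" where
  "bun_comp = (\<lambda>((gE, gX, gY, gG), b, c) ((fE, fX, fY, fG), (A, B), b').
     ((compose (topspace (bE B)) gE fE, compose (topspace (bX B)) gX fX,
       compose (topspace (bY B)) gY fY, compose (topspace (gtop (bG B))) gG fG), (A, B), c))"


section \<open>Local coordinate spaces\<close>

text \<open>
  A signature \<open>[\<alpha>\<^sub>0, \<dots>, \<alpha>\<^sub>n]\<close> denotes functions
  \<open>M ! \<alpha>\<^sub>0 \<times> \<dots> \<times> M ! \<alpha>\<^sub>n\<^sub>-\<^sub>1 \<rightarrow> M ! \<alpha>\<^sub>n\<close>; the arguments form an element of the library's indexed
  product over \<open>{..<n}\<close>.
\<close>

type_synonym 'a opn = "(nat \<Rightarrow> 'a point) \<Rightarrow> 'a point"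

record 'a lcs =
  lN :: "'a ocat list"
  lM :: "'a obj list"
  lA :: "'a point chart set"
  lF :: "'a opn list"
  lSig :: "nat list list"

definition sig_dom :: "'a obj list \<Rightarrow> nat list \<Rightarrow> (nat \<Rightarrow> 'a point) set" where
  "sig_dom M s = (\<Pi>\<^sub>E i\<in>{..<length s - 1}. pts (M ! (s ! i)))"

definition has_signature :: "'a obj list \<Rightarrow> nat list \<Rightarrow> 'a opn \<Rightarrow> bool" where
  "has_signature M s F \<longleftrightarrow>
     s \<noteq> [] \<and> (\<forall>\<alpha> \<in> set s. \<alpha> < length M) \<and>
     F \<in> extensional (sig_dom M s) \<and>
     continuous_map (product_topology (\<lambda>i. top_of (M ! (s ! i))) {..<length s - 1})
                    (top_of (M ! last s)) F"

text \<open>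
  In a local coordinate space a ``model category'' is a category of model spaces and model
  functions. Closure under model subspaces is not demanded, because the singleton category of a model
  space has one object only and a G-rho-model category is an arbitrary subcategory; both
  have to be admissible.
\<close>

definition local_coordinate_space :: "'a ocat list \<Rightarrow> nat list list \<Rightarrow> 'a lcs \<Rightarrow> bool" where
  "local_coordinate_space N \<Sigma> L \<longleftrightarrow>
     lN L = N \<and> lSig L = \<Sigma> \<and>
     2 \<le> length N \<and> length (lM L) = length N \<and> length (lF L) = length \<Sigma> \<and>
     (\<forall>\<alpha> < length N. topological_category (N ! \<alpha>) \<or> model_function_category (N ! \<alpha>)) \<and>
     model_function_category (N ! 1) \<and>
     (\<forall>\<alpha> < length N. lM L ! \<alpha> \<in> Ob (N ! \<alpha>)) \<and>
     (\<forall>\<gamma> < length \<Sigma>. has_signature (lM L) (\<Sigma> ! \<gamma>) (lF L ! \<gamma>)) \<and>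
     maximal_m_atlas (msp (lM L ! 0)) (msp (lM L ! 1)) (lA L)"

definition lcs_morphism ::
  "nat list list \<Rightarrow> 'a lcs \<Rightarrow> 'a lcs \<Rightarrow> ('a point \<Rightarrow> 'a point) list \<Rightarrow> bool" where
  "lcs_morphism \<Sigma> L1 L2 f \<longleftrightarrow>
     local_coordinate_space (lN L1) \<Sigma> L1 \<and> local_coordinate_space (lN L2) \<Sigma> L2 \<and>
     length (lM L1) = length f \<and> length (lM L2) = length f \<and>
     (\<forall>\<alpha> < length f.
        f ! \<alpha> \<in> extensional (pts (lM L1 ! \<alpha>)) \<and>
        continuous_map (top_of (lM L1 ! \<alpha>)) (top_of (lM L2 ! \<alpha>)) (f ! \<alpha>) \<and>
        (\<not> is_top (lM L1 ! \<alpha>) \<and> \<not> is_top (lM L2 ! \<alpha>) \<longrightarrow>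
           model_function (msp (lM L1 ! \<alpha>)) (msp (lM L2 ! \<alpha>)) (f ! \<alpha>))) \<and>
     (\<forall>\<gamma> < length \<Sigma>. \<forall>x \<in> sig_dom (lM L1) (\<Sigma> ! \<gamma>).
        (f ! last (\<Sigma> ! \<gamma>)) ((lF L1 ! \<gamma>) x) =
        (lF L2 ! \<gamma>) (\<lambda>i\<in>{..<length (\<Sigma> ! \<gamma>) - 1}. (f ! (\<Sigma> ! \<gamma> ! i)) (x i))) \<and>
     m_atlas_morphism (msp (lM L1 ! 0)) (lA L1) (msp (lM L1 ! 1))
                      (msp (lM L2 ! 0)) (lA L2) (msp (lM L2 ! 1)) (f ! 0) (f ! 1)"

definition strict_lcs_morphism ::
  "nat list list \<Rightarrow> 'a lcs \<Rightarrow> 'a lcs \<Rightarrow> ('a point \<Rightarrow> 'a point) list \<Rightarrow> bool" where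
  "strict_lcs_morphism \<Sigma> L1 L2 f \<longleftrightarrow>
     lcs_morphism \<Sigma> L1 L2 f \<and> lN L1 = lN L2 \<and>
     (\<forall>\<alpha> < length f. (f ! \<alpha>, lM L1 ! \<alpha>, lM L2 ! \<alpha>) \<in> Ar (lN L1 ! \<alpha>))"

definition lcs_comp :: "('a lcs, ('a point \<Rightarrow> 'a point) list) composition" where
  "lcs_comp = (\<lambda>(g, L2, L3) (f, L1, L2').
     (map (\<lambda>\<alpha>. compose (pts (lM L1 ! \<alpha>)) (g ! \<alpha>) (f ! \<alpha>)) [0..<length (lM L1)], L1, L3))"


section \<open>Fiber bundles as local coordinate spaces\<close>

definition bun_sig :: "nat list list" where
  "bun_sig = [[0, 2], [1, 2], [1, 3], [4, 4, 4], [3, 4, 3]]"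

definition bun_M :: "'a protobundle \<Rightarrow> 'a obj list" where
  "bun_M B =
     [ModObj (triv (bE B)), coord_obj B, TopObj (bX B), TopObj (bY B), TopObj (gtop (bG B))]"

definition bun_F :: "'a protobundle \<Rightarrow> 'a opn list" where
  "bun_F B =
     map2 (\<lambda>s h. restrict h (sig_dom (bun_M B) s)) bun_sig
       [\<lambda>x. bpi B (x 0), \<lambda>x. pfst (x 0), \<lambda>x. psnd (x 0),
        \<lambda>x. x 0 \<otimes>\<^bsub>grp (bG B)\<^esub> x 1, \<lambda>x. brho B (x 0, x 1)]"

definition bun_S :: "'a protobundle \<Rightarrow> 'a ocat list" where
  "bun_S B = map singleton_cat (bun_M B)"

definition lcs_obj :: "'a fbundle \<Rightarrow> 'a lcs" where
  "lcs_obj = (\<lambda>(A, B).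
     \<lparr>lN = bun_S B, lM = bun_M B, lA = A, lF = bun_F B, lSig = bun_sig\<rparr>)"

definition lcs_obj_in :: "'a ocat list \<Rightarrow> 'a fbundle \<Rightarrow> 'a lcs" where
  "lcs_obj_in \<M> = (\<lambda>(A, B).
     \<lparr>lN = \<M>, lM = map triv_ident (bun_M B), lA = A, lF = bun_F B, lSig = bun_sig\<rparr>)"

definition bmap_seq :: "'a fbundle \<Rightarrow> 'a bmap \<Rightarrow> ('a point \<Rightarrow> 'a point) list" where
  "bmap_seq = (\<lambda>(A, B) (fE, fX, fY, fG). [fE, pmap (bX B) (bY B) fX fY, fX, fY, fG])"

definition lcs_arr ::
  "('a fbundle, 'a bmap) arrow \<Rightarrow> ('a lcs, ('a point \<Rightarrow> 'a point) list) arrow" where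
  "lcs_arr = (\<lambda>(f, a, b). (bmap_seq a f, lcs_obj a, lcs_obj b))"

definition lcs_arr_in ::
  "'a ocat list \<Rightarrow> ('a fbundle, 'a bmap) arrow \<Rightarrow>
   ('a lcs, ('a point \<Rightarrow> 'a point) list) arrow" where
  "lcs_arr_in \<M> = (\<lambda>(f, a, b). (bmap_seq a f, lcs_obj_in \<M> a, lcs_obj_in \<M> b))"

definition LCS_Bun ::
  "'a protobundle set \<Rightarrow> ('a lcs, ('a point \<Rightarrow> 'a point) list) cat" where
  "LCS_Bun \<B> = image_cat lcs_obj lcs_arr (Bun \<B>)"

definition LCS_Bun_in ::
  "'a ocat list \<Rightarrow> 'a protobundle set \<Rightarrow> ('a lcs, ('a point \<Rightarrow> 'a point) list) cat" where
  "LCS_Bun_in \<M> \<B> = image_cat (lcs_obj_in \<M>) (lcs_arr_in \<M>) (Bun \<B>)"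

definition id_seq :: "'a protobundle \<Rightarrow> ('a point \<Rightarrow> 'a point) list" where
  "id_seq B =
     [\<lambda>x\<in>topspace (bE B). x, \<lambda>p\<in>topspace (pprod (bX B) (bY B)). p, \<lambda>x\<in>topspace (bX B). x,
      \<lambda>y\<in>topspace (bY B). y, \<lambda>g\<in>topspace (gtop (bG B)). g]"

end

theory Submission
  imports Defs
begin

text \<open>
  Fiber bundles are local coordinate spaces whose coordinate space is the trivial \<open>G\<close>-\<open>\<rho>\<close> model space on
  \<open>X \<times> Y\<close>, whose neighborhoods are the boxes \<open>V \<times> Y\<close> and whose morphisms are the shifts
  \<open>(x, y) \<mapsto> (x, y \<star> g x)\<close> by continuous functions \<open>g\<close> into the group, followed by
  inclusions. Most of the data and axioms correspond one to
  one. The mathematical content lies in four places.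

  \<^item> The trivial \<open>G\<close>-\<open>\<rho>\<close> model space is a model space (\<open>model_space_triv_grho\<close>). Morphisms can be glued
  because the action is effective: a shift determines the group element at each base point, so that local
  choices of \<open>g\<close> agree on overlaps.

  \<^item> A maximal bundle atlas is a maximal m-atlas (\<open>maximal_m_atlas_if_maximal_bundle_atlas\<close>). The transition
  function of two bundle charts is the restriction of a shift over the open set \<open>\<pi>[U \<inter> U']\<close>. Conversely, an m-chart
  compatible with a bundle atlas commutes with \<open>\<pi>\<close>, because shifts preserve the first coordinate.

  \<^item> Bundle maps compose (\<open>bundle_map_compose\<close>). In charts a bundle map is a product map followed by a twist, and
  the twist of the first map cannot in general be carried over to the third bundle. It is instead
  absorbed into the chart of the middle bundle: a maximal atlas is closed under twisting a chart
  by a shift (\<open>twisted_chart_mem\<close>), and the local condition of the second map is assumed for all charts.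

  \<^item> A bundle map yields a morphism of local coordinate spaces (\<open>lcs_morphism_bmap_seq\<close>). The open sets of
  the source coordinate space in the local condition are enlarged to boxes, which a product map
  allows.

  The rest is formal. The assignment of a local coordinate space to a bundle is injective on objects
  and compatible with composition, and the image of a category under such an assignment is a category
  to which it is a functor (\<open>is_functor_image_cat\<close>).
\<close>


section \<open>The transported product topology\<close>

lemma Tup_in_ptimes [simp]: "Tup x y \<in> ptimes A B \<longleftrightarrow> x \<in> A \<and> y \<in> B"
  by (auto simp: ptimes_def)

lemma ptimesE:
  assumes "p \<in> ptimes A B"
  obtains x y where "p = Tup x y" "x \<in> A" "y \<in> B"
  using assms by (auto simp: ptimes_def)

lemma ptimesD: "p \<in> ptimes A B \<Longrightarrow> pfst p \<in> A \<and> psnd p \<in> B"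
  by (auto simp: ptimes_def)

lemma ptimes_mono: "A \<subseteq> A' \<Longrightarrow> ptimes A B \<subseteq> ptimes A' B"
  by (auto simp: ptimes_def)

lemma ptimes_Int: "ptimes A B \<inter> ptimes A' B = ptimes (A \<inter> A') B"
  by (auto simp: ptimes_def)

lemma ptimes_empty_right [simp]: "ptimes A {} = {}"
  by (auto simp: ptimes_def)

lemma ptimes_empty_left [simp]: "ptimes {} B = {}"
  by (auto simp: ptimes_def)

lemma topspace_pprod [simp]: "topspace (pprod X Y) = ptimes (topspace X) (topspace Y)"
  by (auto simp: pprod_def topspace_pullback_topology ptimes_def)

lemma continuous_map_pfst: "continuous_map (pprod X Y) X pfst"
proof -
  have "continuous_map (pprod X Y) X (fst \<circ> (\<lambda>p. (pfst p, psnd p)))"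
    unfolding pprod_def by (rule continuous_map_pullback) (rule continuous_map_fst)
  then show ?thesis by (simp add: o_def)
qed

lemma continuous_map_psnd: "continuous_map (pprod X Y) Y psnd"
proof -
  have "continuous_map (pprod X Y) Y (snd \<circ> (\<lambda>p. (pfst p, psnd p)))"
    unfolding pprod_def by (rule continuous_map_pullback) (rule continuous_map_snd)
  then show ?thesis by (simp add: o_def)
qed

lemma continuous_map_into_pprod:
  assumes "continuous_map T X (\<lambda>t. pfst (f t))" "continuous_map T Y (\<lambda>t. psnd (f t))"
    and "\<And>t. t \<in> topspace T \<Longrightarrow> f t \<in> ptimes (topspace X) (topspace Y)"
  shows "continuous_map T (pprod X Y) f"
  unfolding pprod_def
proof (rule continuous_map_pullback')
  show "continuous_map T (prod_topology X Y) ((\<lambda>p. (pfst p, psnd p)) \<circ> f)"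
    using assms(1,2) by (simp add: o_def continuous_map_pairwise)
  show "topspace T \<subseteq> f -` ptimes (topspace X) (topspace Y)"
    using assms(3) by auto
qed

lemma openin_ptimes:
  assumes "openin X U" "openin Y V"
  shows "openin (pprod X Y) (ptimes U V)"
  unfolding pprod_def openin_pullback_topology
proof (intro exI conjI)
  show "openin (prod_topology X Y) (U \<times> V)"
    using assms by (simp add: openin_prod_Times_iff)
  show "ptimes U V = (\<lambda>p. (pfst p, psnd p)) -` (U \<times> V) \<inter> ptimes (topspace X) (topspace Y)"
    using openin_subset[OF assms(1)] openin_subset[OF assms(2)] by (auto simp: ptimes_def)
qed

text \<open>
  Projections are open maps. This is what produces open subsets of the base, and hence model neighborhoods
  of a \<open>G\<close>-\<open>\<rho>\<close> model space, out of arbitrary open subsets of the product.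
\<close>

lemma openin_pfst_image:
  assumes "openin (pprod X Y) W"
  shows "openin X (pfst ` W)"
proof -
  obtain U where U: "openin (prod_topology X Y) U"
    and W: "W = (\<lambda>p. (pfst p, psnd p)) -` U \<inter> ptimes (topspace X) (topspace Y)"
    using assms unfolding pprod_def openin_pullback_topology by auto
  have "U \<subseteq> topspace X \<times> topspace Y"
    using openin_subset[OF U] by simp
  then have "Tup (fst z) (snd z) \<in> W" if "z \<in> U" for z
    using that by (auto simp: W)
  then have "fst z \<in> pfst ` W" if "z \<in> U" for z
    using imageI[OF \<open>\<And>z. z \<in> U \<Longrightarrow> Tup (fst z) (snd z) \<in> W\<close>[OF that], of pfst] by simp
  then have "pfst ` W = fst ` U"
    by (auto simp: W rev_image_eqI)
  then show ?thesis
    using open_map_fst[of X Y] U by (simp add: open_map_def)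
qed

lemma pmap_Tup [simp]:
  "x \<in> topspace X \<Longrightarrow> y \<in> topspace Y \<Longrightarrow> pmap X Y f g (Tup x y) = Tup (f x) (g y)"
  by (simp add: pmap_def)

lemma continuous_map_pmap:
  assumes "continuous_map X X' f" "continuous_map Y Y' g"
  shows "continuous_map (pprod X Y) (pprod X' Y') (pmap X Y f g)"
proof (rule continuous_map_into_pprod)
  have "continuous_map (pprod X Y) X' (f \<circ> pfst)"
    using continuous_map_compose[OF continuous_map_pfst assms(1)] .
  then show "continuous_map (pprod X Y) X' (\<lambda>p. pfst (pmap X Y f g p))"
    by (rule continuous_map_eq) (auto elim!: ptimesE)
  have "continuous_map (pprod X Y) Y' (g \<circ> psnd)"
    using continuous_map_compose[OF continuous_map_psnd assms(2)] .
  then show "continuous_map (pprod X Y) Y' (\<lambda>p. psnd (pmap X Y f g p))"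
    by (rule continuous_map_eq) (auto elim!: ptimesE)
  show "pmap X Y f g p \<in> ptimes (topspace X') (topspace Y')" if "p \<in> topspace (pprod X Y)" for p
    using that continuous_map_funspace[OF assms(1)] continuous_map_funspace[OF assms(2)]
    by (auto elim!: ptimesE)
qed


section \<open>Categories of functions\<close>

lemma fun_categoryI:
  assumes ends: "\<And>f a b. (f, a, b) \<in> Ar C \<Longrightarrow> a \<in> Ob C \<and> b \<in> Ob C \<and> f \<in> P a \<rightarrow>\<^sub>E P b"
    and comp: "\<And>f g a b c. (f, a, b) \<in> Ar C \<Longrightarrow> (g, b, c) \<in> Ar C \<Longrightarrow> (compose (P a) g f, a, c) \<in> Ar C"
    and ident: "\<And>a. a \<in> Ob C \<Longrightarrow> (\<lambda>x\<in>P a. x, a, a) \<in> Ar C"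
  shows "fun_category P C"
proof -
  have "identity_arrow (fun_comp P) C a (\<lambda>x\<in>P a. x, a, a)" if a: "a \<in> Ob C" for a
    unfolding identity_arrow_def
  proof (intro conjI allI impI)
    show "(\<lambda>x\<in>P a. x, a, a) \<in> Ar C" by (rule ident[OF a])
    show "\<exists>e. (\<lambda>x\<in>P a. x, a, a) = (e, a, a)" by blast
    show "fun_comp P (f, a, b) (\<lambda>x\<in>P a. x, a, a) = (f, a, b)" if "(f, a, b) \<in> Ar C" for f b
      using ends[OF that] by (auto simp: fun_comp_def PiE_iff intro!: compose_Id)
    show "fun_comp P (\<lambda>x\<in>P a. x, a, a) (f, b, a) = (f, b, a)" if "(f, b, a) \<in> Ar C" for f b
      using ends[OF that] by (auto simp: fun_comp_def PiE_iff intro!: Id_compose)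
  qed
  moreover have "fun_comp P (h, c, d) (fun_comp P (g, b, c) (f, a, b)) =
      fun_comp P (fun_comp P (h, c, d) (g, b, c)) (f, a, b)"
    if "(f, a, b) \<in> Ar C" for f g h a b c d
    using ends[OF that] by (auto simp: fun_comp_def PiE_iff intro!: compose_assoc)
  moreover have "\<exists>h. fun_comp P (g, b, c) (f, a, b) = (h, a, c) \<and> (h, a, c) \<in> Ar C"
    if "(f, a, b) \<in> Ar C" "(g, b, c) \<in> Ar C" for f g a b c
    using comp[OF that] by (simp add: fun_comp_def)
  ultimately have "category (fun_comp P) C"
    unfolding category_def using ends by blast
  then show ?thesis
    unfolding fun_category_def using ends ident by blast
qed

lemma fun_category_comp:
  assumes "fun_category P C" "(f, a, b) \<in> Ar C" "(g, b, c) \<in> Ar C"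
  shows "(compose (P a) g f, a, c) \<in> Ar C"
proof -
  have "\<exists>h. fun_comp P (g, b, c) (f, a, b) = (h, a, c) \<and> (h, a, c) \<in> Ar C"
    using assms unfolding fun_category_def category_def by blast
  then show ?thesis by (simp add: fun_comp_def)
qed

lemma continuous_map_compose_restrict:
  assumes "continuous_map X Y f" "continuous_map Y Z g" "topspace X = A"
  shows "continuous_map X Z (compose A g f)"
  using continuous_map_compose[OF assms(1,2)]
  by (rule continuous_map_eq) (simp add: compose_def assms(3))


section \<open>Model spaces and singleton categories\<close>

lemma spc_triv [simp]: "spc (triv T) = T"
  and Ob_triv [simp]: "Ob (nbs (triv T)) = {U. openin T U}"
  by (simp_all add: triv_def)

lemma Ar_triv:
  "(f, U, V) \<in> Ar (nbs (triv T)) \<longleftrightarrow> openin T U \<and> openin T V \<and> f \<in> extensional U \<and>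
     continuous_map (subtopology T U) (subtopology T V) f"
  by (simp add: triv_def)

lemma topspace_sub_open: "openin T U \<Longrightarrow> topspace (subtopology T U) = U"
  by (meson openin_subset topspace_subtopology_subset)

lemma continuous_map_subtopology_mem:
  assumes "continuous_map (subtopology T U) (subtopology T' V) f" "openin T U" "x \<in> U"
  shows "f x \<in> V"
  using continuous_map_funspace[OF assms(1)] assms(2,3) openin_subset[OF assms(2)] by auto

lemma model_space_triv: "model_space (triv T)"
  unfolding model_space_def
proof (intro conjI ballI allI impI)
  show "fun_category (\<lambda>U. U) (nbs (triv T))"
  proof (rule fun_categoryI)
    fix f U V assume "(f, U, V) \<in> Ar (nbs (triv T))"
    then show "U \<in> Ob (nbs (triv T)) \<and> V \<in> Ob (nbs (triv T)) \<and> f \<in> U \<rightarrow>\<^sub>E V"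
      by (auto simp: Ar_triv PiE_iff intro: continuous_map_subtopology_mem)
  next
    fix f g U V W assume "(f, U, V) \<in> Ar (nbs (triv T))" "(g, V, W) \<in> Ar (nbs (triv T))"
    then show "(compose U g f, U, W) \<in> Ar (nbs (triv T))"
      using continuous_map_compose_restrict[OF _ _ topspace_sub_open, of T U "subtopology T V" f "subtopology T W" g]
      by (simp add: Ar_triv)
  next
    fix U assume "U \<in> Ob (nbs (triv T))"
    moreover have "continuous_map (subtopology T U) (subtopology T U) (\<lambda>x\<in>U. x)"
      by (rule continuous_map_eq[OF continuous_map_id]) auto
    ultimately show "(\<lambda>x\<in>U. x, U, U) \<in> Ar (nbs (triv T))"
      by (simp add: Ar_triv)
  qed
next
  fix f U V U' V'
  assume *: "(f, U, V) \<in> Ar (nbs (triv T))" "U' \<in> Ob (nbs (triv T))" "V' \<in> Ob (nbs (triv T))"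
    "U' \<subseteq> U" "V' \<subseteq> V" "f ` U' \<subseteq> V'"
  have "continuous_map (subtopology T U') T f"
    using * continuous_map_from_subtopology_mono[of T U T f U']
    by (auto simp: Ar_triv continuous_map_in_subtopology)
  then have "continuous_map (subtopology T U') (subtopology T V') (restrict f U')"
    using * by (auto simp: continuous_map_in_subtopology topspace_sub_open intro: continuous_map_eq)
  then show "(restrict f U', U', V') \<in> Ar (nbs (triv T))"
    using * by (simp add: Ar_triv)
next
  fix U U' assume "U \<in> Ob (nbs (triv T))" "U' \<in> Ob (nbs (triv T))" "U' \<subseteq> U"
  moreover have "continuous_map (subtopology T U') (subtopology T U) (\<lambda>x\<in>U'. x)" if "U' \<subseteq> U"
    using that by (auto simp: continuous_map_in_subtopology intro!: continuous_map_eq[OF continuous_map_from_subtopology[OF continuous_map_id]])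
  ultimately show "(\<lambda>x\<in>U'. x, U', U) \<in> Ar (nbs (triv T))"
    by (simp add: Ar_triv)
qed (auto simp: Ar_triv dest: openin_subset)

lemma model_function_triv:
  assumes "f \<in> extensional (topspace S)" "continuous_map S T f"
  shows "model_function (triv S) (triv T) f"
  unfolding model_function_def
proof (intro conjI ballI)
  show "\<exists>V\<in>Ob (nbs (triv T)). f ` U \<subseteq> V" if "U \<in> Ob (nbs (triv S))" for U
    using that assms(2) continuous_map_funspace[OF assms(2)] openin_subset[of S U]
    by (intro bexI[of _ "topspace T"]) auto
qed (use assms in \<open>auto intro: openin_continuous_map_preimage\<close>)

lemma model_space_parts:
  assumes "model_space S"
  shows model_space_fun_category: "fun_category (\<lambda>U. U) (nbs S)"
    and model_space_openin: "U \<in> Ob (nbs S) \<Longrightarrow> openin (spc S) U"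
    and model_space_cover: "\<Union> (Ob (nbs S)) = topspace (spc S)"
    and model_space_Int: "U \<in> Ob (nbs S) \<Longrightarrow> V \<in> Ob (nbs S) \<Longrightarrow> U \<inter> V \<in> Ob (nbs S)"
    and model_space_restrict: "(f, U, V) \<in> Ar (nbs S) \<Longrightarrow> U' \<in> Ob (nbs S) \<Longrightarrow> V' \<in> Ob (nbs S) \<Longrightarrow>
        U' \<subseteq> U \<Longrightarrow> V' \<subseteq> V \<Longrightarrow> f ` U' \<subseteq> V' \<Longrightarrow> (restrict f U', U', V') \<in> Ar (nbs S)"
proof -
  note parts = assms[unfolded model_space_def]
  show "fun_category (\<lambda>U. U) (nbs S)" using parts by (elim conjE)
  show "\<Union> (Ob (nbs S)) = topspace (spc S)" using parts by (elim conjE)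
  have "\<forall>U \<in> Ob (nbs S). openin (spc S) U" using parts by (elim conjE)
  then show "openin (spc S) U" if "U \<in> Ob (nbs S)" using that by blast
  have "\<forall>U \<in> Ob (nbs S). \<forall>V \<in> Ob (nbs S). U \<inter> V \<in> Ob (nbs S)" using parts by (elim conjE)
  then show "U \<inter> V \<in> Ob (nbs S)" if "U \<in> Ob (nbs S)" "V \<in> Ob (nbs S)" using that by blast
  have "\<forall>f U V U' V'. (f, U, V) \<in> Ar (nbs S) \<longrightarrow> U' \<in> Ob (nbs S) \<longrightarrow> V' \<in> Ob (nbs S) \<longrightarrow>
      U' \<subseteq> U \<longrightarrow> V' \<subseteq> V \<longrightarrow> f ` U' \<subseteq> V' \<longrightarrow> (restrict f U', U', V') \<in> Ar (nbs S)"
    using parts by (elim conjE)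
  then show "(restrict f U', U', V') \<in> Ar (nbs S)"
    if "(f, U, V) \<in> Ar (nbs S)" "U' \<in> Ob (nbs S)" "V' \<in> Ob (nbs S)" "U' \<subseteq> U" "V' \<subseteq> V" "f ` U' \<subseteq> V'"
    using that by blast
qed

lemma model_space_ident_arrow:
  assumes "model_space S" "U \<in> Ob (nbs S)"
  shows "(\<lambda>x\<in>U. x, U, U) \<in> Ar (nbs S)"
  using model_space_fun_category[OF assms(1)] assms(2) by (simp add: fun_category_def)

lemma model_function_ident:
  assumes "model_space S"
  shows "model_function S S (\<lambda>x\<in>topspace (spc S). x)"
proof -
  have "{x \<in> topspace (spc S). restrict (\<lambda>x. x) (topspace (spc S)) x \<in> V} = V"
    if "V \<in> Ob (nbs S)" for V
    using model_space_openin[OF assms that] openin_subset[of "spc S" V] by auto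
  moreover have "restrict (\<lambda>x. x) (topspace (spc S)) ` U \<subseteq> U" if "U \<in> Ob (nbs S)" for U
    using model_space_openin[OF assms that] openin_subset[of "spc S" U] by auto
  moreover have "continuous_map (spc S) (spc S) (\<lambda>x\<in>topspace (spc S). x)"
    by (rule continuous_map_eq[OF continuous_map_id]) auto
  ultimately show ?thesis
    unfolding model_function_def by (metis (no_types, lifting) restrict_extensional)
qed

lemma model_function_compose:
  assumes S: "model_space S" and f: "model_function S T f" and g: "model_function T R g"
  shows "model_function S R (compose (topspace (spc S)) g f)"
  unfolding model_function_def
proof (intro conjI ballI)
  have cf: "continuous_map (spc S) (spc T) f" and cg: "continuous_map (spc T) (spc R) g"
    using f g unfolding model_function_def by auto
  show "continuous_map (spc S) (spc R) (compose (topspace (spc S)) g f)"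
    by (rule continuous_map_compose_restrict[OF cf cg refl])
  show "{x \<in> topspace (spc S). compose (topspace (spc S)) g f x \<in> V} \<in> Ob (nbs S)"
    if V: "V \<in> Ob (nbs R)" for V
  proof -
    have "{x \<in> topspace (spc S). f x \<in> {y \<in> topspace (spc T). g y \<in> V}} \<in> Ob (nbs S)"
      using f g V unfolding model_function_def by blast
    moreover have "{x \<in> topspace (spc S). f x \<in> {y \<in> topspace (spc T). g y \<in> V}} =
        {x \<in> topspace (spc S). compose (topspace (spc S)) g f x \<in> V}"
      using continuous_map_funspace[OF cf] by (auto simp: compose_def)
    ultimately show ?thesis by simp
  qed
  show "\<exists>V\<in>Ob (nbs R). compose (topspace (spc S)) g f ` U \<subseteq> V" if U: "U \<in> Ob (nbs S)" for U
  proof -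
    obtain V where V: "V \<in> Ob (nbs T)" "f ` U \<subseteq> V"
      using f U unfolding model_function_def by blast
    obtain W where W: "W \<in> Ob (nbs R)" "g ` V \<subseteq> W"
      using g V(1) unfolding model_function_def by blast
    have "U \<subseteq> topspace (spc S)"
      by (rule openin_subset[OF model_space_openin[OF S U]])
    then have "compose (topspace (spc S)) g f ` U \<subseteq> W"
      using V(2) W(2) by (auto simp: compose_def)
    then show ?thesis using W(1) by blast
  qed
qed simp


lemma local_morphism_ident:
  assumes S: "model_space S"
  shows "local_morphism S (\<lambda>x\<in>topspace (spc S). x)"
  unfolding local_morphism_def
proof
  fix u assume "u \<in> topspace (spc S)"
  then obtain U where U: "U \<in> Ob (nbs S)" "u \<in> U"
    using model_space_cover[OF S] by blast
  have sub: "U \<subseteq> topspace (spc S)"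
    by (rule openin_subset[OF model_space_openin[OF S U(1)]])
  then have "restrict (\<lambda>x\<in>topspace (spc S). x) U = (\<lambda>x\<in>U. x)"
    by (auto simp: restrict_def fun_eq_iff)
  then have "(restrict (\<lambda>x\<in>topspace (spc S). x) U, U, U) \<in> Ar (nbs S)"
    using model_space_ident_arrow[OF S U(1)] by simp
  moreover have "(\<lambda>x\<in>topspace (spc S). x) ` U \<subseteq> U" "(\<lambda>x\<in>topspace (spc S). x) u \<in> U"
    using sub U(2) by auto
  ultimately show "\<exists>U\<in>Ob (nbs S). \<exists>V\<in>Ob (nbs S). u \<in> U \<and> (\<lambda>x\<in>topspace (spc S). x) u \<in> V \<and>
      (\<lambda>x\<in>topspace (spc S). x) ` U \<subseteq> V \<and> (restrict (\<lambda>x\<in>topspace (spc S). x) U, U, V) \<in> Ar (nbs S)"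
    using U by blast
qed

text \<open>
  Inverse images of model neighborhoods under a model function are model neighborhoods. This makes
  it possible to shrink the domain of a local piece of \<open>f\<close> until it lands in the domain of a local
  piece of \<open>g\<close>.
\<close>

lemma local_morphism_compose:
  assumes S: "model_space S" and f: "model_function S S f" "local_morphism S f"
    and g: "local_morphism S g"
  shows "local_morphism S (compose (topspace (spc S)) g f)"
  unfolding local_morphism_def
proof
  let ?h = "compose (topspace (spc S)) g f"
  fix u assume u: "u \<in> topspace (spc S)"
  have cf: "continuous_map (spc S) (spc S) f"
    using f(1) unfolding model_function_def by blast
  obtain U V where UV: "U \<in> Ob (nbs S)" "V \<in> Ob (nbs S)" "u \<in> U" "f u \<in> V" "f ` U \<subseteq> V"
    "(restrict f U, U, V) \<in> Ar (nbs S)"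
    using f(2) u unfolding local_morphism_def by blast
  have "f u \<in> topspace (spc S)"
    using continuous_map_funspace[OF cf] u by auto
  then obtain P Q where PQ: "P \<in> Ob (nbs S)" "Q \<in> Ob (nbs S)" "f u \<in> P" "g (f u) \<in> Q" "g ` P \<subseteq> Q"
    "(restrict g P, P, Q) \<in> Ar (nbs S)"
    using g unfolding local_morphism_def by blast
  \<comment> \<open>On \<open>U'\<close> the map \<open>f\<close> takes values in the domain \<open>P\<close> of the local piece of \<open>g\<close>.\<close>
  define U' where "U' = U \<inter> {x \<in> topspace (spc S). f x \<in> P}"
  have "{x \<in> topspace (spc S). f x \<in> P} \<in> Ob (nbs S)"
    using f(1) PQ(1) unfolding model_function_def by blast
  then have U': "U' \<in> Ob (nbs S)"
    unfolding U'_def using model_space_Int[OF S UV(1)] by blast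
  have VP: "V \<inter> P \<in> Ob (nbs S)"
    by (rule model_space_Int[OF S UV(2) PQ(1)])
  have "(restrict (restrict f U) U', U', V \<inter> P) \<in> Ar (nbs S)"
    by (rule model_space_restrict[OF S UV(6) U' VP]) (use UV(5) in \<open>auto simp: U'_def\<close>)
  moreover have "(restrict (restrict g P) (V \<inter> P), V \<inter> P, Q) \<in> Ar (nbs S)"
    by (rule model_space_restrict[OF S PQ(6) VP PQ(2)]) (use PQ(5) in auto)
  ultimately have "(compose U' (restrict (restrict g P) (V \<inter> P)) (restrict (restrict f U) U'), U', Q)
      \<in> Ar (nbs S)"
    by (rule fun_category_comp[OF model_space_fun_category[OF S]])
  moreover have "compose U' (restrict (restrict g P) (V \<inter> P)) (restrict (restrict f U) U') =
      restrict ?h U'"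
    using UV(5) by (auto simp: compose_def U'_def restrict_def fun_eq_iff)
  ultimately have "(restrict ?h U', U', Q) \<in> Ar (nbs S)" by simp
  moreover have "u \<in> U'" using u UV(3) PQ(3) by (auto simp: U'_def)
  moreover have "?h u \<in> Q" using u PQ(4) by (simp add: compose_def)
  moreover have "?h ` U' \<subseteq> Q" using PQ(5) by (auto simp: U'_def compose_def)
  ultimately show "\<exists>U\<in>Ob (nbs S). \<exists>V\<in>Ob (nbs S). u \<in> U \<and> ?h u \<in> V \<and> ?h ` U \<subseteq> V \<and>
      (restrict ?h U, U, V) \<in> Ar (nbs S)"
    using U' PQ(2) by blast
qed

lemma Ob_singleton_cat [simp]: "Ob (singleton_cat a) = {a}"
  by (simp add: singleton_cat_def)

lemma topological_category_singleton_cat: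
  "topological_category (singleton_cat (TopObj T))"
proof -
  let ?C = "singleton_cat (TopObj T)"
  have Ar: "(f, a, b) \<in> Ar ?C \<longleftrightarrow> a = TopObj T \<and> b = TopObj T \<and> f \<in> extensional (topspace T) \<and>
      continuous_map T T f" for f a b
    by (auto simp: singleton_cat_def pts_def top_of_def)
  have pts: "pts (TopObj T) = topspace T"
    by (simp add: pts_def top_of_def)
  have "fun_category pts ?C"
  proof (rule fun_categoryI)
    show "a \<in> Ob ?C \<and> b \<in> Ob ?C \<and> f \<in> pts a \<rightarrow>\<^sub>E pts b" if "(f, a, b) \<in> Ar ?C" for f a b
      using that continuous_map_funspace[of T T f] by (auto simp: Ar pts PiE_iff)
    show "(compose (pts a) g f, a, c) \<in> Ar ?C"
      if "(f, a, b) \<in> Ar ?C" "(g, b, c) \<in> Ar ?C" for f g a b c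
      using that by (auto simp: Ar pts intro: continuous_map_compose_restrict)
    show "(\<lambda>x\<in>pts a. x, a, a) \<in> Ar ?C" if "a \<in> Ob ?C" for a
      using that by (auto simp: Ar pts intro: continuous_map_eq[OF continuous_map_id])
  qed
  then show ?thesis
    unfolding topological_category_def by (auto simp: Ar top_of_def)
qed

lemma model_function_category_singleton_cat:
  assumes a: "\<not> is_top a" "model_space (msp a)"
  shows "model_function_category (singleton_cat a)"
proof -
  let ?C = "singleton_cat a"
  have Ar: "(f, b, c) \<in> Ar ?C \<longleftrightarrow> b = a \<and> c = a \<and> model_function (msp a) (msp a) f \<and>
      local_morphism (msp a) f" for f b c
    using a(1) by (auto simp: singleton_cat_def)
  have pts: "pts a = topspace (spc (msp a))"
    by (simp add: pts_def top_of_def)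
  have "fun_category pts ?C"
  proof (rule fun_categoryI)
    show "b \<in> Ob ?C \<and> c \<in> Ob ?C \<and> f \<in> pts b \<rightarrow>\<^sub>E pts c" if "(f, b, c) \<in> Ar ?C" for f b c
      using that continuous_map_funspace[of "spc (msp a)" "spc (msp a)" f]
      by (auto simp: Ar pts PiE_iff model_function_def)
    show "(compose (pts b) g f, b, d) \<in> Ar ?C"
      if "(f, b, c) \<in> Ar ?C" "(g, c, d) \<in> Ar ?C" for f g b c d
      using that model_function_compose[OF a(2)] local_morphism_compose[OF a(2)]
      by (auto simp: Ar pts)
    show "(\<lambda>x\<in>pts b. x, b, b) \<in> Ar ?C" if "b \<in> Ob ?C" for b
      using that model_function_ident[OF a(2)] local_morphism_ident[OF a(2)] by (auto simp: Ar pts)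
  qed
  then show ?thesis
    unfolding model_function_category_def using a by (auto simp: Ar)
qed



section \<open>Shifts by a continuous function into the group\<close>

definition shift ::
  "'a point topology \<Rightarrow> ('a point \<times> 'a point \<Rightarrow> 'a point) \<Rightarrow> 'a point set \<Rightarrow> ('a point \<Rightarrow> 'a point) \<Rightarrow>
   'a point \<Rightarrow> 'a point" where
  "shift Y \<rho> V g = (\<lambda>p\<in>ptimes V (topspace Y). act \<rho> p (g (pfst p)))"

lemma pfst_act [simp]: "pfst (act \<rho> p g) = pfst p"
  and psnd_act [simp]: "psnd (act \<rho> p g) = \<rho> (psnd p, g)"
  by (simp_all add: act_def)

lemma shift_apply: "p \<in> ptimes V (topspace Y) \<Longrightarrow> shift Y \<rho> V g p = act \<rho> p (g (pfst p))"
  by (simp add: shift_def)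

lemma group_shift_iff:
  "group_shift X Y \<rho> V g f \<longleftrightarrow> f = shift Y \<rho> V g \<and>
     homeomorphic_map (subtopology (pprod X Y) (ptimes V (topspace Y)))
                      (subtopology (pprod X Y) (ptimes V (topspace Y))) f"
  by (simp add: group_shift_def shift_def)

locale tgroup_action =
  fixes X Y :: "'a point topology" and G :: "'a point tgroup"
    and \<rho> :: "'a point \<times> 'a point \<Rightarrow> 'a point"
  assumes tgroup: "topological_group G" and action: "effective_action Y G \<rho>"
begin

abbreviation box :: "'a point set \<Rightarrow> 'a point set" where "box V \<equiv> ptimes V (topspace Y)"

abbreviation S :: "'a point mspace" where "S \<equiv> triv_grho X Y G \<rho>"

lemma grp: "group (grp G)"
  and carrier_eq: "carrier (grp G) = topspace (gtop G)"
  using tgroup by (simp_all add: topological_group_def)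

lemma continuous_mult:
  assumes "continuous_map T (gtop G) g" "continuous_map T (gtop G) h"
  shows "continuous_map T (gtop G) (\<lambda>t. g t \<otimes>\<^bsub>grp G\<^esub> h t)"
proof -
  have "continuous_map (prod_topology (gtop G) (gtop G)) (gtop G) (\<lambda>(g, h). g \<otimes>\<^bsub>grp G\<^esub> h)"
    using tgroup by (simp add: topological_group_def)
  moreover have "continuous_map T (prod_topology (gtop G) (gtop G)) (\<lambda>t. (g t, h t))"
    using assms by (simp add: continuous_map_pairwise o_def)
  ultimately have "continuous_map T (gtop G) ((\<lambda>(g, h). g \<otimes>\<^bsub>grp G\<^esub> h) \<circ> (\<lambda>t. (g t, h t)))"
    by (rule continuous_map_compose[rotated])
  then show ?thesis by (simp add: o_def)
qed

lemma continuous_inv: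
  assumes "continuous_map T (gtop G) g"
  shows "continuous_map T (gtop G) (\<lambda>t. inv\<^bsub>grp G\<^esub> g t)"
proof -
  have "continuous_map (gtop G) (gtop G) (\<lambda>g. inv\<^bsub>grp G\<^esub> g)"
    using tgroup by (simp add: topological_group_def)
  then have "continuous_map T (gtop G) ((\<lambda>g. inv\<^bsub>grp G\<^esub> g) \<circ> g)"
    using assms continuous_map_compose by blast
  then show ?thesis by (simp add: o_def)
qed

lemma one_closed: "\<one>\<^bsub>grp G\<^esub> \<in> topspace (gtop G)"
  using monoid.one_closed[of "grp G"] grp carrier_eq by (simp add: group.is_monoid)

lemma mult_closed:
  "g \<in> topspace (gtop G) \<Longrightarrow> h \<in> topspace (gtop G) \<Longrightarrow> g \<otimes>\<^bsub>grp G\<^esub> h \<in> topspace (gtop G)"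
  using monoid.m_closed[of "grp G" g h] grp carrier_eq by (simp add: group.is_monoid)

lemma inv_closed: "g \<in> topspace (gtop G) \<Longrightarrow> inv\<^bsub>grp G\<^esub> g \<in> topspace (gtop G)"
  using group.inv_closed[OF grp, of g] carrier_eq by simp

lemma continuous_one: "continuous_map T (gtop G) (\<lambda>t. \<one>\<^bsub>grp G\<^esub>)"
  by (simp add: one_closed)

lemma continuous_action: "continuous_map (prod_topology Y (gtop G)) Y \<rho>"
  and action_one: "y \<in> topspace Y \<Longrightarrow> \<rho> (y, \<one>\<^bsub>grp G\<^esub>) = y"
  and action_mult: "y \<in> topspace Y \<Longrightarrow> g \<in> topspace (gtop G) \<Longrightarrow> h \<in> topspace (gtop G) \<Longrightarrow>
     \<rho> (\<rho> (y, g), h) = \<rho> (y, g \<otimes>\<^bsub>grp G\<^esub> h)"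
  and action_effective: "g \<in> topspace (gtop G) \<Longrightarrow> (\<And>y. y \<in> topspace Y \<Longrightarrow> \<rho> (y, g) = y) \<Longrightarrow>
     g = \<one>\<^bsub>grp G\<^esub>"
  using action by (simp_all add: effective_action_def)

lemma action_closed: "y \<in> topspace Y \<Longrightarrow> g \<in> topspace (gtop G) \<Longrightarrow> \<rho> (y, g) \<in> topspace Y"
  using continuous_map_funspace[OF continuous_action] by auto

lemma act_closed: "p \<in> box V \<Longrightarrow> g \<in> topspace (gtop G) \<Longrightarrow> act \<rho> p g \<in> box V"
  by (auto elim!: ptimesE simp: act_def action_closed)

lemma act_act:
  assumes "p \<in> box V" "g \<in> topspace (gtop G)" "h \<in> topspace (gtop G)"
  shows "act \<rho> (act \<rho> p g) h = act \<rho> p (g \<otimes>\<^bsub>grp G\<^esub> h)"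
  using assms by (auto elim!: ptimesE simp: act_def action_mult)

lemma act_one: "p \<in> box V \<Longrightarrow> act \<rho> p \<one>\<^bsub>grp G\<^esub> = p"
  by (auto elim!: ptimesE simp: act_def action_one)

lemma act_inv:
  assumes "p \<in> box V" "g \<in> topspace (gtop G)"
  shows "act \<rho> (act \<rho> p g) (inv\<^bsub>grp G\<^esub> g) = p" "act \<rho> (act \<rho> p (inv\<^bsub>grp G\<^esub> g)) g = p"
  using assms group.r_inv[OF grp, of g] group.l_inv[OF grp, of g]
  by (simp_all add: act_act[OF assms(1)] inv_closed act_one carrier_eq)

text \<open>
  Effectiveness is stated for the neutral element; applied to \<open>g h\<^sup>-\<^sup>1\<close> it separates any two elements.
\<close>

lemma effective_cancel:
  assumes gh: "g \<in> topspace (gtop G)" "h \<in> topspace (gtop G)"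
    and eq: "\<And>y. y \<in> topspace Y \<Longrightarrow> \<rho> (y, g) = \<rho> (y, h)"
  shows "g = h"
proof -
  interpret GG: group "grp G" by (rule grp)
  have "g \<otimes>\<^bsub>grp G\<^esub> inv\<^bsub>grp G\<^esub> h = \<one>\<^bsub>grp G\<^esub>"
  proof (rule action_effective)
    show "g \<otimes>\<^bsub>grp G\<^esub> inv\<^bsub>grp G\<^esub> h \<in> topspace (gtop G)"
      using gh by (simp add: mult_closed inv_closed)
    show "\<rho> (y, g \<otimes>\<^bsub>grp G\<^esub> inv\<^bsub>grp G\<^esub> h) = y" if y: "y \<in> topspace Y" for y
    proof -
      have "\<rho> (y, g \<otimes>\<^bsub>grp G\<^esub> inv\<^bsub>grp G\<^esub> h) = \<rho> (\<rho> (y, h), inv\<^bsub>grp G\<^esub> h)"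
        using y gh by (simp add: action_mult[symmetric] inv_closed eq)
      also have "\<dots> = y"
        using y gh by (simp add: action_mult inv_closed GG.r_inv[unfolded carrier_eq] action_one)
      finally show ?thesis .
    qed
  qed
  then show ?thesis
    using gh by (metis GG.inv_closed GG.inv_equality GG.inv_inv carrier_eq)
qed

lemma continuous_on_base_mem:
  "continuous_map (subtopology X V) (gtop G) g \<Longrightarrow> V \<subseteq> topspace X \<Longrightarrow> x \<in> V \<Longrightarrow> g x \<in> topspace (gtop G)"
  using continuous_map_funspace[of "subtopology X V" "gtop G" g] by auto

lemma continuous_shift:
  assumes V: "V \<subseteq> topspace X" and g: "continuous_map (subtopology X V) (gtop G) g"
  shows "continuous_map (subtopology (pprod X Y) (box V)) (subtopology (pprod X Y) (box V)) (shift Y \<rho> V g)"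
proof -
  let ?T = "subtopology (pprod X Y) (box V)"
  have pf: "continuous_map ?T X pfst" and ps: "continuous_map ?T Y psnd"
    by (simp_all add: continuous_map_from_subtopology continuous_map_pfst continuous_map_psnd)
  have "continuous_map ?T (subtopology X V) pfst"
    using pf by (auto simp: continuous_map_in_subtopology dest: ptimesD)
  then have "continuous_map ?T (gtop G) (g \<circ> pfst)"
    using g continuous_map_compose by blast
  then have "continuous_map ?T (prod_topology Y (gtop G)) (\<lambda>p. (psnd p, g (pfst p)))"
    using ps by (simp add: continuous_map_pairwise o_def)
  then have c: "continuous_map ?T Y (\<rho> \<circ> (\<lambda>p. (psnd p, g (pfst p))))"
    using continuous_action continuous_map_compose by blast
  have im: "shift Y \<rho> V g p \<in> box V" if "p \<in> box V" for p
    using act_closed[OF that continuous_on_base_mem[OF g V]] that by (simp add: shift_apply ptimesD)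
  have "continuous_map ?T (pprod X Y) (shift Y \<rho> V g)"
  proof (rule continuous_map_into_pprod)
    show "continuous_map ?T X (\<lambda>p. pfst (shift Y \<rho> V g p))"
      by (rule continuous_map_eq[OF pf]) (simp add: shift_apply)
    show "continuous_map ?T Y (\<lambda>p. psnd (shift Y \<rho> V g p))"
      by (rule continuous_map_eq[OF c]) (simp add: shift_apply)
    show "shift Y \<rho> V g p \<in> ptimes (topspace X) (topspace Y)" if "p \<in> topspace ?T" for p
      using that im ptimes_mono[OF V, of "topspace Y"] by auto
  qed
  then show ?thesis
    using im by (auto simp: continuous_map_in_subtopology)
qed

lemma shift_inverse:
  assumes V: "V \<subseteq> topspace X" and g: "continuous_map (subtopology X V) (gtop G) g" and p: "p \<in> box V"
  shows "shift Y \<rho> V (\<lambda>x. inv\<^bsub>grp G\<^esub> g x) (shift Y \<rho> V g p) = p"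
    and "shift Y \<rho> V g (shift Y \<rho> V (\<lambda>x. inv\<^bsub>grp G\<^esub> g x) p) = p"
proof -
  have gp: "g (pfst p) \<in> topspace (gtop G)"
    using continuous_on_base_mem[OF g V] p by (auto dest: ptimesD)
  show "shift Y \<rho> V (\<lambda>x. inv\<^bsub>grp G\<^esub> g x) (shift Y \<rho> V g p) = p"
    using p gp act_closed[OF p gp] by (simp add: shift_apply act_inv(1))
  show "shift Y \<rho> V g (shift Y \<rho> V (\<lambda>x. inv\<^bsub>grp G\<^esub> g x) p) = p"
    using p gp act_closed[OF p inv_closed[OF gp]] by (simp add: shift_apply act_inv(2))
qed

text \<open>
  The action is jointly continuous and inversion in the group is continuous, so the shift by a
  continuous \<open>g\<close> is continuous, with the shift by the pointwise inverse of \<open>g\<close> as its continuous inverse.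
\<close>

lemma homeomorphic_shift:
  assumes V: "V \<subseteq> topspace X" and g: "continuous_map (subtopology X V) (gtop G) g"
  shows "homeomorphic_map (subtopology (pprod X Y) (box V)) (subtopology (pprod X Y) (box V)) (shift Y \<rho> V g)"
  unfolding homeomorphic_map_maps homeomorphic_maps_def
  using continuous_shift[OF V g] continuous_shift[OF V continuous_inv[OF g]] shift_inverse[OF V g]
  by (intro exI[of _ "shift Y \<rho> V (\<lambda>x. inv\<^bsub>grp G\<^esub> g x)"]) auto

lemma spc_S [simp]: "spc S = pprod X Y"
  and Ob_S: "Ob (nbs S) = {box V | V. openin X V}"
  by (simp_all add: triv_grho_def)

text \<open>
  The arrows of the trivial \<open>G\<close>-\<open>\<rho>\<close> model space are required to be homeomorphisms; for a continuous \<open>g\<close>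
  this is automatic.
\<close>

lemma Ar_S:
  "(f, U, U') \<in> Ar (nbs S) \<longleftrightarrow>
     (\<exists>V W g. U = box V \<and> U' = box W \<and> openin X V \<and> openin X W \<and> V \<subseteq> W \<and>
        continuous_map (subtopology X V) (gtop G) g \<and> f = shift Y \<rho> V g)"
proof -
  have "group_shift X Y \<rho> V g f \<longleftrightarrow> f = shift Y \<rho> V g"
    if "openin X V" "continuous_map (subtopology X V) (gtop G) g" for V g
    using homeomorphic_shift[OF openin_subset[OF that(1)] that(2)] by (auto simp: group_shift_iff)
  then show ?thesis
    unfolding triv_grho_def by (simp, blast)
qed

lemma ArI:
  "openin X V \<Longrightarrow> openin X W \<Longrightarrow> V \<subseteq> W \<Longrightarrow> continuous_map (subtopology X V) (gtop G) g \<Longrightarrow>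
   (shift Y \<rho> V g, box V, box W) \<in> Ar (nbs S)"
  unfolding Ar_S by blast

lemma shift_one: "shift Y \<rho> V (\<lambda>x. \<one>\<^bsub>grp G\<^esub>) = (\<lambda>p\<in>box V. p)"
  by (auto simp: shift_def fun_eq_iff act_one)

lemma compose_shift:
  assumes V: "V \<subseteq> topspace X" and W: "W \<subseteq> topspace X" "V \<subseteq> W"
    and g: "continuous_map (subtopology X V) (gtop G) g"
    and h: "continuous_map (subtopology X W) (gtop G) h"
  shows "compose (box V) (shift Y \<rho> W h) (shift Y \<rho> V g) = shift Y \<rho> V (\<lambda>x. g x \<otimes>\<^bsub>grp G\<^esub> h x)"
proof
  fix p
  show "compose (box V) (shift Y \<rho> W h) (shift Y \<rho> V g) p = shift Y \<rho> V (\<lambda>x. g x \<otimes>\<^bsub>grp G\<^esub> h x) p"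
  proof (cases "p \<in> box V")
    case True
    then have "pfst p \<in> V" by (auto dest: ptimesD)
    then have "g (pfst p) \<in> topspace (gtop G)" "h (pfst p) \<in> topspace (gtop G)"
      using continuous_on_base_mem[OF g V] continuous_on_base_mem[OF h W(1)] W(2) by auto
    moreover from this have "act \<rho> p (g (pfst p)) \<in> box W"
      using True ptimes_mono[OF W(2)] by (meson act_closed subsetD)
    ultimately show ?thesis
      using True by (simp add: compose_def shift_apply act_act)
  next
    case False
    then show ?thesis by (simp add: compose_def shift_def)
  qed
qed

lemma fun_iso_shift:
  assumes V: "openin X V" and g: "continuous_map (subtopology X V) (gtop G) g"
  shows "fun_iso (\<lambda>A. A) (nbs S) (shift Y \<rho> V g) (box V) (box V)"
  unfolding fun_iso_def
proof (intro conjI exI)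
  note V' = openin_subset[OF V] and g' = continuous_inv[OF g]
  show "(shift Y \<rho> V g, box V, box V) \<in> Ar (nbs S)"
    by (rule ArI[OF V V subset_refl g])
  show "(shift Y \<rho> V (\<lambda>x. inv\<^bsub>grp G\<^esub> g x), box V, box V) \<in> Ar (nbs S)"
    by (rule ArI[OF V V subset_refl g'])
  show "compose (box V) (shift Y \<rho> V (\<lambda>x. inv\<^bsub>grp G\<^esub> g x)) (shift Y \<rho> V g) = (\<lambda>x\<in>box V. x)"
    "compose (box V) (shift Y \<rho> V g) (shift Y \<rho> V (\<lambda>x. inv\<^bsub>grp G\<^esub> g x)) = (\<lambda>x\<in>box V. x)"
    using shift_inverse[OF V' g] by (auto simp: compose_def fun_eq_iff)
qed

text \<open>
  A map that is locally a shift by a continuous function is a shift by a continuous function on the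
  union: by effectiveness the map determines the group elements, so the local functions agree.
\<close>

lemma continuous_map_glue:
  assumes V: "\<And>i. i \<in> I \<Longrightarrow> openin X (V i)"
    and g: "\<And>i. i \<in> I \<Longrightarrow> continuous_map (subtopology X (V i)) (gtop G) (g i)"
    and f: "\<And>i p. i \<in> I \<Longrightarrow> p \<in> box (V i) \<Longrightarrow> f p = act \<rho> p (g i (pfst p))"
  obtains h where "continuous_map (subtopology X (\<Union>i\<in>I. V i)) (gtop G) h"
    "\<And>p. p \<in> box (\<Union>i\<in>I. V i) \<Longrightarrow> f p = act \<rho> p (h (pfst p))"
proof -
  have mem: "g i x \<in> topspace (gtop G)" if "i \<in> I" "x \<in> V i" for i x
    using continuous_on_base_mem[OF g[OF that(1)] openin_subset[OF V[OF that(1)]] that(2)] .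
  have agree: "g i x = g j x" if "i \<in> I" "j \<in> I" "x \<in> V i" "x \<in> V j" for i j x
  proof (rule effective_cancel)
    show "\<rho> (y, g i x) = \<rho> (y, g j x)" if "y \<in> topspace Y" for y
      using f[of i "Tup x y"] f[of j "Tup x y"] \<open>i \<in> I\<close> \<open>j \<in> I\<close> \<open>x \<in> V i\<close> \<open>x \<in> V j\<close> that
      by (simp add: act_def)
  qed (use that mem in auto)
  let ?V = "\<Union>i\<in>I. V i"
  obtain h where h: "continuous_map (subtopology X ?V) (gtop G) h"
    "\<And>x i. i \<in> I \<Longrightarrow> x \<in> topspace (subtopology X ?V) \<inter> V i \<Longrightarrow> h x = g i x"
  proof (rule pasting_lemma_exists[of "subtopology X ?V" V I "gtop G" g])
    show "topspace (subtopology X ?V) \<subseteq> \<Union> (V ` I)" by auto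
    show "openin (subtopology X ?V) (V i)" if "i \<in> I" for i
      using openin_subtopology_Int2[OF V[OF that], of ?V] that by (simp add: Int_absorb1 UN_upper)
    show "continuous_map (subtopology (subtopology X ?V) (V i)) (gtop G) (g i)" if "i \<in> I" for i
      using g[OF that] that by (simp add: subtopology_subtopology Int_absorb1 UN_upper)
    show "g i x = g j x" if "i \<in> I" "j \<in> I" "x \<in> topspace (subtopology X ?V) \<inter> V i \<inter> V j" for i j x
      using agree[OF that(1,2)] that(3) by blast
  qed blast
  show ?thesis
  proof (rule that[OF h(1)])
    show "f p = act \<rho> p (h (pfst p))" if p: "p \<in> box ?V" for p
    proof -
      obtain x y where xy: "p = Tup x y" "x \<in> ?V" "y \<in> topspace Y" using p by (rule ptimesE)
      then obtain i where i: "i \<in> I" "x \<in> V i" by blast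
      then have "h x = g i x"
        using h(2)[of i x] openin_subset[OF V[of i]] by auto
      then show ?thesis using f[of i p] i xy by simp
    qed
  qed
qed


text \<open>
  A set \<open>box V\<close> determines \<open>V\<close> only if the fiber is non-empty. Taking \<open>V\<close> to be the image under the first
  projection gives a description of objects and arrows that is uniform in the fiber: over an
  empty fiber every object is empty, and so is its projection.
\<close>

lemma pfst_box: "pfst ` box V = (if topspace Y = {} then {} else V)"
proof (cases "topspace Y = {}")
  case False
  then obtain y where y: "y \<in> topspace Y" by blast
  have "x \<in> pfst ` box V" if "x \<in> V" for x
    using that y by (intro image_eqI[of _ _ "Tup x y"]) auto
  then show ?thesis using False by (auto dest: ptimesD)
qed simp

lemma box_pfst_box [simp]: "box (pfst ` box V) = box V"
  by (simp add: pfst_box)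

lemma Ob_S_iff: "U \<in> Ob (nbs S) \<longleftrightarrow> openin X (pfst ` U) \<and> U = box (pfst ` U)"
proof
  assume "U \<in> Ob (nbs S)"
  then obtain V where "U = box V" "openin X V" by (auto simp: Ob_S)
  then show "openin X (pfst ` U) \<and> U = box (pfst ` U)" by (simp add: pfst_box)
qed (auto simp: Ob_S)

lemma Ar_S_iff:
  "(f, U, U') \<in> Ar (nbs S) \<longleftrightarrow> U \<in> Ob (nbs S) \<and> U' \<in> Ob (nbs S) \<and> U \<subseteq> U' \<and>
     (\<exists>g. continuous_map (subtopology X (pfst ` U)) (gtop G) g \<and> f = shift Y \<rho> (pfst ` U) g)"
proof
  assume "(f, U, U') \<in> Ar (nbs S)"
  then obtain V W g where *: "U = box V" "U' = box W" "openin X V" "openin X W" "V \<subseteq> W"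
    "continuous_map (subtopology X V) (gtop G) g" "f = shift Y \<rho> V g"
    unfolding Ar_S by blast
  have "continuous_map (subtopology X (pfst ` U)) (gtop G) g"
    by (rule continuous_map_from_subtopology_mono[OF *(6)]) (auto simp: *(1) dest: ptimesD)
  moreover have "shift Y \<rho> V g = shift Y \<rho> (pfst ` U) g"
    by (simp add: shift_def *(1))
  ultimately show "U \<in> Ob (nbs S) \<and> U' \<in> Ob (nbs S) \<and> U \<subseteq> U' \<and>
     (\<exists>g. continuous_map (subtopology X (pfst ` U)) (gtop G) g \<and> f = shift Y \<rho> (pfst ` U) g)"
    using * ptimes_mono[OF *(5)] by (auto simp: Ob_S)
next
  assume *: "U \<in> Ob (nbs S) \<and> U' \<in> Ob (nbs S) \<and> U \<subseteq> U' \<and>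
     (\<exists>g. continuous_map (subtopology X (pfst ` U)) (gtop G) g \<and> f = shift Y \<rho> (pfst ` U) g)"
  then show "(f, U, U') \<in> Ar (nbs S)"
    unfolding Ob_S_iff Ar_S
    by (intro exI[of _ "pfst ` U"] exI[of _ "pfst ` U'"]) auto
qed

lemma continuous_map_base_mono:
  "continuous_map (subtopology X (pfst ` U)) (gtop G) g \<Longrightarrow> U' \<subseteq> U \<Longrightarrow>
   continuous_map (subtopology X (pfst ` U')) (gtop G) g"
  by (rule continuous_map_from_subtopology_mono) (auto intro: image_mono)

lemma Ob_S_subset: "U \<in> Ob (nbs S) \<Longrightarrow> pfst ` U \<subseteq> topspace X"
  by (simp add: Ob_S_iff openin_subset)

lemma shift_base_apply: "U \<in> Ob (nbs S) \<Longrightarrow> p \<in> U \<Longrightarrow> shift Y \<rho> (pfst ` U) g p = act \<rho> p (g (pfst p))"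
  by (simp add: Ob_S_iff shift_apply)

lemma shift_base_extensional: "U \<in> Ob (nbs S) \<Longrightarrow> shift Y \<rho> (pfst ` U) g \<in> extensional U"
  unfolding Ob_S_iff shift_def by (metis restrict_extensional)

lemma shift_base_mem:
  assumes "U \<in> Ob (nbs S)" "continuous_map (subtopology X (pfst ` U)) (gtop G) g" "p \<in> U"
  shows "shift Y \<rho> (pfst ` U) g p \<in> U"
proof -
  have "p \<in> box (pfst ` U)" using assms(1,3) by (simp add: Ob_S_iff)
  moreover have "g (pfst p) \<in> topspace (gtop G)"
    using continuous_on_base_mem[OF assms(2) Ob_S_subset[OF assms(1)]] assms(3) by blast
  ultimately have "act \<rho> p (g (pfst p)) \<in> box (pfst ` U)" by (rule act_closed)
  then show ?thesis using assms(1,3) by (simp add: Ob_S_iff shift_base_apply)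
qed

text \<open>
  Composition multiplies the group-valued functions, and restriction and inclusion restrict them. The
  axiom with content is the gluing of morphisms, which rests on effectiveness of the action.
\<close>

lemma model_space_triv_grho: "model_space S"
  unfolding model_space_def
proof (intro conjI ballI allI impI)
  show "fun_category (\<lambda>U. U) (nbs S)"
  proof (rule fun_categoryI)
    show "U \<in> Ob (nbs S) \<and> U' \<in> Ob (nbs S) \<and> f \<in> U \<rightarrow>\<^sub>E U'" if "(f, U, U') \<in> Ar (nbs S)" for f U U'
      using that shift_base_mem shift_base_extensional unfolding Ar_S_iff PiE_iff by blast
  next
    fix f h U U' U'' assume f: "(f, U, U') \<in> Ar (nbs S)" and h: "(h, U', U'') \<in> Ar (nbs S)"
    obtain k where k: "continuous_map (subtopology X (pfst ` U)) (gtop G) k" "f = shift Y \<rho> (pfst ` U) k"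
      using f unfolding Ar_S_iff by blast
    obtain l where l: "continuous_map (subtopology X (pfst ` U')) (gtop G) l" "h = shift Y \<rho> (pfst ` U') l"
      using h unfolding Ar_S_iff by blast
    have U: "U \<in> Ob (nbs S)" "U' \<in> Ob (nbs S)" "U'' \<in> Ob (nbs S)" "U \<subseteq> U'" "U' \<subseteq> U''"
      using f h unfolding Ar_S_iff by auto
    have "compose (box (pfst ` U)) h f = shift Y \<rho> (pfst ` U) (\<lambda>x. k x \<otimes>\<^bsub>grp G\<^esub> l x)"
      unfolding k(2) l(2)
      by (rule compose_shift[OF Ob_S_subset[OF U(1)] Ob_S_subset[OF U(2)] image_mono[OF U(4)] k(1) l(1)])
    then have "compose U h f = shift Y \<rho> (pfst ` U) (\<lambda>x. k x \<otimes>\<^bsub>grp G\<^esub> l x)"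
      using U(1) by (simp add: Ob_S_iff)
    moreover have "continuous_map (subtopology X (pfst ` U)) (gtop G) (\<lambda>x. k x \<otimes>\<^bsub>grp G\<^esub> l x)"
      by (rule continuous_mult[OF k(1) continuous_map_base_mono[OF l(1) U(4)]])
    ultimately show "(compose U h f, U, U'') \<in> Ar (nbs S)"
      using U unfolding Ar_S_iff by blast
  next
    fix U assume U: "U \<in> Ob (nbs S)"
    then have "(\<lambda>x\<in>U. x) = shift Y \<rho> (pfst ` U) (\<lambda>x. \<one>\<^bsub>grp G\<^esub>)"
      by (simp add: shift_one Ob_S_iff)
    then show "(\<lambda>x\<in>U. x, U, U) \<in> Ar (nbs S)"
      unfolding Ar_S_iff using U continuous_one by blast
  qed
next
  fix U assume "U \<in> Ob (nbs S)"
  then show "openin (spc S) U" by (auto simp: Ob_S intro: openin_ptimes)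
next
  fix f U U' assume f: "(f, U, U') \<in> Ar (nbs S)"
  then obtain g where g: "continuous_map (subtopology X (pfst ` U)) (gtop G) g" "f = shift Y \<rho> (pfst ` U) g"
    and U: "U \<in> Ob (nbs S)" "U \<subseteq> U'" unfolding Ar_S_iff by blast
  have "continuous_map (subtopology (spc S) U) (subtopology (spc S) U) f"
    using continuous_shift[OF Ob_S_subset[OF U(1)] g(1)] U(1) g(2) by (simp add: Ob_S_iff)
  then show "continuous_map (subtopology (spc S) U) (subtopology (spc S) U') f"
    using U(2) by (auto simp: continuous_map_in_subtopology)
next
  show "\<Union> (Ob (nbs S)) = topspace (spc S)"
  proof
    show "\<Union> (Ob (nbs S)) \<subseteq> topspace (spc S)"
    proof (rule Union_least)
      show "U \<subseteq> topspace (spc S)" if "U \<in> Ob (nbs S)" for U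
        using that by (auto simp: Ob_S intro!: ptimes_mono openin_subset del: subsetI)
    qed
    show "topspace (spc S) \<subseteq> \<Union> (Ob (nbs S))"
      unfolding Ob_S using openin_topspace[of X] by auto
  qed
next
  fix U V assume "U \<in> Ob (nbs S)" "V \<in> Ob (nbs S)"
  then obtain V' V'' where "U = box V'" "V = box V''" "openin X V'" "openin X V''"
    by (auto simp: Ob_S)
  then have "U \<inter> V = box (V' \<inter> V'')" "openin X (V' \<inter> V'')"
    by (simp_all add: ptimes_Int openin_Int)
  then show "U \<inter> V \<in> Ob (nbs S)" unfolding Ob_S by blast
next
  fix f U V U' V'
  assume f: "(f, U, V) \<in> Ar (nbs S)" and U': "U' \<in> Ob (nbs S)" "V' \<in> Ob (nbs S)"
    "U' \<subseteq> U" "V' \<subseteq> V" "f ` U' \<subseteq> V'"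
  then obtain g where g: "continuous_map (subtopology X (pfst ` U)) (gtop G) g" "f = shift Y \<rho> (pfst ` U) g"
    and U: "U \<in> Ob (nbs S)" unfolding Ar_S_iff by blast
  have "restrict f U' = shift Y \<rho> (pfst ` U') g"
  proof
    show "restrict f U' p = shift Y \<rho> (pfst ` U') g p" for p
    proof (cases "p \<in> U'")
      case True
      then have "p \<in> U" using U'(3) by blast
      then show ?thesis
        using True by (simp add: g(2) shift_base_apply[OF U] shift_base_apply[OF U'(1)])
    next
      case False
      then show ?thesis by (simp add: extensional_arb[OF shift_base_extensional[OF U'(1)]])
    qed
  qed
  moreover have "U' \<subseteq> V'"
  proof
    fix p assume p: "p \<in> U'"
    then have "f p \<in> V'" "pfst (f p) = pfst p"
      using U' U by (auto simp: g(2) shift_base_apply)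
    then have "pfst p \<in> pfst ` V'" by (metis imageI)
    moreover have "p \<in> box (pfst ` U')" using p U'(1) by (simp add: Ob_S_iff)
    ultimately have "p \<in> box (pfst ` V')" by (auto elim!: ptimesE)
    then show "p \<in> V'" using U'(2) by (simp add: Ob_S_iff)
  qed
  ultimately show "(restrict f U', U', V') \<in> Ar (nbs S)"
    unfolding Ar_S_iff using U' continuous_map_base_mono[OF g(1) U'(3)] by auto
next
  fix U U' assume U: "U \<in> Ob (nbs S)" "U' \<in> Ob (nbs S)" "U' \<subseteq> U"
  then have "(\<lambda>x\<in>U'. x) = shift Y \<rho> (pfst ` U') (\<lambda>x. \<one>\<^bsub>grp G\<^esub>)"
    by (simp add: shift_one Ob_S_iff)
  then show "(\<lambda>x\<in>U'. x, U', U) \<in> Ar (nbs S)"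
    unfolding Ar_S_iff using U continuous_one by blast
next
  fix \<F> f U V
  assume \<F>: "\<F> \<subseteq> Ar (nbs S)" and U: "U = (\<Union>(h, U', V')\<in>\<F>. U')" and V: "V = (\<Union>(h, U', V')\<in>\<F>. V')"
    and Ob: "U \<in> Ob (nbs S)" "V \<in> Ob (nbs S)" and ext: "f \<in> extensional U"
    and f: "\<forall>(h, U', V')\<in>\<F>. \<forall>x\<in>U'. f x = h x"
  let ?V = "\<lambda>i. pfst ` fst (snd i)"
  have arr: "(h, U', V') \<in> Ar (nbs S)" "\<And>p. p \<in> U' \<Longrightarrow> f p = h p" if "(h, U', V') \<in> \<F>" for h U' V'
    using that \<F> f by blast+
  have "\<exists>g. continuous_map (subtopology X (?V i)) (gtop G) g \<and> fst i = shift Y \<rho> (?V i) g \<and>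
      fst (snd i) \<in> Ob (nbs S)" if "i \<in> \<F>" for i
  proof -
    obtain h U' V' where i: "i = (h, U', V')" by (cases i)
    then have "(h, U', V') \<in> Ar (nbs S)" using arr(1) that by blast
    then show ?thesis unfolding Ar_S_iff i fst_conv snd_conv by blast
  qed
  then obtain g where g: "\<And>i. i \<in> \<F> \<Longrightarrow> continuous_map (subtopology X (?V i)) (gtop G) (g i) \<and>
      fst i = shift Y \<rho> (?V i) (g i) \<and> fst (snd i) \<in> Ob (nbs S)"
    by metis
  have base: "pfst ` U = (\<Union>i\<in>\<F>. ?V i)"
    unfolding U by (simp add: image_UN case_prod_beta)
  obtain k where k: "continuous_map (subtopology X (\<Union>i\<in>\<F>. ?V i)) (gtop G) k"
    "\<And>p. p \<in> box (\<Union>i\<in>\<F>. ?V i) \<Longrightarrow> f p = act \<rho> p (k (pfst p))"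
  proof (rule continuous_map_glue[of \<F> ?V g f])
    show "openin X (?V i)" "continuous_map (subtopology X (?V i)) (gtop G) (g i)" if "i \<in> \<F>" for i
      using g[OF that] by (simp_all add: Ob_S_iff)
    show "f p = act \<rho> p (g i (pfst p))" if "i \<in> \<F>" "p \<in> box (?V i)" for i p
    proof -
      have "p \<in> fst (snd i)" using g[OF that(1)] that(2) by (simp add: Ob_S_iff)
      then have "f p = fst i p" using arr(2)[of "fst i" "fst (snd i)" "snd (snd i)" p] that(1) by simp
      then show ?thesis using g[OF that(1)] that(2) by (simp add: shift_apply)
    qed
  qed blast
  have "f = shift Y \<rho> (pfst ` U) k"
  proof
    show "f p = shift Y \<rho> (pfst ` U) k p" for p
    proof (cases "p \<in> U")
      case True
      then have "p \<in> box (pfst ` U)" using Ob(1) unfolding Ob_S_iff by blast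
      then show ?thesis
        using k(2)[folded base] by (simp add: shift_apply)
    next
      case False
      then show ?thesis
        using extensional_arb[OF ext] extensional_arb[OF shift_base_extensional[OF Ob(1)]] by metis
    qed
  qed
  moreover have "U \<subseteq> V"
  proof
    fix p assume "p \<in> U"
    then obtain h U' V' where *: "(h, U', V') \<in> \<F>" "p \<in> U'" unfolding U by blast
    then have "U' \<subseteq> V'" using arr(1) unfolding Ar_S_iff by blast
    then show "p \<in> V" using * unfolding V by blast
  qed
  ultimately show "(f, U, V) \<in> Ar (nbs S)"
    unfolding Ar_S_iff using Ob k(1)[folded base] by blast
qed

end



section \<open>Bundle atlases are m-atlases\<close>

lemma transition_apply: "inj_on \<phi>' U' \<Longrightarrow> u \<in> U' \<Longrightarrow> transition (U, V, \<phi>) (U', V', \<phi>') (\<phi>' u) = \<phi> u"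
  by (simp add: transition_def)

lemma homeomorphic_map_open_facts:
  assumes "homeomorphic_map (subtopology S U) (subtopology T W) \<phi>" "openin S U" "openin T W"
  shows "continuous_map (subtopology S U) (subtopology T W) \<phi>" "inj_on \<phi> U" "\<phi> ` U = W"
    "\<And>Q. openin S Q \<Longrightarrow> Q \<subseteq> U \<Longrightarrow> openin T (\<phi> ` Q)"
proof -
  have top: "topspace (subtopology S U) = U" "topspace (subtopology T W) = W"
    using topspace_sub_open[OF assms(2)] topspace_sub_open[OF assms(3)] .
  show "continuous_map (subtopology S U) (subtopology T W) \<phi>"
    using assms(1) by (rule homeomorphic_imp_continuous_map)
  show "inj_on \<phi> U" "\<phi> ` U = W"
    using homeomorphic_imp_injective_map[OF assms(1)] homeomorphic_imp_surjective_map[OF assms(1)] top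
    by simp_all
  show "openin T (\<phi> ` Q)" if "openin S Q" "Q \<subseteq> U" for Q
  proof -
    have "openin (subtopology S U) Q"
      using that assms(2) by (simp add: openin_open_subtopology)
    then have "openin (subtopology T W) (\<phi> ` Q)"
      using homeomorphic_imp_open_map[OF assms(1)] unfolding open_map_def by blast
    then show ?thesis using assms(3) by (simp add: openin_open_subtopology)
  qed
qed

locale pbundle =
  fixes B :: "'a protobundle"
  assumes pb: "protobundle B"
begin

sublocale tgroup_action "bX B" "bY B" "bG B" "brho B"
  using pb by unfold_locales (simp_all add: protobundle_def)

lemma continuous_pi: "continuous_map (bE B) (bX B) (bpi B)"
  and pi_extensional: "bpi B \<in> extensional (topspace (bE B))"
  using pb by (simp_all add: protobundle_def)

text \<open>
  A bundle chart takes values in a box \<open>V \<times> Y\<close> that is open in the product, without \<open>V\<close> being assumed open.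
  The box is nevertheless a model neighborhood, as it is also the box over its own projection, and
  that projection is open.
\<close>

lemma bundle_chart_iff:
  "bundle_chart B (U, W, \<phi>) \<longleftrightarrow> openin (bE B) U \<and> W \<in> Ob (nbs S) \<and> \<phi> \<in> extensional U \<and>
     homeomorphic_map (subtopology (bE B) U) (subtopology (pprod (bX B) (bY B)) W) \<phi> \<and>
     (\<forall>u\<in>U. pfst (\<phi> u) = bpi B u)"
proof -
  have "(\<exists>V\<subseteq>topspace (bX B). W = box V) \<and> openin (pprod (bX B) (bY B)) W \<longleftrightarrow> W \<in> Ob (nbs S)"
  proof
    assume "(\<exists>V\<subseteq>topspace (bX B). W = box V) \<and> openin (pprod (bX B) (bY B)) W"
    then show "W \<in> Ob (nbs S)"
      unfolding Ob_S_iff using openin_pfst_image[of "bX B" "bY B" W] by auto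
  next
    assume "W \<in> Ob (nbs S)"
    then show "(\<exists>V\<subseteq>topspace (bX B). W = box V) \<and> openin (pprod (bX B) (bY B)) W"
      unfolding Ob_S using openin_subset[of "bX B"] by (auto intro: openin_ptimes)
  qed
  then show ?thesis
    unfolding bundle_chart_def by auto
qed

lemma bundle_chartD:
  assumes "bundle_chart B (U, W, \<phi>)"
  shows "openin (bE B) U" "W \<in> Ob (nbs S)" "\<phi> \<in> extensional U"
    "homeomorphic_map (subtopology (bE B) U) (subtopology (pprod (bX B) (bY B)) W) \<phi>"
    "\<And>u. u \<in> U \<Longrightarrow> pfst (\<phi> u) = bpi B u"
    "continuous_map (subtopology (bE B) U) (subtopology (pprod (bX B) (bY B)) W) \<phi>"
    "inj_on \<phi> U" "\<phi> ` U = W"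
    "\<And>Q. openin (bE B) Q \<Longrightarrow> Q \<subseteq> U \<Longrightarrow> openin (pprod (bX B) (bY B)) (\<phi> ` Q)"
proof -
  show *: "openin (bE B) U" "W \<in> Ob (nbs S)" "\<phi> \<in> extensional U"
    "homeomorphic_map (subtopology (bE B) U) (subtopology (pprod (bX B) (bY B)) W) \<phi>"
    "\<And>u. u \<in> U \<Longrightarrow> pfst (\<phi> u) = bpi B u"
    using assms by (simp_all add: bundle_chart_iff)
  have "openin (pprod (bX B) (bY B)) W"
    using model_space_openin[OF model_space_triv_grho *(2)] by simp
  from homeomorphic_map_open_facts[OF *(4) *(1) this]
  show "continuous_map (subtopology (bE B) U) (subtopology (pprod (bX B) (bY B)) W) \<phi>"
    "inj_on \<phi> U" "\<phi> ` U = W"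
    "\<And>Q. openin (bE B) Q \<Longrightarrow> Q \<subseteq> U \<Longrightarrow> openin (pprod (bX B) (bY B)) (\<phi> ` Q)"
    by blast+
qed

lemma chart_base:
  assumes "bundle_chart B (U, W, \<phi>)" "Q \<subseteq> U"
  shows "pfst ` \<phi> ` Q = bpi B ` Q"
  using bundle_chartD(5)[OF assms(1)] assms(2) by (auto simp: image_image subset_iff intro!: image_cong)

lemma openin_chart_base:
  assumes "bundle_chart B (U, W, \<phi>)" "openin (bE B) Q" "Q \<subseteq> U"
  shows "openin (bX B) (bpi B ` Q)"
  using openin_pfst_image[OF bundle_chartD(9)[OF assms]] chart_base[OF assms(1,3)] by simp

lemma chart_mem_box:
  assumes "bundle_chart B (U, W, \<phi>)" "u \<in> Q" "Q \<subseteq> U"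
  shows "\<phi> u \<in> box (bpi B ` Q)"
proof -
  have "\<phi> u \<in> box (pfst ` W)"
    using bundle_chartD(2,8)[OF assms(1)] assms(2,3) by (auto simp: Ob_S_iff)
  then show ?thesis
    using bundle_chartD(5)[OF assms(1), of u] assms(2,3) by (auto elim!: ptimesE)
qed

lemma chart_base_subset:
  assumes "bundle_chart B (U, W, \<phi>)" "Q \<subseteq> U"
  shows "box (bpi B ` Q) \<subseteq> W"
proof -
  have "bpi B ` Q \<subseteq> pfst ` W"
    using bundle_chartD(8)[OF assms(1)] chart_base[OF assms] assms(2) by blast
  then show ?thesis
    using bundle_chartD(2)[OF assms(1)] ptimes_mono[of _ "pfst ` W" "topspace (bY B)"] by (simp add: Ob_S_iff)
qed

text \<open>
  Charts with disjoint domains are covered by the same condition, because every function is continuous on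
  the empty base.
\<close>

lemma grho_compatible_iff:
  assumes c': "bundle_chart B (U', W', \<phi>')"
  shows "grho_compatible B (U, W, \<phi>) (U', W', \<phi>') \<longleftrightarrow>
    (\<exists>g. continuous_map (subtopology (bX B) (bpi B ` (U \<inter> U'))) (gtop (bG B)) g \<and>
       (\<forall>u \<in> U \<inter> U'. \<phi> u = act (brho B) (\<phi>' u) (g (bpi B u))))"
proof -
  have "(\<forall>p \<in> \<phi>' ` (U \<inter> U'). transition (U, W, \<phi>) (U', W', \<phi>') p = act (brho B) p (g (pfst p))) \<longleftrightarrow>
     (\<forall>u \<in> U \<inter> U'. \<phi> u = act (brho B) (\<phi>' u) (g (bpi B u)))" for g
    using bundle_chartD(5)[OF c'] by (auto simp: transition_apply[OF bundle_chartD(7)[OF c']])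
  moreover have "\<exists>g. continuous_map (subtopology (bX B) (bpi B ` (U \<inter> U'))) (gtop (bG B)) g \<and>
       (\<forall>u \<in> U \<inter> U'. \<phi> u = act (brho B) (\<phi>' u) (g (bpi B u)))" if "U \<inter> U' = {}"
    using that continuous_one by auto
  ultimately show ?thesis
    unfolding grho_compatible_def using chart_base[OF c', of "U \<inter> U'"] by auto
qed

text \<open>
  A homeomorphism onto a model neighborhood is a model function here, because all open sets of the total
  space are model neighborhoods and the image of the whole chart is one.
\<close>

lemma m_chart_iff:
  "m_chart (triv (bE B)) S (U, W, \<phi>) \<longleftrightarrow> openin (bE B) U \<and> W \<in> Ob (nbs S) \<and> \<phi> \<in> extensional U \<and>
     homeomorphic_map (subtopology (bE B) U) (subtopology (pprod (bX B) (bY B)) W) \<phi>"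
proof -
  have "model_function (nb_space (triv (bE B)) U) (nb_space S W) \<phi>"
    if U: "openin (bE B) U" and W: "W \<in> Ob (nbs S)" and ext: "\<phi> \<in> extensional U"
      and hom: "homeomorphic_map (subtopology (bE B) U) (subtopology (pprod (bX B) (bY B)) W) \<phi>"
    unfolding model_function_def
  proof (intro conjI ballI)
    have Wo: "openin (pprod (bX B) (bY B)) W"
      using model_space_openin[OF model_space_triv_grho W] by simp
    note facts = homeomorphic_map_open_facts[OF hom U Wo]
    show "\<phi> \<in> extensional (topspace (spc (nb_space (triv (bE B)) U)))"
      using ext topspace_sub_open[OF U] by (simp add: nb_space_def)
    show "continuous_map (spc (nb_space (triv (bE B)) U)) (spc (nb_space S W)) \<phi>"
      using facts(1) by (simp add: nb_space_def)
    show "{x \<in> topspace (spc (nb_space (triv (bE B)) U)). \<phi> x \<in> V} \<in> Ob (nbs (nb_space (triv (bE B)) U))"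
      if "V \<in> Ob (nbs (nb_space S W))" for V
    proof -
      have "V \<in> Ob (nbs S)" "V \<subseteq> W" using that by (simp_all add: nb_space_def)
      then have "openin (subtopology (pprod (bX B) (bY B)) W) V"
        using model_space_openin[OF model_space_triv_grho, of V] Wo by (simp add: openin_open_subtopology)
      then have "openin (subtopology (bE B) U) {x \<in> topspace (subtopology (bE B) U). \<phi> x \<in> V}"
        by (rule openin_continuous_map_preimage[OF facts(1)])
      then show ?thesis
        using U by (simp add: nb_space_def openin_open_subtopology topspace_sub_open del: topspace_subtopology)
    qed
    show "\<exists>V\<in>Ob (nbs (nb_space S W)). \<phi> ` Q \<subseteq> V" if "Q \<in> Ob (nbs (nb_space (triv (bE B)) U))" for Q
      using that W facts(3) by (intro bexI[of _ W]) (auto simp: nb_space_def)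
  qed
  moreover have "\<phi> \<in> extensional U"
    if "openin (bE B) U" "model_function (nb_space (triv (bE B)) U) (nb_space S W) \<phi>"
    using that topspace_sub_open[OF that(1)] by (simp add: model_function_def nb_space_def del: topspace_subtopology)
  ultimately show ?thesis
    unfolding m_chart_def by auto
qed

text \<open>
  The transition function is defined only on the image of \<open>U \<inter> U'\<close>, which need not be a box. But its
  group-valued function lives on the base \<open>\<pi>[U \<inter> U']\<close>, which is open, so the transition function extends to the
  shift of the whole box over that base, and this shift is an isomorphism.
\<close>

lemma m_compatible_if_grho_compatible:
  assumes c: "bundle_chart B (U, W, \<phi>)" and c': "bundle_chart B (U', W', \<phi>')"
    and comp: "grho_compatible B (U', W', \<phi>') (U, W, \<phi>)"
  shows "m_compatible S (U, W, \<phi>) (U', W', \<phi>')"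
proof -
  obtain g where g: "continuous_map (subtopology (bX B) (bpi B ` (U' \<inter> U))) (gtop (bG B)) g"
    "\<And>u. u \<in> U' \<inter> U \<Longrightarrow> \<phi>' u = act (brho B) (\<phi> u) (g (bpi B u))"
    using comp unfolding grho_compatible_iff[OF c] by blast
  let ?V = "bpi B ` (U' \<inter> U)"
  let ?h = "shift (bY B) (brho B) ?V g"
  have V: "openin (bX B) ?V"
    using openin_chart_base[OF c] bundle_chartD(1)[OF c] bundle_chartD(1)[OF c'] by (simp add: openin_Int)
  have box: "\<phi> u \<in> box ?V" "\<phi>' u \<in> box ?V" if "u \<in> U' \<inter> U" for u
    using chart_mem_box[OF c that] chart_mem_box[OF c' that] by auto
  have "?h (\<phi> u) = \<phi>' u" if "u \<in> U' \<inter> U" for u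
    using that by (simp add: shift_apply[OF box(1)[OF that]] g(2) bundle_chartD(5)[OF c])
  then have "\<forall>p\<in>\<phi> ` (U \<inter> U'). ?h p = transition (U', W', \<phi>') (U, W, \<phi>) p"
    by (auto simp: transition_apply[OF bundle_chartD(7)[OF c]])
  moreover have "\<phi> ` (U \<inter> U') \<subseteq> box ?V" "\<phi>' ` (U \<inter> U') \<subseteq> box ?V"
    using box by auto
  ultimately show ?thesis
    unfolding m_compatible_def using fun_iso_shift[OF V g(1)] by blast
qed

lemma m_compatibleD:
  assumes "m_compatible S (U, W, \<phi>) (U', W', \<phi>')" "inj_on \<phi> U"
  obtains V g where "continuous_map (subtopology (bX B) V) (gtop (bG B)) g"
    "\<And>u. u \<in> U \<inter> U' \<Longrightarrow> \<phi> u \<in> box V \<and> \<phi>' u = act (brho B) (\<phi> u) (g (pfst (\<phi> u)))"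
proof (cases "U \<inter> U' = {}")
  case True
  then show ?thesis using that continuous_one by blast
next
  case False
  then obtain h W0 W1 where h: "fun_iso (\<lambda>A. A) (nbs S) h W0 W1" "\<phi> ` (U \<inter> U') \<subseteq> W0"
    "\<forall>p\<in>\<phi> ` (U \<inter> U'). h p = transition (U', W', \<phi>') (U, W, \<phi>) p"
    using assms(1) unfolding m_compatible_def by auto
  obtain V g where V: "W0 = box V" "continuous_map (subtopology (bX B) V) (gtop (bG B)) g"
    "h = shift (bY B) (brho B) V g"
    using h(1) unfolding fun_iso_def Ar_S by blast
  show ?thesis
  proof (rule that[OF V(2)])
    show "\<phi> u \<in> box V \<and> \<phi>' u = act (brho B) (\<phi> u) (g (pfst (\<phi> u)))" if "u \<in> U \<inter> U'" for u
    proof -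
      have "\<phi> u \<in> box V" using h(2) that V(1) by blast
      then show ?thesis
        using bspec[OF h(3) imageI[OF that]] that by (simp add: V(3) shift_apply transition_apply[OF assms(2)])
    qed
  qed
qed

lemma grho_compatible_if_m_compatible:
  assumes c: "bundle_chart B (U, W, \<phi>)" and comp: "m_compatible S (U, W, \<phi>) (U', W', \<phi>')"
  shows "grho_compatible B (U', W', \<phi>') (U, W, \<phi>)"
proof -
  obtain V g where g: "continuous_map (subtopology (bX B) V) (gtop (bG B)) g"
    "\<And>u. u \<in> U \<inter> U' \<Longrightarrow> \<phi> u \<in> box V \<and> \<phi>' u = act (brho B) (\<phi> u) (g (pfst (\<phi> u)))"
    using m_compatibleD[OF comp bundle_chartD(7)[OF c]] by blast
  have "bpi B ` (U' \<inter> U) \<subseteq> V"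
    using g(2) bundle_chartD(5)[OF c] by (force dest: ptimesD)
  then have "continuous_map (subtopology (bX B) (bpi B ` (U' \<inter> U))) (gtop (bG B)) g"
    using continuous_map_from_subtopology_mono[OF g(1)] by blast
  then show ?thesis
    unfolding grho_compatible_iff[OF c] using g(2) bundle_chartD(5)[OF c] by (auto intro!: exI[of _ g])
qed

lemma m_atlas_if_bundle_atlas:
  assumes A: "bundle_atlas B A"
  shows "m_atlas (triv (bE B)) S A"
  unfolding m_atlas_def
proof (intro conjI ballI)
  have chart: "bundle_chart B c" if "c \<in> A" for c
    using A that unfolding bundle_atlas_def by blast
  show "m_chart (triv (bE B)) S c" if "c \<in> A" for c
    using chart[OF that] by (cases c) (simp add: m_chart_iff bundle_chart_iff)
  show "m_compatible S c c'" if "c \<in> A" "c' \<in> A" for c c'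
  proof -
    have "grho_compatible B c' c" using A that unfolding bundle_atlas_def by blast
    then show ?thesis
      using chart[OF that(1)] chart[OF that(2)] m_compatible_if_grho_compatible by (cases c, cases c') blast
  qed
  show "(\<Union>(U, V, \<phi>)\<in>A. U) = topspace (spc (triv (bE B)))"
    using A by (simp add: bundle_atlas_def)
qed

text \<open>
  Nothing in the notion of an m-chart refers to \<open>\<pi>\<close>. But the isomorphisms of the coordinate space
  preserve the first coordinate, so an m-chart that is compatible with an atlas of bundle charts has,
  point by point, the first coordinate of a bundle chart.
\<close>

lemma bundle_atlas_insert_if_m_atlas:
  assumes A: "bundle_atlas B A" and cA: "m_atlas (triv (bE B)) S (insert c A)"
  shows "bundle_atlas B (insert c A)"
proof -
  obtain U W \<phi> where c: "c = (U, W, \<phi>)" by (cases c)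
  have m: "m_chart (triv (bE B)) S (U, W, \<phi>)"
    using cA unfolding m_atlas_def c by blast
  have Wo: "openin (pprod (bX B) (bY B)) W"
    using m model_space_openin[OF model_space_triv_grho, of W] by (simp add: m_chart_iff)
  have inj: "inj_on \<phi> U"
    using m homeomorphic_map_open_facts(2)[OF _ _ Wo] unfolding m_chart_iff by blast
  have chartA: "bundle_chart B c'" if "c' \<in> A" for c'
    using A that unfolding bundle_atlas_def by blast
  have "pfst (\<phi> u) = bpi B u" if u: "u \<in> U" for u
  proof -
    have "u \<in> topspace (bE B)"
      using m u openin_subset unfolding m_chart_iff by blast
    then have "u \<in> (\<Union>(U, V, \<phi>)\<in>A. U)"
      using A unfolding bundle_atlas_def by blast
    then obtain U' W' \<phi>' where c': "(U', W', \<phi>') \<in> A" "u \<in> U'" by blast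
    have "m_compatible S (U, W, \<phi>) (U', W', \<phi>')"
      using cA c'(1) unfolding m_atlas_def c by blast
    then have "pfst (\<phi>' u) = pfst (\<phi> u)"
      by (rule m_compatibleD[OF _ inj]) (use u c'(2) in simp)
    then show ?thesis
      using bundle_chartD(5)[OF chartA[OF c'(1)] c'(2)] by simp
  qed
  then have "bundle_chart B c"
    using m unfolding c m_chart_iff bundle_chart_iff by blast
  then have charts: "bundle_chart B c'" if "c' \<in> insert c A" for c'
    using that chartA by blast
  moreover have "grho_compatible B c1 c2" if "c1 \<in> insert c A" "c2 \<in> insert c A" for c1 c2
  proof -
    have "m_compatible S c2 c1" using cA that unfolding m_atlas_def by blast
    then show ?thesis
      using charts[OF that(2)] grho_compatible_if_m_compatible by (cases c1, cases c2) blast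
  qed
  moreover have "(\<Union>(U, V, \<phi>)\<in>insert c A. U) = topspace (bE B)"
    using cA by (simp add: m_atlas_def)
  ultimately show ?thesis
    unfolding bundle_atlas_def by blast
qed

lemma maximal_m_atlas_if_maximal_bundle_atlas:
  assumes "maximal_bundle_atlas B A"
  shows "maximal_m_atlas (triv (bE B)) S A"
  using assms m_atlas_if_bundle_atlas bundle_atlas_insert_if_m_atlas
  unfolding maximal_bundle_atlas_def maximal_m_atlas_def by blast

end



section \<open>The category of fiber bundles\<close>

context pbundle
begin

text \<open>
  A maximal bundle atlas is closed under following a chart by an arrow of the coordinate space, that
  is, by a shift with some continuous \<open>k\<close>: the group-valued functions of the transitions to and from the
  new chart are those of the old chart multiplied by \<open>k\<close> or by its inverse, so the new chart is
  compatible with the atlas.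
\<close>

lemma twisted_chart_mem:
  assumes A: "maximal_bundle_atlas B A" and c: "(U, W, \<phi>) \<in> A"
    and h: "(h, V, V') \<in> Ar (nbs S)" and VW: "V \<subseteq> W"
  shows "({u \<in> U. \<phi> u \<in> V}, V, \<lambda>u\<in>{u \<in> U. \<phi> u \<in> V}. h (\<phi> u)) \<in> A"
proof -
  let ?U = "{u \<in> U. \<phi> u \<in> V}"
  let ?\<psi> = "\<lambda>u\<in>?U. h (\<phi> u)"
  have atlas: "bundle_atlas B A" using A by (simp add: maximal_bundle_atlas_def)
  have chartA: "bundle_chart B c" if "c \<in> A" for c
    using atlas that unfolding bundle_atlas_def by blast
  note C = chartA[OF c] and D = bundle_chartD[OF chartA[OF c]]
  obtain k where V: "V \<in> Ob (nbs S)" and k: "continuous_map (subtopology (bX B) (pfst ` V)) (gtop (bG B)) k"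
    and hk: "h = shift (bY B) (brho B) (pfst ` V) k"
    using h unfolding Ar_S_iff by blast
  have Vbox: "box (pfst ` V) = V" using V by (simp add: Ob_S_iff)
  have hV: "h p = act (brho B) p (k (pfst p))" if "p \<in> V" for p
    unfolding hk by (rule shift_base_apply[OF V that])
  have Wo: "openin (pprod (bX B) (bY B)) W" and Vo: "openin (pprod (bX B) (bY B)) V"
    using model_space_openin[OF model_space_triv_grho D(2)] model_space_openin[OF model_space_triv_grho V] by simp_all
  have topU: "topspace (subtopology (bE B) U) = U"
    by (rule topspace_sub_open[OF D(1)])
  have "openin (subtopology (pprod (bX B) (bY B)) W) V"
    using Wo Vo VW by (simp add: openin_open_subtopology)
  from openin_continuous_map_preimage[OF D(6) this]
  have Uo: "openin (bE B) ?U"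
    unfolding topU using D(1) by (simp add: openin_open_subtopology)
  have "homeomorphic_map (subtopology (subtopology (bE B) U) ?U)
      (subtopology (subtopology (pprod (bX B) (bY B)) W) V) \<phi>"
    by (rule homeomorphic_map_subtopologies_alt[OF D(4)]) (use topU in auto)
  then have h1: "homeomorphic_map (subtopology (bE B) ?U) (subtopology (pprod (bX B) (bY B)) V) \<phi>"
    using VW by (simp add: subtopology_subtopology Int_absorb1 Collect_conj_eq)
  have h2: "homeomorphic_map (subtopology (pprod (bX B) (bY B)) V) (subtopology (pprod (bX B) (bY B)) V) h"
    using homeomorphic_shift[OF Ob_S_subset[OF V] k] by (simp add: Vbox hk)
  have hom: "homeomorphic_map (subtopology (bE B) ?U) (subtopology (pprod (bX B) (bY B)) V) ?\<psi>"
    by (rule homeomorphic_map_eq[OF homeomorphic_map_compose[OF h1 h2]])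
       (use topspace_sub_open[OF Uo] in \<open>simp del: topspace_subtopology\<close>)
  have pf: "pfst (?\<psi> u) = bpi B u" if "u \<in> ?U" for u
    using that D(5) hV by simp
  have chart: "bundle_chart B (?U, V, ?\<psi>)"
    unfolding bundle_chart_iff using Uo V hom pf by auto
  have \<psi>: "?\<psi> u = act (brho B) (\<phi> u) (k (bpi B u))" if "u \<in> ?U" for u
    using that D(5) hV by simp
  have base: "bpi B ` ?U \<subseteq> pfst ` V"
    using D(5) by force
  have kmem: "k (bpi B u) \<in> topspace (gtop (bG B))" if "u \<in> ?U" for u
    using continuous_on_base_mem[OF k Ob_S_subset[OF V]] base that by blast
  have from_new: "grho_compatible B c1 (?U, V, ?\<psi>)" and to_new: "grho_compatible B (?U, V, ?\<psi>) c1"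
    if c1: "c1 \<in> A" for c1
  proof -
    obtain U1 W1 \<phi>1 where c1': "c1 = (U1, W1, \<phi>1)" by (cases c1)
    have C1: "bundle_chart B (U1, W1, \<phi>1)" using chartA[OF c1] c1' by simp
    have sub: "bpi B ` (U1 \<inter> ?U) \<subseteq> topspace (bX B)"
      using openin_chart_base[OF C1, of "U1 \<inter> ?U"] bundle_chartD(1)[OF C1] Uo
      by (auto dest: openin_subset simp: openin_Int)
    have k': "continuous_map (subtopology (bX B) (bpi B ` (U1 \<inter> ?U))) (gtop (bG B)) k"
      by (rule continuous_map_from_subtopology_mono[OF k]) (use base in blast)
    obtain g where g: "continuous_map (subtopology (bX B) (bpi B ` (U1 \<inter> U))) (gtop (bG B)) g"
      "\<And>u. u \<in> U1 \<inter> U \<Longrightarrow> \<phi>1 u = act (brho B) (\<phi> u) (g (bpi B u))"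
      using atlas c c1 unfolding bundle_atlas_def c1' by (metis grho_compatible_iff[OF C])
    have g': "continuous_map (subtopology (bX B) (bpi B ` (U1 \<inter> ?U))) (gtop (bG B)) g"
      by (rule continuous_map_from_subtopology_mono[OF g(1)]) auto
    show "grho_compatible B c1 (?U, V, ?\<psi>)"
      unfolding c1' grho_compatible_iff[OF chart]
    proof (intro exI conjI ballI)
      show "continuous_map (subtopology (bX B) (bpi B ` (U1 \<inter> ?U))) (gtop (bG B))
          (\<lambda>x. inv\<^bsub>grp (bG B)\<^esub> k x \<otimes>\<^bsub>grp (bG B)\<^esub> g x)"
        by (rule continuous_mult[OF continuous_inv[OF k'] g'])
      fix u assume u: "u \<in> U1 \<inter> ?U"
      have p: "\<phi> u \<in> box (pfst ` V)" using u Vbox by simp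
      have K: "k (bpi B u) \<in> topspace (gtop (bG B))" using kmem u by blast
      have "g (bpi B u) \<in> topspace (gtop (bG B))"
        using continuous_on_base_mem[OF g' sub] u by blast
      then have "act (brho B) (?\<psi> u) (inv\<^bsub>grp (bG B)\<^esub> k (bpi B u) \<otimes>\<^bsub>grp (bG B)\<^esub> g (bpi B u)) =
          act (brho B) (act (brho B) (?\<psi> u) (inv\<^bsub>grp (bG B)\<^esub> k (bpi B u))) (g (bpi B u))"
        using u by (simp only: \<psi> Int_iff act_act[OF act_closed[OF p K] inv_closed[OF K]])
      also have "\<dots> = \<phi>1 u"
        using u g(2)[of u] by (simp only: \<psi> Int_iff act_inv(1)[OF p K]) simp
      finally show "\<phi>1 u = act (brho B) (?\<psi> u) (inv\<^bsub>grp (bG B)\<^esub> k (bpi B u) \<otimes>\<^bsub>grp (bG B)\<^esub> g (bpi B u))" ..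
    qed
    obtain l where l: "continuous_map (subtopology (bX B) (bpi B ` (U \<inter> U1))) (gtop (bG B)) l"
      "\<And>u. u \<in> U \<inter> U1 \<Longrightarrow> \<phi> u = act (brho B) (\<phi>1 u) (l (bpi B u))"
      using atlas c c1 unfolding bundle_atlas_def c1' by (metis grho_compatible_iff[OF C1])
    have l': "continuous_map (subtopology (bX B) (bpi B ` (?U \<inter> U1))) (gtop (bG B)) l"
      by (rule continuous_map_from_subtopology_mono[OF l(1)]) auto
    show "grho_compatible B (?U, V, ?\<psi>) c1"
      unfolding c1' grho_compatible_iff[OF C1]
    proof (intro exI conjI ballI)
      show "continuous_map (subtopology (bX B) (bpi B ` (?U \<inter> U1))) (gtop (bG B))
          (\<lambda>x. l x \<otimes>\<^bsub>grp (bG B)\<^esub> k x)"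
        by (rule continuous_mult[OF l' k'[unfolded Int_commute[of U1]]])
      fix u assume u: "u \<in> ?U \<inter> U1"
      have p: "\<phi>1 u \<in> box (bpi B ` U1)" using chart_mem_box[OF C1, of u U1] u by simp
      have K: "k (bpi B u) \<in> topspace (gtop (bG B))" using kmem u by blast
      have L: "l (bpi B u) \<in> topspace (gtop (bG B))"
        by (rule continuous_on_base_mem[OF l' sub[unfolded Int_commute[of U1]] imageI[OF u]])
      show "?\<psi> u = act (brho B) (\<phi>1 u) (l (bpi B u) \<otimes>\<^bsub>grp (bG B)\<^esub> k (bpi B u))"
        using u \<psi>[of u] l(2)[of u] act_act[OF p L K] by simp
    qed
  qed
  have self: "grho_compatible B (?U, V, ?\<psi>) (?U, V, ?\<psi>)"
    unfolding grho_compatible_iff[OF chart]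
  proof (intro exI conjI ballI)
    show "continuous_map (subtopology (bX B) (bpi B ` (?U \<inter> ?U))) (gtop (bG B)) (\<lambda>x. \<one>\<^bsub>grp (bG B)\<^esub>)"
      by (rule continuous_one)
    show "?\<psi> u = act (brho B) (?\<psi> u) \<one>\<^bsub>grp (bG B)\<^esub>" if "u \<in> ?U \<inter> ?U" for u
      using act_one[OF chart_mem_box[OF chart, of u ?U]] that by simp
  qed
  have "bundle_atlas B (insert (?U, V, ?\<psi>) A)"
    unfolding bundle_atlas_def
  proof (intro conjI ballI)
    show "bundle_chart B c" if "c \<in> insert (?U, V, ?\<psi>) A" for c
      using that chart chartA by blast
    show "grho_compatible B c1 c2" if "c1 \<in> insert (?U, V, ?\<psi>) A" "c2 \<in> insert (?U, V, ?\<psi>) A" for c1 c2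
      using that self from_new to_new atlas unfolding bundle_atlas_def by blast
    have "(\<Union>(U, V, \<phi>)\<in>A. U) = topspace (bE B)"
      using atlas by (simp add: bundle_atlas_def)
    then show "(\<Union>(U, V, \<phi>)\<in>insert (?U, V, ?\<psi>) A. U) = topspace (bE B)"
      using c by auto
  qed
  then show ?thesis
    using A unfolding maximal_bundle_atlas_def by blast
qed

end

text \<open>
  The next two predicates isolate the local clause of a bundle map. It involves the maps of
  total spaces and coordinate spaces only, and is the part of the definition whose stability under
  composition is not formal.
\<close>

definition local_product_at ::
  "'a protobundle \<Rightarrow> 'a protobundle \<Rightarrow> ('a point \<Rightarrow> 'a point) \<Rightarrow> ('a point \<Rightarrow> 'a point) \<Rightarrow>
   'a point set \<Rightarrow> 'a point set \<Rightarrow> ('a point \<Rightarrow> 'a point) \<Rightarrow>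
   'a point set \<Rightarrow> 'a point set \<Rightarrow> ('a point \<Rightarrow> 'a point) \<Rightarrow> 'a point \<Rightarrow> bool" where
  "local_product_at B1 B2 fE f1 U1 V1 \<phi>1 U2 V2 \<phi>2 x \<longleftrightarrow>
     (let T2 = nbs (triv_grho (bX B2) (bY B2) (bG B2) (brho B2)) in
       \<exists>U1' V1' U2'. \<exists>V2' \<in> Ob T2. \<exists>V2h \<in> Ob T2. \<exists>fh.
         openin (bE B1) U1' \<and> openin (pprod (bX B1) (bY B1)) V1' \<and> openin (bE B2) U2' \<and>
         U1' \<subseteq> {u \<in> U1. fE u \<in> U2} \<and> V1' \<subseteq> V1 \<and> U2' \<subseteq> U2 \<and> V2' \<subseteq> V2 \<and>
         fun_iso (\<lambda>A. A) T2 fh V2' V2h \<and>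
         local_square x U1' V1' U2' V2' V2h fh \<phi>1 \<phi>2 fE f1)"

definition local_product_map ::
  "'a fbundle \<Rightarrow> 'a fbundle \<Rightarrow> ('a point \<Rightarrow> 'a point) \<Rightarrow> ('a point \<Rightarrow> 'a point) \<Rightarrow> bool" where
  "local_product_map = (\<lambda>(A1, B1) (A2, B2) fE f1.
     \<forall>(U1, V1, \<phi>1) \<in> A1. \<forall>(U2, V2, \<phi>2) \<in> A2. \<forall>x \<in> {u \<in> U1. fE u \<in> U2}.
       local_product_at B1 B2 fE f1 U1 V1 \<phi>1 U2 V2 \<phi>2 x)"

lemma local_product_mapI:
  assumes "\<And>U1 V1 \<phi>1 U2 V2 \<phi>2 x. (U1, V1, \<phi>1) \<in> A1 \<Longrightarrow> (U2, V2, \<phi>2) \<in> A2 \<Longrightarrow> x \<in> U1 \<Longrightarrow> fE x \<in> U2 \<Longrightarrow>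
    local_product_at B1 B2 fE f1 U1 V1 \<phi>1 U2 V2 \<phi>2 x"
  shows "local_product_map (A1, B1) (A2, B2) fE f1"
  using assms by (auto simp: local_product_map_def)

lemma local_product_mapD:
  assumes "local_product_map (A1, B1) (A2, B2) fE f1" "(U1, V1, \<phi>1) \<in> A1" "(U2, V2, \<phi>2) \<in> A2"
    "x \<in> U1" "fE x \<in> U2"
  shows "local_product_at B1 B2 fE f1 U1 V1 \<phi>1 U2 V2 \<phi>2 x"
  using assms unfolding local_product_map_def by fast

lemma bundle_map_iff:
  "bundle_map (A1, B1) (A2, B2) (fE, fX, fY, fG) \<longleftrightarrow>
     fE \<in> extensional (topspace (bE B1)) \<and> continuous_map (bE B1) (bE B2) fE \<and>
     fX \<in> extensional (topspace (bX B1)) \<and> continuous_map (bX B1) (bX B2) fX \<and>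
     fY \<in> extensional (topspace (bY B1)) \<and> continuous_map (bY B1) (bY B2) fY \<and>
     fG \<in> extensional (topspace (gtop (bG B1))) \<and> cont_hom (bG B1) (bG B2) fG \<and>
     (\<forall>u \<in> topspace (bE B1). bpi B2 (fE u) = fX (bpi B1 u)) \<and>
     (\<forall>y \<in> topspace (bY B1). \<forall>g \<in> topspace (gtop (bG B1)).
        brho B2 (fY y, fG g) = fY (brho B1 (y, g))) \<and>
     local_product_map (A1, B1) (A2, B2) fE (pmap (bX B1) (bY B1) fX fY)"
  unfolding bundle_map_def local_product_map_def local_product_at_def Let_def by simp

text \<open>
  For the identity the twist between two charts of one atlas is their transition function, extended to
  the box over the base of the overlap.
\<close>

lemma local_product_map_ident:
  assumes "protobundle B" and A: "bundle_atlas B A"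
  shows "local_product_map (A, B) (A, B) (\<lambda>u\<in>topspace (bE B). u) (\<lambda>p\<in>topspace (pprod (bX B) (bY B)). p)"
proof -
  interpret pbundle B by unfold_locales (rule assms(1))
  show ?thesis
  proof (rule local_product_mapI)
    fix U1 V1 \<phi>1 U2 V2 \<phi>2 x
    assume c1: "(U1, V1, \<phi>1) \<in> A" and c2: "(U2, V2, \<phi>2) \<in> A"
      and x: "x \<in> U1" "(\<lambda>u\<in>topspace (bE B). u) x \<in> U2"
    have C1: "bundle_chart B (U1, V1, \<phi>1)" and C2: "bundle_chart B (U2, V2, \<phi>2)"
      using A c1 c2 unfolding bundle_atlas_def by blast+
    have sub: "U1 \<subseteq> topspace (bE B)"
      by (rule openin_subset[OF bundle_chartD(1)[OF C1]])
    let ?U = "U1 \<inter> U2"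
    let ?O = "bpi B ` ?U"
    have Uo: "openin (bE B) ?U"
      using bundle_chartD(1)[OF C1] bundle_chartD(1)[OF C2] by (rule openin_Int)
    have Oo: "openin (bX B) ?O"
      using openin_chart_base[OF C1 Uo] by simp
    have "grho_compatible B (U1, V1, \<phi>1) (U2, V2, \<phi>2)"
      using A c1 c2 unfolding bundle_atlas_def by blast
    then obtain g where g: "continuous_map (subtopology (bX B) ?O) (gtop (bG B)) g"
      "\<And>u. u \<in> ?U \<Longrightarrow> \<phi>1 u = act (brho B) (\<phi>2 u) (g (bpi B u))"
      unfolding grho_compatible_iff[OF C2] by blast
    let ?h = "shift (bY B) (brho B) ?O g"
    have box: "\<phi>1 u \<in> box ?O" "\<phi>2 u \<in> box ?O" if "u \<in> ?U" for u
      using chart_mem_box[OF C1 that] chart_mem_box[OF C2 that] by auto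
    have boxO: "box ?O \<in> Ob (nbs S)" using Oo by (auto simp: Ob_S)
    have boxsub: "box ?O \<subseteq> topspace (pprod (bX B) (bY B))"
      using openin_subset[OF model_space_openin[OF model_space_triv_grho boxO]] by simp
    have "local_square x ?U (box ?O) ?U (box ?O) (box ?O) ?h \<phi>1 \<phi>2 (\<lambda>u\<in>topspace (bE B). u)
           (\<lambda>p\<in>topspace (pprod (bX B) (bY B)). p)"
      unfolding local_square_def
    proof (intro conjI ballI)
      show xU: "x \<in> ?U" using x sub by auto
      show "(\<lambda>p\<in>topspace (pprod (bX B) (bY B)). p) (\<phi>1 x) \<in> box ?O"
        using box(1)[OF xU] boxsub by auto
      show "(\<lambda>u\<in>topspace (bE B). u) ` ?U \<subseteq> ?U" using sub by auto
      show "\<phi>1 ` ?U \<subseteq> box ?O" "\<phi>2 ` ?U \<subseteq> box ?O" using box by blast+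
      show "(\<lambda>p\<in>topspace (pprod (bX B) (bY B)). p) ` box ?O \<subseteq> box ?O" using boxsub by auto
      show "?h (\<phi>2 ((\<lambda>u\<in>topspace (bE B). u) u)) = (\<lambda>p\<in>topspace (pprod (bX B) (bY B)). p) (\<phi>1 u)"
        if u: "u \<in> ?U" for u
      proof -
        have "u \<in> topspace (bE B)" using u sub by blast
        moreover have "\<phi>1 u \<in> topspace (pprod (bX B) (bY B))" using box(1)[OF u] boxsub by blast
        moreover have "?h (\<phi>2 u) = \<phi>1 u"
          using u g(2)[OF u] bundle_chartD(5)[OF C2, of u] by (simp add: shift_apply[OF box(2)[OF u]])
        ultimately show ?thesis by simp
      qed
    qed
    moreover have "openin (pprod (bX B) (bY B)) (box ?O)"
      using model_space_openin[OF model_space_triv_grho boxO] by simp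
    moreover have "box ?O \<subseteq> V1" "box ?O \<subseteq> V2"
      using chart_base_subset[OF C1, of ?U] chart_base_subset[OF C2, of ?U] by auto
    moreover have "?U \<subseteq> {u \<in> U1. (\<lambda>u\<in>topspace (bE B). u) u \<in> U2}"
      using sub by auto
    ultimately show "local_product_at B B (\<lambda>u\<in>topspace (bE B). u)
        (\<lambda>p\<in>topspace (pprod (bX B) (bY B)). p) U1 V1 \<phi>1 U2 V2 \<phi>2 x"
      unfolding local_product_at_def Let_def using Uo boxO fun_iso_shift[OF Oo g(1)] by blast
  qed
qed

text \<open>
  Two local squares over the same middle chart \<open>\<phi>2\<close> cannot simply be pasted: the first map agrees with a product
  map only up to a twist \<open>fh\<close> following \<open>\<phi>2\<close>, and \<open>fh\<close> cannot in general be pushed forward to the third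
  bundle when the second base map is not injective. Instead the twist is absorbed into the middle chart. By
  maximality \<open>fh \<circ> \<phi>2\<close> is again a chart of the middle atlas, and the local condition of the second map
  holds for this chart as well.
\<close>

lemma local_product_map_compose:
  assumes B: "protobundle B2" and A2: "maximal_bundle_atlas B2 A2" and B1: "bundle_atlas B1 A1" "protobundle B1"
    and fE: "continuous_map (bE B1) (bE B2) fE"
    and f1: "continuous_map (pprod (bX B1) (bY B1)) (pprod (bX B2) (bY B2)) f1"
    and f: "local_product_map (A1, B1) (A2, B2) fE f1"
    and g: "local_product_map (A2, B2) (A3, B3) gE g1"
  shows "local_product_map (A1, B1) (A3, B3) (compose (topspace (bE B1)) gE fE)
     (compose (topspace (pprod (bX B1) (bY B1))) g1 f1)"
proof -
  interpret pbundle B2 by unfold_locales (rule B)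
  interpret one: pbundle B1 by unfold_locales (rule B1(2))
  let ?E = "topspace (bE B1)" and ?P = "topspace (pprod (bX B1) (bY B1))"
  let ?S3 = "nbs (triv_grho (bX B3) (bY B3) (bG B3) (brho B3))"
  show ?thesis
  proof (rule local_product_mapI)
    fix U1 V1 \<phi>1 U3 V3 \<phi>3 x
    assume c1: "(U1, V1, \<phi>1) \<in> A1" and c3: "(U3, V3, \<phi>3) \<in> A3"
      and x: "x \<in> U1" "compose ?E gE fE x \<in> U3"
    have C1: "bundle_chart B1 (U1, V1, \<phi>1)" using B1(1) c1 unfolding bundle_atlas_def by blast
    have U1sub: "U1 \<subseteq> ?E" by (rule openin_subset[OF one.bundle_chartD(1)[OF C1]])
    have atlas: "(\<Union>(U, V, \<phi>)\<in>A2. U) = topspace (bE B2)"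
      using A2 by (simp add: maximal_bundle_atlas_def bundle_atlas_def)
    have fx: "fE x \<in> topspace (bE B2)"
      using x U1sub continuous_map_funspace[OF fE] by auto
    then obtain U2 V2 \<phi>2 where c2: "(U2, V2, \<phi>2) \<in> A2" "fE x \<in> U2"
      unfolding atlas[symmetric] by blast
    obtain U1' V1' U2' V2' V2h fh where F: "openin (bE B1) U1'" "openin (pprod (bX B1) (bY B1)) V1'"
      "openin (bE B2) U2'" "U1' \<subseteq> {u \<in> U1. fE u \<in> U2}" "V1' \<subseteq> V1" "U2' \<subseteq> U2" "V2' \<subseteq> V2"
      "fun_iso (\<lambda>A. A) (nbs S) fh V2' V2h" "local_square x U1' V1' U2' V2' V2h fh \<phi>1 \<phi>2 fE f1"
      using local_product_mapD[OF f c1 c2(1) x(1) c2(2)] unfolding local_product_at_def Let_def by blast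
    let ?Q = "{u \<in> U2. \<phi>2 u \<in> V2'}"
    let ?\<psi> = "\<lambda>u\<in>?Q. fh (\<phi>2 u)"
    have "(fh, V2', V2h) \<in> Ar (nbs S)" using F(8) by (simp add: fun_iso_def)
    then have tw: "(?Q, V2', ?\<psi>) \<in> A2"
      using twisted_chart_mem[OF A2 c2(1) _ F(7)] by blast
    have sq: "x \<in> U1'" "f1 ` V1' \<subseteq> V2h" "fE ` U1' \<subseteq> U2'" "\<phi>1 ` U1' \<subseteq> V1'" "\<phi>2 ` U2' \<subseteq> V2'"
      "\<And>u. u \<in> U1' \<Longrightarrow> fh (\<phi>2 (fE u)) = f1 (\<phi>1 u)"
      using F(9) unfolding local_square_def by blast+
    have Q: "fE u \<in> ?Q" if "u \<in> U1'" for u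
      using that sq(3,5) F(6) by blast
    have "gE (fE x) \<in> U3" using x U1sub by (auto simp: compose_def)
    from local_product_mapD[OF g tw c3 Q[OF sq(1)] this] obtain P V2'' U3' V3' V3h gh where H: "openin (bE B2) P" "openin (pprod (bX B2) (bY B2)) V2''"
      "openin (bE B3) U3'" "V3' \<in> Ob ?S3" "V3h \<in> Ob ?S3" "P \<subseteq> {u \<in> ?Q. gE u \<in> U3}" "V2'' \<subseteq> V2'" "U3' \<subseteq> U3" "V3' \<subseteq> V3"
      "fun_iso (\<lambda>A. A) ?S3 gh V3' V3h" "local_square (fE x) P V2'' U3' V3' V3h gh ?\<psi> \<phi>3 gE g1"
      unfolding local_product_at_def Let_def by blast
    have sr: "fE x \<in> P" "g1 ` V2'' \<subseteq> V3h" "gE ` P \<subseteq> U3'" "?\<psi> ` P \<subseteq> V2''" "\<phi>3 ` U3' \<subseteq> V3'"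
      "\<And>u. u \<in> P \<Longrightarrow> gh (\<phi>3 (gE u)) = g1 (?\<psi> u)"
      using H(11) unfolding local_square_def by blast+
    \<comment> \<open>Over \<open>U\<close> both squares are available, the second one at the point \<open>fE u\<close>.\<close>
    define U where "U = U1' \<inter> {u \<in> ?E. fE u \<in> P}"
    define V where "V = V1' \<inter> {p \<in> ?P. f1 p \<in> V2''}"
    have Uo: "openin (bE B1) U"
      unfolding U_def using F(1) openin_continuous_map_preimage[OF fE H(1)] by (rule openin_Int)
    have Vo: "openin (pprod (bX B1) (bY B1)) V"
      unfolding V_def using F(2) openin_continuous_map_preimage[OF f1 H(2)] by (rule openin_Int)
    have U: "u \<in> U1'" "u \<in> ?E" "fE u \<in> P" if "u \<in> U" for u
      using that by (auto simp: U_def)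
    have \<phi>1V: "\<phi>1 u \<in> V" "?\<psi> (fE u) = f1 (\<phi>1 u)" if u: "u \<in> U" for u
    proof -
      show eq: "?\<psi> (fE u) = f1 (\<phi>1 u)"
        using Q[OF U(1)[OF u]] sq(6)[OF U(1)[OF u]] by simp
      have "\<phi>1 u \<in> V1'" using sq(4) U(1)[OF u] by blast
      moreover have "V1' \<subseteq> ?P" by (rule openin_subset[OF F(2)])
      moreover have "?\<psi> (fE u) \<in> V2''" using sr(4) U(3)[OF u] by blast
      ultimately show "\<phi>1 u \<in> V" unfolding V_def eq by blast
    qed
    have VP: "V \<subseteq> ?P" by (auto simp: V_def)
    have xU: "x \<in> U" using sq(1) sr(1) x U1sub by (auto simp: U_def)
    have gV: "compose ?P g1 f1 ` V \<subseteq> V3h"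
      using sr(2) by (auto simp: V_def compose_def)
    have "local_square x U V U3' V3' V3h gh \<phi>1 \<phi>3 (compose ?E gE fE) (compose ?P g1 f1)"
      unfolding local_square_def
    proof (intro conjI ballI)
      show "x \<in> U" by (rule xU)
      show "compose ?P g1 f1 (\<phi>1 x) \<in> V3h" using gV \<phi>1V(1)[OF xU] by blast
      show "compose ?E gE fE ` U \<subseteq> U3'" using sr(3) U by (auto simp: compose_def)
      show "\<phi>1 ` U \<subseteq> V" using \<phi>1V(1) by blast
      show "compose ?P g1 f1 ` V \<subseteq> V3h" by (rule gV)
      show "\<phi>3 ` U3' \<subseteq> V3'" by (rule sr(5))
      show "gh (\<phi>3 (compose ?E gE fE u)) = compose ?P g1 f1 (\<phi>1 u)" if u: "u \<in> U" for u
      proof -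
        have "\<phi>1 u \<in> ?P" using \<phi>1V(1)[OF u] VP by blast
        then show ?thesis
          using U[OF u] sr(6)[OF U(3)[OF u]] \<phi>1V(2)[OF u] by (simp add: compose_eq)
      qed
    qed
    moreover have "U \<subseteq> {u \<in> U1. compose ?E gE fE u \<in> U3}"
      using U F(4) H(6) by (fastforce simp: compose_def)
    moreover have "V \<subseteq> V1" using F(5) by (auto simp: V_def)
    ultimately show "local_product_at B1 B3 (compose ?E gE fE) (compose ?P g1 f1) U1 V1 \<phi>1 U3 V3 \<phi>3 x"
      unfolding local_product_at_def Let_def using Uo Vo H(3,4,5,8,9,10) by blast
  qed
qed


lemma pmap_ident: "pmap X Y (\<lambda>x\<in>topspace X. x) (\<lambda>y\<in>topspace Y. y) = (\<lambda>p\<in>topspace (pprod X Y). p)"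
  by (auto simp: pmap_def fun_eq_iff elim!: ptimesE)

lemma pmap_compose:
  assumes "continuous_map X1 X2 fX" "continuous_map Y1 Y2 fY"
  shows "pmap X1 Y1 (compose (topspace X1) gX fX) (compose (topspace Y1) gY fY) =
    compose (topspace (pprod X1 Y1)) (pmap X2 Y2 gX gY) (pmap X1 Y1 fX fY)"
proof
  fix p
  show "pmap X1 Y1 (compose (topspace X1) gX fX) (compose (topspace Y1) gY fY) p =
    compose (topspace (pprod X1 Y1)) (pmap X2 Y2 gX gY) (pmap X1 Y1 fX fY) p"
  proof (cases "p \<in> ptimes (topspace X1) (topspace Y1)")
    case True
    then show ?thesis
      using continuous_map_funspace[OF assms(1)] continuous_map_funspace[OF assms(2)]
      by (auto simp: compose_eq Pi_iff elim!: ptimesE)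
  qed (simp add: pmap_def compose_def)
qed

lemma cont_hom_ident:
  assumes "topological_group G"
  shows "cont_hom G G (\<lambda>g\<in>topspace (gtop G). g)"
proof -
  have "carrier (grp G) = topspace (gtop G)" "group (grp G)"
    using assms by (simp_all add: topological_group_def)
  moreover from this have "g \<otimes>\<^bsub>grp G\<^esub> h \<in> topspace (gtop G)"
    if "g \<in> topspace (gtop G)" "h \<in> topspace (gtop G)" for g h
    using that monoid.m_closed[of "grp G" g h] by (simp add: group.is_monoid)
  moreover have "continuous_map (gtop G) (gtop G) (\<lambda>g\<in>topspace (gtop G). g)"
    by (rule continuous_map_eq[OF continuous_map_id]) auto
  ultimately show ?thesis
    unfolding cont_hom_def by (auto intro!: homI)
qed

lemma cont_homD:
  assumes "cont_hom G H f" "topological_group G"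
  shows "continuous_map (gtop G) (gtop H) f"
    "\<And>g h. g \<in> topspace (gtop G) \<Longrightarrow> h \<in> topspace (gtop G) \<Longrightarrow> f (g \<otimes>\<^bsub>grp G\<^esub> h) = f g \<otimes>\<^bsub>grp H\<^esub> f h"
    "\<And>g. g \<in> topspace (gtop G) \<Longrightarrow> f g \<in> topspace (gtop H)"
  using assms continuous_map_funspace[of "gtop G" "gtop H" f]
  by (auto simp: cont_hom_def topological_group_def intro: hom_mult)

lemma cont_hom_compose:
  assumes G: "topological_group G" "topological_group H" "topological_group K"
    and f: "cont_hom G H f" and g: "cont_hom H K g"
  shows "cont_hom G K (compose (topspace (gtop G)) g f)"
proof -
  have c: "carrier (grp G) = topspace (gtop G)" "group (grp G)" "carrier (grp K) = topspace (gtop K)"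
    using G by (simp_all add: topological_group_def)
  then have m: "g \<otimes>\<^bsub>grp G\<^esub> h \<in> topspace (gtop G)"
    if "g \<in> topspace (gtop G)" "h \<in> topspace (gtop G)" for g h
    using that monoid.m_closed[of "grp G" g h] by (simp add: group.is_monoid)
  note F = cont_homD[OF f G(1)] and H = cont_homD[OF g G(2)]
  have "compose (topspace (gtop G)) g f \<in> hom (grp G) (grp K)"
    by (rule homI) (use m F(2,3) H(2,3) in \<open>auto simp: c compose_eq\<close>)
  moreover have "continuous_map (gtop G) (gtop K) (compose (topspace (gtop G)) g f)"
    by (rule continuous_map_compose_restrict[OF F(1) H(1) refl])
  ultimately show ?thesis by (simp add: cont_hom_def)
qed

definition id_bmap :: "'a protobundle \<Rightarrow> 'a bmap" where
  "id_bmap B = (\<lambda>u\<in>topspace (bE B). u, \<lambda>x\<in>topspace (bX B). x, \<lambda>y\<in>topspace (bY B). y,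
     \<lambda>g\<in>topspace (gtop (bG B)). g)"

lemma bundle_map_ident:
  assumes B: "protobundle B" and A: "bundle_atlas B A"
  shows "bundle_map (A, B) (A, B) (id_bmap B)"
proof -
  interpret pbundle B by unfold_locales (rule B)
  have id: "continuous_map T T (\<lambda>x\<in>topspace T. x)" for T :: "'a point topology"
    by (rule continuous_map_eq[OF continuous_map_id]) auto
  show ?thesis
    unfolding id_bmap_def bundle_map_iff pmap_ident
    using id cont_hom_ident[OF tgroup] local_product_map_ident[OF B A]
      continuous_map_funspace[OF continuous_pi] action_closed
    by auto
qed

lemma bundle_map_compose:
  assumes B: "protobundle B1" "protobundle B2" "protobundle B3"
    and A: "bundle_atlas B1 A1" "maximal_bundle_atlas B2 A2"
    and f: "bundle_map (A1, B1) (A2, B2) (fE, fX, fY, fG)"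
    and g: "bundle_map (A2, B2) (A3, B3) (gE, gX, gY, gG)"
  shows "bundle_map (A1, B1) (A3, B3)
    (compose (topspace (bE B1)) gE fE, compose (topspace (bX B1)) gX fX,
     compose (topspace (bY B1)) gY fY, compose (topspace (gtop (bG B1))) gG fG)"
proof -
  interpret one: pbundle B1 by unfold_locales (rule B(1))
  interpret two: pbundle B2 by unfold_locales (rule B(2))
  interpret three: pbundle B3 by unfold_locales (rule B(3))
  note F = f[unfolded bundle_map_iff] and H = g[unfolded bundle_map_iff]
  have cE: "continuous_map (bE B1) (bE B2) fE" and cX: "continuous_map (bX B1) (bX B2) fX"
    and cY: "continuous_map (bY B1) (bY B2) fY" and cG: "cont_hom (bG B1) (bG B2) fG"
    and fpi: "\<And>u. u \<in> topspace (bE B1) \<Longrightarrow> bpi B2 (fE u) = fX (bpi B1 u)"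
    and frho: "\<And>y g. y \<in> topspace (bY B1) \<Longrightarrow> g \<in> topspace (gtop (bG B1)) \<Longrightarrow>
      brho B2 (fY y, fG g) = fY (brho B1 (y, g))"
    and fl: "local_product_map (A1, B1) (A2, B2) fE (pmap (bX B1) (bY B1) fX fY)"
    using F by blast+
  have dE: "continuous_map (bE B2) (bE B3) gE" and dX: "continuous_map (bX B2) (bX B3) gX"
    and dY: "continuous_map (bY B2) (bY B3) gY" and dG: "cont_hom (bG B2) (bG B3) gG"
    and gpi: "\<And>u. u \<in> topspace (bE B2) \<Longrightarrow> bpi B3 (gE u) = gX (bpi B2 u)"
    and grho: "\<And>y g. y \<in> topspace (bY B2) \<Longrightarrow> g \<in> topspace (gtop (bG B2)) \<Longrightarrow>
      brho B3 (gY y, gG g) = gY (brho B2 (y, g))"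
    and gl: "local_product_map (A2, B2) (A3, B3) gE (pmap (bX B2) (bY B2) gX gY)"
    using H by blast+
  have mem: "\<And>u. u \<in> topspace (bE B1) \<Longrightarrow> fE u \<in> topspace (bE B2)"
    "\<And>u. u \<in> topspace (bE B1) \<Longrightarrow> bpi B1 u \<in> topspace (bX B1)"
    "\<And>y. y \<in> topspace (bY B1) \<Longrightarrow> fY y \<in> topspace (bY B2)"
    "\<And>g. g \<in> topspace (gtop (bG B1)) \<Longrightarrow> fG g \<in> topspace (gtop (bG B2))"
    using continuous_map_funspace[OF cE] continuous_map_funspace[OF one.continuous_pi]
      continuous_map_funspace[OF cY] cont_homD(3)[OF cG one.tgroup] by auto
  have "local_product_map (A1, B1) (A3, B3) (compose (topspace (bE B1)) gE fE)
      (pmap (bX B1) (bY B1) (compose (topspace (bX B1)) gX fX) (compose (topspace (bY B1)) gY fY))"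
    unfolding pmap_compose[OF cX cY]
    by (rule local_product_map_compose[OF B(2) A(2) A(1) B(1) cE continuous_map_pmap[OF cX cY] fl gl])
  moreover have "cont_hom (bG B1) (bG B3) (compose (topspace (gtop (bG B1))) gG fG)"
    by (rule cont_hom_compose[OF one.tgroup two.tgroup three.tgroup cG dG])
  ultimately show ?thesis
    unfolding bundle_map_iff
    using continuous_map_compose_restrict[OF cE dE refl] continuous_map_compose_restrict[OF cX dX refl]
      continuous_map_compose_restrict[OF cY dY refl] mem fpi gpi frho grho one.action_closed
    by (simp add: compose_eq)
qed

lemma Ob_Bun [simp]: "Ob (Bun \<B>) = {(A, B). B \<in> \<B> \<and> maximal_bundle_atlas B A}"
  by (simp add: Bun_def Let_def)

lemma Ar_Bun:
  "(f, a, b) \<in> Ar (Bun \<B>) \<longleftrightarrow> a \<in> Ob (Bun \<B>) \<and> b \<in> Ob (Bun \<B>) \<and> bundle_map a b f"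
  by (simp add: Bun_def Let_def)

lemma maximal_bundle_atlasD: "maximal_bundle_atlas B A \<Longrightarrow> bundle_atlas B A"
  by (simp add: maximal_bundle_atlas_def)

lemma bundle_map_components:
  assumes "bundle_map (A1, B1) (A2, B2) (fE, fX, fY, fG)"
  shows "fE \<in> topspace (bE B1) \<rightarrow> topspace (bE B2)" "fE \<in> extensional (topspace (bE B1))"
    "fX \<in> topspace (bX B1) \<rightarrow> topspace (bX B2)" "fX \<in> extensional (topspace (bX B1))"
    "fY \<in> topspace (bY B1) \<rightarrow> topspace (bY B2)" "fY \<in> extensional (topspace (bY B1))"
    "fG \<in> topspace (gtop (bG B1)) \<rightarrow> topspace (gtop (bG B2))" "fG \<in> extensional (topspace (gtop (bG B1)))"
  using assms continuous_map_funspace unfolding bundle_map_iff cont_hom_def by blast+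

lemma identity_arrow_Bun:
  assumes BB: "\<And>B. B \<in> \<B> \<Longrightarrow> protobundle B" and a: "(A, B) \<in> Ob (Bun \<B>)"
  shows "identity_arrow bun_comp (Bun \<B>) (A, B) (id_bmap B, (A, B), (A, B))"
  unfolding identity_arrow_def
proof (intro conjI allI impI)
  show "(id_bmap B, (A, B), (A, B)) \<in> Ar (Bun \<B>)"
    using a bundle_map_ident[OF BB maximal_bundle_atlasD] by (auto simp: Ar_Bun)
  show "\<exists>e. (id_bmap B, (A, B), (A, B)) = (e, (A, B), (A, B))" by blast
  show "bun_comp (f, (A, B), b) (id_bmap B, (A, B), (A, B)) = (f, (A, B), b)"
    if f: "(f, (A, B), b) \<in> Ar (Bun \<B>)" for f b
  proof -
    obtain fE fX fY fG A' B' where *: "f = (fE, fX, fY, fG)" "b = (A', B')"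
      by (cases f; cases b)
    then have "bundle_map (A, B) (A', B') (fE, fX, fY, fG)" using f by (simp add: Ar_Bun)
    from bundle_map_components[OF this] show ?thesis
      by (simp add: * bun_comp_def id_bmap_def compose_Id)
  qed
  show "bun_comp (id_bmap B, (A, B), (A, B)) (f, b, (A, B)) = (f, b, (A, B))"
    if f: "(f, b, (A, B)) \<in> Ar (Bun \<B>)" for f b
  proof -
    obtain fE fX fY fG A' B' where *: "f = (fE, fX, fY, fG)" "b = (A', B')"
      by (cases f; cases b)
    then have "bundle_map (A', B') (A, B) (fE, fX, fY, fG)" using f by (simp add: Ar_Bun)
    from bundle_map_components[OF this] show ?thesis
      by (simp add: * bun_comp_def id_bmap_def Id_compose)
  qed
qed

lemma category_Bun:
  assumes BB: "\<And>B. B \<in> \<B> \<Longrightarrow> protobundle B"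
  shows "category bun_comp (Bun \<B>)"
  unfolding category_def
proof (intro conjI allI impI ballI)
  show "a \<in> Ob (Bun \<B>)" "b \<in> Ob (Bun \<B>)" if "(f, a, b) \<in> Ar (Bun \<B>)" for f a b
    using that unfolding Ar_Bun by blast+
  show "\<exists>h. bun_comp (g, b, c) (f, a, b) = (h, a, c) \<and> (h, a, c) \<in> Ar (Bun \<B>)"
    if fg: "(f, a, b) \<in> Ar (Bun \<B>)" "(g, b, c) \<in> Ar (Bun \<B>)" for f g a b c
  proof -
    obtain A1 B1 A2 B2 A3 B3 where abc: "a = (A1, B1)" "b = (A2, B2)" "c = (A3, B3)"
      by (cases a; cases b; cases c)
    obtain fE fX fY fG gE gX gY gG where fg': "f = (fE, fX, fY, fG)" "g = (gE, gX, gY, gG)"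
      by (cases f; cases g)
    have m: "B1 \<in> \<B>" "B2 \<in> \<B>" "B3 \<in> \<B>" "maximal_bundle_atlas B1 A1" "maximal_bundle_atlas B2 A2"
      "bundle_map (A1, B1) (A2, B2) (fE, fX, fY, fG)" "bundle_map (A2, B2) (A3, B3) (gE, gX, gY, gG)"
      using fg by (simp_all add: abc fg' Ar_Bun)
    show ?thesis
      using fg bundle_map_compose[OF BB BB BB maximal_bundle_atlasD, OF m]
      by (simp add: abc fg' Ar_Bun bun_comp_def)
  qed
  show "bun_comp (h, c, d) (bun_comp (g, b, c) (f, a, b)) = bun_comp (bun_comp (h, c, d) (g, b, c)) (f, a, b)"
    if f: "(f, a, b) \<in> Ar (Bun \<B>)" for f g h a b c d
  proof -
    obtain A1 B1 A2 B2 where ab: "a = (A1, B1)" "b = (A2, B2)"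
      by (cases a; cases b)
    obtain fE fX fY fG gE gX gY gG hE hX hY hG
      where fg': "f = (fE, fX, fY, fG)" "g = (gE, gX, gY, gG)" "h = (hE, hX, hY, hG)"
      by (cases f; cases g; cases h)
    have "bundle_map (A1, B1) (A2, B2) (fE, fX, fY, fG)"
      using f by (simp add: Ar_Bun ab fg')
    from bundle_map_components[OF this] show ?thesis
      by (simp add: ab fg' bun_comp_def compose_assoc)
  qed
  show "\<exists>i. identity_arrow bun_comp (Bun \<B>) a i" if "a \<in> Ob (Bun \<B>)" for a
    using that identity_arrow_Bun[OF BB] by (cases a) blast
qed


section \<open>Images of categories\<close>

text \<open>
  Composable arrows of the image lift to composable arrows because the functor is injective on
  objects; this is what makes the image a category.
\<close>

lemma is_functor_image_cat:
  assumes C: "category cmpC C" and inj: "inj_on Fo (Ob C)"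
    and Fa: "\<And>f a b. (f, a, b) \<in> Ar C \<Longrightarrow> \<exists>f'. Fa (f, a, b) = (f', Fo a, Fo b)"
    and comp: "\<And>f g a b c. (f, a, b) \<in> Ar C \<Longrightarrow> (g, b, c) \<in> Ar C \<Longrightarrow>
      cmpD (Fa (g, b, c)) (Fa (f, a, b)) = Fa (cmpC (g, b, c) (f, a, b))"
  shows "is_functor cmpC C cmpD (image_cat Fo Fa C) Fo Fa"
proof -
  let ?D = "image_cat Fo Fa C"
  have Cends: "a \<in> Ob C" "b \<in> Ob C" if "(f, a, b) \<in> Ar C" for f a b
    using C that unfolding category_def by blast+
  have Ccomp: "\<exists>h. cmpC (g, b, c) (f, a, b) = (h, a, c) \<and> (h, a, c) \<in> Ar C"
    if "(f, a, b) \<in> Ar C" "(g, b, c) \<in> Ar C" for f g a b c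
  proof -
    have "\<forall>f g a b c. (f, a, b) \<in> Ar C \<longrightarrow> (g, b, c) \<in> Ar C \<longrightarrow>
        (\<exists>h. cmpC (g, b, c) (f, a, b) = (h, a, c) \<and> (h, a, c) \<in> Ar C)"
      using C unfolding category_def by (elim conjE)
    then show ?thesis using that by blast
  qed
  have Cassoc: "cmpC (h, c, d) (cmpC (g, b, c) (f, a, b)) = cmpC (cmpC (h, c, d) (g, b, c)) (f, a, b)"
    if "(f, a, b) \<in> Ar C" "(g, b, c) \<in> Ar C" "(h, c, d) \<in> Ar C" for f g h a b c d
  proof -
    have "\<forall>f g h a b c d. (f, a, b) \<in> Ar C \<longrightarrow> (g, b, c) \<in> Ar C \<longrightarrow> (h, c, d) \<in> Ar C \<longrightarrow>
        cmpC (h, c, d) (cmpC (g, b, c) (f, a, b)) = cmpC (cmpC (h, c, d) (g, b, c)) (f, a, b)"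
      using C unfolding category_def by (elim conjE)
    then show ?thesis using that by blast
  qed
  have lift: "\<exists>f0 a b. (f0, a, b) \<in> Ar C \<and> a \<in> Ob C \<and> b \<in> Ob C \<and> (f, x, y) = Fa (f0, a, b) \<and>
      x = Fo a \<and> y = Fo b" if "(f, x, y) \<in> Ar ?D" for f x y
  proof -
    have "(f, x, y) \<in> Fa ` Ar C" using that by (simp add: image_cat_def)
    then obtain t where t: "t \<in> Ar C" "(f, x, y) = Fa t" by (rule imageE)
    obtain f0 a b where "t = (f0, a, b)" by (cases t)
    with t have *: "(f0, a, b) \<in> Ar C" "(f, x, y) = Fa (f0, a, b)" by simp_all
    obtain f' where "Fa (f0, a, b) = (f', Fo a, Fo b)" using Fa[OF *(1)] by blast
    with * Cends[OF *(1)] show ?thesis by (intro exI[of _ f0] exI[of _ a] exI[of _ b]) simp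
  qed
  have ident: "identity_arrow cmpD ?D (Fo a) (Fa i)" if a: "a \<in> Ob C" and i: "identity_arrow cmpC C a i" for a i
    unfolding identity_arrow_def
  proof (intro conjI allI impI)
    obtain e where e: "i = (e, a, a)" and iC: "(e, a, a) \<in> Ar C"
      using i unfolding identity_arrow_def by blast
    have right: "cmpC (f, a, b) i = (f, a, b)" if "(f, a, b) \<in> Ar C" for f b
      using i that unfolding identity_arrow_def by blast
    have left: "cmpC i (f, b, a) = (f, b, a)" if "(f, b, a) \<in> Ar C" for f b
      using i that unfolding identity_arrow_def by blast
    show "Fa i \<in> Ar ?D" using iC by (simp add: e image_cat_def)
    show "\<exists>e. Fa i = (e, Fo a, Fo a)" using Fa[OF iC] by (simp add: e)
    show "cmpD (f, Fo a, y) (Fa i) = (f, Fo a, y)" if f: "(f, Fo a, y) \<in> Ar ?D" for f y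
    proof -
      obtain f0 a' b where f0: "(f0, a', b) \<in> Ar C" "a' \<in> Ob C" "(f, Fo a, y) = Fa (f0, a', b)" "Fo a = Fo a'"
        using lift[OF f] by blast
      have "a' = a" using inj_onD[OF inj f0(4) a f0(2)] ..
      note f1 = f0(1,3)[unfolded this]
      show ?thesis unfolding f1(2) e comp[OF iC f1(1)] right[OF f1(1), unfolded e] ..
    qed
    show "cmpD (Fa i) (f, y, Fo a) = (f, y, Fo a)" if f: "(f, y, Fo a) \<in> Ar ?D" for f y
    proof -
      obtain f0 a' b where f0: "(f0, b, a') \<in> Ar C" "a' \<in> Ob C" "(f, y, Fo a) = Fa (f0, b, a')" "Fo a = Fo a'"
        using lift[OF f] by blast
      have "a' = a" using inj_onD[OF inj f0(4) a f0(2)] ..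
      note f1 = f0(1,3)[unfolded this]
      show ?thesis unfolding f1(2) e comp[OF f1(1) iC] left[OF f1(1), unfolded e] ..
    qed
  qed
  have D: "category cmpD ?D"
    unfolding category_def
  proof (intro conjI allI impI ballI)
    show "x \<in> Ob ?D" "y \<in> Ob ?D" if "(f, x, y) \<in> Ar ?D" for f x y
      using lift[OF that] by (auto simp: image_cat_def)
    show "\<exists>h. cmpD (g, y, z) (f, x, y) = (h, x, z) \<and> (h, x, z) \<in> Ar ?D"
      if fg: "(f, x, y) \<in> Ar ?D" "(g, y, z) \<in> Ar ?D" for f g x y z
    proof -
      obtain f0 a b where f0: "(f0, a, b) \<in> Ar C" "b \<in> Ob C" "(f, x, y) = Fa (f0, a, b)" "x = Fo a" "y = Fo b"
        using lift[OF fg(1)] by blast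
      obtain g0 b' c where g0: "(g0, b', c) \<in> Ar C" "b' \<in> Ob C" "(g, y, z) = Fa (g0, b', c)" "y = Fo b'" "z = Fo c"
        using lift[OF fg(2)] by blast
      have b': "b' = b" using inj_onD[OF inj _ g0(2) f0(2)] f0(5) g0(4) by simp
      obtain h where h: "cmpC (g0, b, c) (f0, a, b) = (h, a, c)" "(h, a, c) \<in> Ar C"
        using Ccomp[OF f0(1) g0(1)[unfolded b']] by blast
      obtain h' where h': "Fa (h, a, c) = (h', x, z)"
        using Fa[OF h(2)] f0(4) g0(5) by auto
      have "cmpD (g, y, z) (f, x, y) = (h', x, z)"
        unfolding f0(3) g0(3) b' comp[OF f0(1) g0(1)[unfolded b']] h(1) h' ..
      moreover have "(h', x, z) \<in> Ar ?D"
        using imageI[OF h(2), of Fa] h' by (simp add: image_cat_def)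
      ultimately show ?thesis by blast
    qed
    show "cmpD (h, z, w) (cmpD (g, y, z) (f, x, y)) = cmpD (cmpD (h, z, w) (g, y, z)) (f, x, y)"
      if fgh: "(f, x, y) \<in> Ar ?D" "(g, y, z) \<in> Ar ?D" "(h, z, w) \<in> Ar ?D" for f g h x y z w
    proof -
      obtain f0 a b where f0: "(f0, a, b) \<in> Ar C" "b \<in> Ob C" "(f, x, y) = Fa (f0, a, b)" "x = Fo a" "y = Fo b"
        using lift[OF fgh(1)] by blast
      obtain g0 b' c where g0: "(g0, b', c) \<in> Ar C" "b' \<in> Ob C" "c \<in> Ob C" "(g, y, z) = Fa (g0, b', c)"
        "y = Fo b'" "z = Fo c"
        using lift[OF fgh(2)] by blast
      obtain h0 c' d where h0: "(h0, c', d) \<in> Ar C" "c' \<in> Ob C" "(h, z, w) = Fa (h0, c', d)" "z = Fo c'" "w = Fo d"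
        using lift[OF fgh(3)] by blast
      have b': "b' = b" using inj_onD[OF inj _ g0(2) f0(2)] f0(5) g0(5) by simp
      have c': "c' = c" using inj_onD[OF inj _ h0(2) g0(3)] g0(6) h0(4) by simp
      note g1 = g0(1)[unfolded b'] and h1 = h0(1)[unfolded c']
      obtain k where k: "cmpC (g0, b, c) (f0, a, b) = (k, a, c)" "(k, a, c) \<in> Ar C"
        using Ccomp[OF f0(1) g1] by blast
      obtain l where l: "cmpC (h0, c, d) (g0, b, c) = (l, b, d)" "(l, b, d) \<in> Ar C"
        using Ccomp[OF g1 h1] by blast
      have "cmpD (h, z, w) (cmpD (g, y, z) (f, x, y)) = Fa (cmpC (h0, c, d) (k, a, c))"
        unfolding f0(3) g0(4) h0(3) b' c' comp[OF f0(1) g1] k(1) comp[OF k(2) h1] ..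
      also have "\<dots> = Fa (cmpC (l, b, d) (f0, a, b))"
        using Cassoc[OF f0(1) g1 h1] k(1) l(1) by simp
      also have "\<dots> = cmpD (cmpD (h, z, w) (g, y, z)) (f, x, y)"
        unfolding f0(3) g0(4) h0(3) b' c' comp[OF g1 h1] l(1) comp[OF f0(1) l(2)] ..
      finally show ?thesis .
    qed
    show "\<exists>i. identity_arrow cmpD ?D x i" if x: "x \<in> Ob ?D" for x
    proof -
      obtain a where a: "a \<in> Ob C" "x = Fo a" using x by (auto simp: image_cat_def)
      moreover obtain i where "identity_arrow cmpC C a i"
        using C a(1) unfolding category_def by blast
      ultimately show ?thesis using ident by blast
    qed
  qed
  have arr: "Fa (f, a, b) \<in> Ar ?D \<and> (\<exists>f'. Fa (f, a, b) = (f', Fo a, Fo b))" if "(f, a, b) \<in> Ar C" for f a b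
    using that Fa[OF that] by (auto simp: image_cat_def)
  show ?thesis
    unfolding is_functor_def
  proof (intro conjI)
    show "\<forall>a\<in>Ob C. Fo a \<in> Ob ?D" by (auto simp: image_cat_def)
    show "\<forall>f a b. (f, a, b) \<in> Ar C \<longrightarrow> Fa (f, a, b) \<in> Ar ?D \<and> (\<exists>f'. Fa (f, a, b) = (f', Fo a, Fo b))"
      using arr by blast
    show "\<forall>a\<in>Ob C. \<forall>i. identity_arrow cmpC C a i \<longrightarrow> identity_arrow cmpD ?D (Fo a) (Fa i)"
      using ident by blast
    show "\<forall>f g a b c. (f, a, b) \<in> Ar C \<longrightarrow> (g, b, c) \<in> Ar C \<longrightarrow>
        Fa (cmpC (g, b, c) (f, a, b)) = cmpD (Fa (g, b, c)) (Fa (f, a, b))"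
      using comp by simp
  qed (rule C, rule D)
qed



section \<open>Fiber bundles as local coordinate spaces\<close>

text \<open>
  The two sequences of objects attached to a protobundle, one containing topological spaces and the other
  only model spaces, have the same underlying model spaces. What follows depends on a sequence
  only through these, and so covers both.
\<close>

definition bun_spaces :: "'a protobundle \<Rightarrow> 'a point mspace list" where
  "bun_spaces B = [triv (bE B), triv_grho (bX B) (bY B) (bG B) (brho B), triv (bX B), triv (bY B),
     triv (gtop (bG B))]"

lemma msp_triv_ident [simp]: "msp (triv_ident a) = msp a"
  by (cases a) simp_all

lemma is_top_triv_ident [simp]: "\<not> is_top (triv_ident a)"
  by (cases a) simp_all

lemma map_msp_bun_M: "map msp (bun_M B) = bun_spaces B" "map msp (map triv_ident (bun_M B)) = bun_spaces B"
  by (simp_all add: bun_M_def bun_spaces_def coord_obj_def)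

lemma bun_spaces_nth:
  assumes "map msp M = bun_spaces B"
  shows "length M = 5" "msp (M ! 0) = triv (bE B)"
    "msp (M ! 1) = triv_grho (bX B) (bY B) (bG B) (brho B)" "msp (M ! 2) = triv (bX B)"
    "msp (M ! 3) = triv (bY B)" "msp (M ! 4) = triv (gtop (bG B))"
proof -
  show len: "length M = 5"
    using arg_cong[OF assms, of length] by (simp add: bun_spaces_def)
  have "msp (M ! i) = bun_spaces B ! i" if "i < 5" for i
    using that len by (metis assms nth_map)
  from this[of 0] this[of 1] this[of 2] this[of 3] this[of 4]
  show "msp (M ! 0) = triv (bE B)" "msp (M ! 1) = triv_grho (bX B) (bY B) (bG B) (brho B)"
    "msp (M ! 2) = triv (bX B)" "msp (M ! 3) = triv (bY B)" "msp (M ! 4) = triv (gtop (bG B))"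
    by (simp_all add: bun_spaces_def)
qed

lemma bun_spaces_top_of:
  assumes "map msp M = bun_spaces B"
  shows "top_of (M ! 0) = bE B" "top_of (M ! 1) = pprod (bX B) (bY B)"
    "top_of (M ! 2) = bX B" "top_of (M ! 3) = bY B" "top_of (M ! 4) = gtop (bG B)"
  using bun_spaces_nth[OF assms] by (simp_all add: top_of_def triv_grho_def)

lemma bun_spaces_pts:
  assumes "map msp M = bun_spaces B"
  shows "pts (M ! 0) = topspace (bE B)" "pts (M ! 1) = topspace (pprod (bX B) (bY B))"
    "pts (M ! 2) = topspace (bX B)" "pts (M ! 3) = topspace (bY B)" "pts (M ! 4) = topspace (gtop (bG B))"
  using bun_spaces_top_of[OF assms] by (simp_all add: pts_def)

lemma all_less_5: "(\<forall>i<5. P i) \<longleftrightarrow> P 0 \<and> P 1 \<and> P 2 \<and> P 3 \<and> P (4::nat)"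
proof -
  have "{..<5::nat} = {0, 1, 2, 3, 4}" by auto
  moreover have "(\<forall>i<5. P i) \<longleftrightarrow> (\<forall>i\<in>{..<5}. P i)" by auto
  ultimately show ?thesis by (simp only: ball_simps) simp
qed

lemma length_bun_sig: "length bun_sig = 5"
  by (simp add: bun_sig_def)

lemma bun_sig_nth:
  "bun_sig ! 0 = [0, 2]" "bun_sig ! 1 = [1, 2]" "bun_sig ! 2 = [1, 3]" "bun_sig ! 3 = [4, 4, 4]"
  "bun_sig ! 4 = [3, 4, 3]"
  by (simp_all add: bun_sig_def)

lemma bun_F_nth:
  "bun_F B ! 0 = restrict (\<lambda>x. bpi B (x 0)) (sig_dom (bun_M B) [0, 2])"
  "bun_F B ! 1 = restrict (\<lambda>x. pfst (x 0)) (sig_dom (bun_M B) [1, 2])"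
  "bun_F B ! 2 = restrict (\<lambda>x. psnd (x 0)) (sig_dom (bun_M B) [1, 3])"
  "bun_F B ! 3 = restrict (\<lambda>x. x 0 \<otimes>\<^bsub>grp (bG B)\<^esub> x 1) (sig_dom (bun_M B) [4, 4, 4])"
  "bun_F B ! 4 = restrict (\<lambda>x. brho B (x 0, x 1)) (sig_dom (bun_M B) [3, 4, 3])"
  by (simp_all add: bun_F_def bun_sig_def)

lemma length_bun_F: "length (bun_F B) = 5"
  by (simp add: bun_F_def bun_sig_def)

lemma sig_dom_eq_bun_M:
  assumes "map msp M = bun_spaces B" "\<And>i. i \<in> set s \<Longrightarrow> i < 5"
  shows "sig_dom M s = sig_dom (bun_M B) s"
proof -
  have "msp (M ! i) = msp (bun_M B ! i)" if "i < 5" for i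
    using that assms(1) map_msp_bun_M(1)[of B] bun_spaces_nth(1)[OF assms(1)] bun_spaces_nth(1)[OF map_msp_bun_M(1), of B]
    by (metis nth_map)
  then have "pts (M ! (s ! i)) = pts (bun_M B ! (s ! i))" if "i < length s - 1" for i
    using assms(2)[of "s ! i"] that by (simp add: pts_def top_of_def)
  then show ?thesis
    unfolding sig_dom_def by (intro PiE_cong) simp
qed

lemma has_signatureI:
  assumes s: "s \<noteq> []" "\<forall>\<alpha>\<in>set s. \<alpha> < length M" and dom: "D = sig_dom M s"
    and F: "continuous_map (product_topology (\<lambda>i. top_of (M ! (s ! i))) {..<length s - 1}) (top_of (M ! last s)) F"
  shows "has_signature M s (restrict F D)"
  unfolding has_signature_def
proof (intro conjI)
  have "topspace (product_topology (\<lambda>i. top_of (M ! (s ! i))) {..<length s - 1}) = D"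
    by (simp add: dom sig_dom_def pts_def)
  then show "continuous_map (product_topology (\<lambda>i. top_of (M ! (s ! i))) {..<length s - 1})
      (top_of (M ! last s)) (restrict F D)"
    using continuous_map_eq[OF F, of "restrict F D"] by simp
qed (use s dom in auto)

context pbundle
begin

lemma has_signature_bun_F:
  assumes M: "map msp M = bun_spaces B"
  shows "\<forall>\<gamma><length bun_sig. has_signature M (bun_sig ! \<gamma>) (bun_F B ! \<gamma>)"
proof -
  note top = bun_spaces_top_of[OF M]
  have dom: "sig_dom (bun_M B) s = sig_dom M s" if "\<forall>i\<in>set s. i < 5" for s
    using sig_dom_eq_bun_M[OF M, of s] that by simp
  have proj: "continuous_map (product_topology (\<lambda>i. top_of (M ! (s ! i))) {..<n}) (top_of (M ! (s ! i))) (\<lambda>x. x i)"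
    if "i < n" for s n i
    using continuous_map_product_projection[of i "{..<n}" "\<lambda>i. top_of (M ! (s ! i))"] that by simp
  note sig = has_signatureI[where M = M, unfolded bun_spaces_nth(1)[OF M]]
  have "has_signature M [0, 2] (bun_F B ! 0)" unfolding bun_F_nth
  proof (rule sig[OF _ _ dom])
    show "continuous_map (product_topology (\<lambda>i. top_of (M ! ([0, 2] ! i))) {..<length [0, 2::nat] - 1})
        (top_of (M ! last [0, 2])) (\<lambda>x. bpi B (x 0))"
      using continuous_map_compose[OF proj[of 0 1 "[0, 2]"], of "bX B" "bpi B"] continuous_pi top
      by (simp add: o_def)
  qed auto
  moreover have "has_signature M [1, 2] (bun_F B ! 1)" unfolding bun_F_nth
  proof (rule sig[OF _ _ dom])
    show "continuous_map (product_topology (\<lambda>i. top_of (M ! ([1, 2] ! i))) {..<length [1, 2::nat] - 1})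
        (top_of (M ! last [1, 2])) (\<lambda>x. pfst (x 0))"
      using continuous_map_compose[OF proj[of 0 1 "[1, 2]"], of "bX B" pfst] continuous_map_pfst[of "bX B" "bY B"] top
      by (simp add: o_def)
  qed auto
  moreover have "has_signature M [1, 3] (bun_F B ! 2)" unfolding bun_F_nth
  proof (rule sig[OF _ _ dom])
    show "continuous_map (product_topology (\<lambda>i. top_of (M ! ([1, 3] ! i))) {..<length [1, 3::nat] - 1})
        (top_of (M ! last [1, 3])) (\<lambda>x. psnd (x 0))"
      using continuous_map_compose[OF proj[of 0 1 "[1, 3]"], of "bY B" psnd] continuous_map_psnd[of "bX B" "bY B"] top
      by (simp add: o_def)
  qed auto
  moreover have "has_signature M [4, 4, 4] (bun_F B ! 3)" unfolding bun_F_nth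
  proof (rule sig[OF _ _ dom])
    let ?T = "product_topology (\<lambda>i. top_of (M ! ([4, 4, 4] ! i))) {..<2}"
    have "continuous_map ?T (gtop (bG B)) (\<lambda>x. x 0)" "continuous_map ?T (gtop (bG B)) (\<lambda>x. x 1)"
      using proj[of 0 2 "[4, 4, 4]"] proj[of 1 2 "[4, 4, 4]"] top by simp_all
    from continuous_mult[OF this]
    show "continuous_map (product_topology (\<lambda>i. top_of (M ! ([4, 4, 4] ! i))) {..<length [4, 4, 4::nat] - 1})
        (top_of (M ! last [4, 4, 4])) (\<lambda>x. x 0 \<otimes>\<^bsub>grp (bG B)\<^esub> x 1)"
      using top by (simp add: numeral_2_eq_2)
  qed auto
  moreover have "has_signature M [3, 4, 3] (bun_F B ! 4)" unfolding bun_F_nth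
  proof (rule sig[OF _ _ dom])
    let ?T = "product_topology (\<lambda>i. top_of (M ! ([3, 4, 3] ! i))) {..<2}"
    have "continuous_map ?T (prod_topology (bY B) (gtop (bG B))) (\<lambda>x. (x 0, x 1))"
      using proj[of 0 2 "[3, 4, 3]"] proj[of 1 2 "[3, 4, 3]"] top
      by (simp add: continuous_map_pairwise o_def)
    from continuous_map_compose[OF this continuous_action]
    show "continuous_map (product_topology (\<lambda>i. top_of (M ! ([3, 4, 3] ! i))) {..<length [3, 4, 3::nat] - 1})
        (top_of (M ! last [3, 4, 3])) (\<lambda>x. brho B (x 0, x 1))"
      using top by (simp add: o_def numeral_2_eq_2)
  qed auto
  ultimately show ?thesis
    unfolding length_bun_sig all_less_5 bun_sig_nth by blast
qed

lemma local_coordinate_space_bun: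
  assumes M: "map msp M = bun_spaces B" and A: "maximal_bundle_atlas B A"
    and N: "length N = 5" "\<forall>\<alpha><5. topological_category (N ! \<alpha>) \<or> model_function_category (N ! \<alpha>)"
      "model_function_category (N ! 1)" "\<forall>\<alpha><5. M ! \<alpha> \<in> Ob (N ! \<alpha>)"
  shows "local_coordinate_space N bun_sig \<lparr>lN = N, lM = M, lA = A, lF = bun_F B, lSig = bun_sig\<rparr>"
  unfolding local_coordinate_space_def lcs.simps
  using N has_signature_bun_F[OF M] maximal_m_atlas_if_maximal_bundle_atlas[OF A]
  by (simp add: bun_spaces_nth[OF M, simplified] length_bun_sig length_bun_F)

text \<open>
  In the singleton setting the categories are topological for the base, the fiber and the group, and
  categories of model functions for the total space and the coordinate space.
\<close>

lemma local_coordinate_space_singletons: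
  assumes A: "maximal_bundle_atlas B A"
  shows "local_coordinate_space (bun_S B) bun_sig (lcs_obj (A, B))"
  unfolding lcs_obj_def prod.case
proof (rule local_coordinate_space_bun[OF map_msp_bun_M(1) A])
  have "model_function_category (singleton_cat (coord_obj B))"
    using model_space_triv_grho by (intro model_function_category_singleton_cat) (simp_all add: coord_obj_def)
  moreover have "model_function_category (singleton_cat (ModObj (triv (bE B))))"
    using model_space_triv by (intro model_function_category_singleton_cat) simp_all
  ultimately show "\<forall>\<alpha><5. topological_category (bun_S B ! \<alpha>) \<or> model_function_category (bun_S B ! \<alpha>)"
    "model_function_category (bun_S B ! 1)"
    unfolding all_less_5 by (simp_all add: bun_S_def bun_M_def topological_category_singleton_cat)
  show "length (bun_S B) = 5" "\<forall>\<alpha><5. bun_M B ! \<alpha> \<in> Ob (bun_S B ! \<alpha>)"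
    unfolding all_less_5 by (simp_all add: bun_S_def bun_M_def)
qed

end



section \<open>Bundle maps as morphisms of local coordinate spaces\<close>

text \<open>
  The local condition of a bundle map provides an open subset \<open>V1'\<close> of the source chart, while an
  m-atlas morphism requires a model neighborhood. The box over the projection of \<open>V1'\<close> serves: a product
  map sends it into every box that contains the image of \<open>V1'\<close>.
\<close>

lemma m_atlas_morphism_if_local_product_map:
  assumes B: "protobundle B1" "protobundle B2" and A1: "bundle_atlas B1 A1"
    and fX: "continuous_map (bX B1) (bX B2) fX" and fY: "continuous_map (bY B1) (bY B2) fY"
    and loc: "local_product_map (A1, B1) (A2, B2) fE (pmap (bX B1) (bY B1) fX fY)"
  shows "m_atlas_morphism (triv (bE B1)) A1 (triv_grho (bX B1) (bY B1) (bG B1) (brho B1))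
     (triv (bE B2)) A2 (triv_grho (bX B2) (bY B2) (bG B2) (brho B2)) fE (pmap (bX B1) (bY B1) fX fY)"
proof -
  interpret one: pbundle B1 by unfold_locales (rule B(1))
  interpret two: pbundle B2 by unfold_locales (rule B(2))
  let ?f = "pmap (bX B1) (bY B1) fX fY"
  have *: "\<exists>U1' \<in> Ob (nbs (triv (bE B1))). \<exists>V1' \<in> Ob (nbs one.S). \<exists>U2' \<in> Ob (nbs (triv (bE B2))).
        \<exists>V2' \<in> Ob (nbs two.S). \<exists>V2h \<in> Ob (nbs two.S). \<exists>fh.
          U1' \<subseteq> {u \<in> U1. fE u \<in> U2} \<and> V1' \<subseteq> V1 \<and> U2' \<subseteq> U2 \<and> V2' \<subseteq> V2 \<and>
          fun_iso (\<lambda>A. A) (nbs two.S) fh V2' V2h \<and>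
          local_square x U1' V1' U2' V2' V2h fh \<phi>1 \<phi>2 fE ?f"
    if c: "(U1, V1, \<phi>1) \<in> A1" "(U2, V2, \<phi>2) \<in> A2" "x \<in> U1" "fE x \<in> U2" for U1 V1 \<phi>1 U2 V2 \<phi>2 x
  proof -
    obtain U1' V1' U2' V2' V2h fh where F: "openin (bE B1) U1'" "openin (pprod (bX B1) (bY B1)) V1'"
      "openin (bE B2) U2'" "V2' \<in> Ob (nbs two.S)" "V2h \<in> Ob (nbs two.S)" "U1' \<subseteq> {u \<in> U1. fE u \<in> U2}"
      "V1' \<subseteq> V1" "U2' \<subseteq> U2" "V2' \<subseteq> V2" "fun_iso (\<lambda>A. A) (nbs two.S) fh V2' V2h"
      "local_square x U1' V1' U2' V2' V2h fh \<phi>1 \<phi>2 fE ?f"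
      using local_product_mapD[OF loc c] unfolding local_product_at_def Let_def by blast
    \<comment> \<open>the smallest model neighborhood containing \<open>V1'\<close>\<close>
    define W where "W = one.box (pfst ` V1')"
    have C1: "bundle_chart B1 (U1, V1, \<phi>1)" using A1 c(1) unfolding bundle_atlas_def by blast
    have W: "W \<in> Ob (nbs one.S)"
      unfolding W_def one.Ob_S using openin_pfst_image[OF F(2)] by blast
    have VW: "V1' \<subseteq> W"
      using openin_subset[OF F(2)] unfolding W_def by (force elim!: ptimesE)
    have "one.box (pfst ` V1) = V1" using one.bundle_chartD(2)[OF C1] one.Ob_S_iff by blast
    then have WV: "W \<subseteq> V1" unfolding W_def using ptimes_mono[OF image_mono[OF F(7)]] by blast
    have boxh: "two.box (pfst ` V2h) = V2h" using F(5) two.Ob_S_iff by blast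
    have fV: "?f ` V1' \<subseteq> V2h" using F(11) by (simp add: local_square_def)
    have fW: "?f ` W \<subseteq> V2h"
    proof
      fix q assume "q \<in> ?f ` W"
      then obtain a y where a: "a \<in> pfst ` V1'" "y \<in> topspace (bY B1)" "q = ?f (Tup a y)"
        unfolding W_def by (auto elim!: ptimesE)
      then obtain r where r: "r \<in> V1'" "a = pfst r" by blast
      have "r \<in> ptimes (topspace (bX B1)) (topspace (bY B1))" using openin_subset[OF F(2)] r(1) by auto
      then obtain z where z: "r = Tup a z" "a \<in> topspace (bX B1)" "z \<in> topspace (bY B1)"
        using r(2) by (auto elim!: ptimesE)
      have "Tup (fX a) (fY z) \<in> V2h" using fV r(1) z by auto
      from imageI[OF this, of pfst] have "fX a \<in> pfst ` V2h" by simp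
      moreover have "fY y \<in> topspace (bY B2)" using continuous_map_funspace[OF fY] a(2) by auto
      moreover have "q = Tup (fX a) (fY y)" using a(2,3) z(2) by simp
      ultimately have "q \<in> two.box (pfst ` V2h)" by simp
      then show "q \<in> V2h" using boxh by simp
    qed
    have "local_square x U1' W U2' V2' V2h fh \<phi>1 \<phi>2 fE ?f"
      using F(11) VW fW unfolding local_square_def by blast
    then show ?thesis
      using F W WV unfolding Ob_triv by blast
  qed
  show ?thesis
    unfolding m_atlas_morphism_def
  proof (intro ballI, goal_cases)
    case (1 c1)
    obtain U1 V1 \<phi>1 where c1: "c1 = (U1, V1, \<phi>1)" by (cases c1)
    show ?case
      unfolding c1 prod.case
    proof (intro ballI, goal_cases)
      case (1 c2)
      obtain U2 V2 \<phi>2 where c2: "c2 = (U2, V2, \<phi>2)" by (cases c2)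
      show ?case
        unfolding c2 prod.case
      proof (intro ballI, goal_cases)
        case (1 x)
        then have "(U1, V1, \<phi>1) \<in> A1" "(U2, V2, \<phi>2) \<in> A2" "x \<in> U1" "fE x \<in> U2"
          using \<open>c1 \<in> A1\<close> \<open>c2 \<in> A2\<close> c1 c2 by auto
        then show ?case by (rule *)
      qed
    qed
  qed
qed

text \<open>
  The inverse image of a box \<open>W \<times> Y2\<close> under a product map \<open>fX \<times> fY\<close> is the box over the inverse image of \<open>W\<close>
  under \<open>fX\<close>.
\<close>

lemma model_function_pmap:
  assumes B: "protobundle B1" "protobundle B2"
    and fX: "continuous_map (bX B1) (bX B2) fX" and fY: "continuous_map (bY B1) (bY B2) fY"
  shows "model_function (triv_grho (bX B1) (bY B1) (bG B1) (brho B1))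
     (triv_grho (bX B2) (bY B2) (bG B2) (brho B2)) (pmap (bX B1) (bY B1) fX fY)"
proof -
  interpret one: pbundle B1 by unfold_locales (rule B(1))
  interpret two: pbundle B2 by unfold_locales (rule B(2))
  let ?f = "pmap (bX B1) (bY B1) fX fY"
  note cont = continuous_map_pmap[OF fX fY]
  show ?thesis
    unfolding model_function_def one.spc_S two.spc_S
  proof (intro conjI ballI)
    show "?f \<in> extensional (topspace (pprod (bX B1) (bY B1)))" by (simp add: pmap_def)
    show "continuous_map (pprod (bX B1) (bY B1)) (pprod (bX B2) (bY B2)) ?f" by (rule cont)
    show "{p \<in> topspace (pprod (bX B1) (bY B1)). ?f p \<in> V} \<in> Ob (nbs one.S)" if "V \<in> Ob (nbs two.S)" for V
    proof -
      obtain V' where V': "V = two.box V'" "openin (bX B2) V'" using \<open>V \<in> Ob (nbs two.S)\<close> by (auto simp: two.Ob_S)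
      have "{p \<in> topspace (pprod (bX B1) (bY B1)). ?f p \<in> V} = one.box {x \<in> topspace (bX B1). fX x \<in> V'}"
        using continuous_map_funspace[OF fY] by (auto simp: V'(1) elim!: ptimesE)
      moreover have "openin (bX B1) {x \<in> topspace (bX B1). fX x \<in> V'}"
        by (rule openin_continuous_map_preimage[OF fX V'(2)])
      ultimately show ?thesis unfolding one.Ob_S by blast
    qed
    show "\<exists>V\<in>Ob (nbs two.S). ?f ` U \<subseteq> V" if "U \<in> Ob (nbs one.S)" for U
    proof (intro bexI[of _ "two.box (topspace (bX B2))"])
      have "U \<subseteq> topspace (pprod (bX B1) (bY B1))"
        using openin_subset[OF model_space_openin[OF one.model_space_triv_grho that]] by simp
      then show "?f ` U \<subseteq> two.box (topspace (bX B2))"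
        using continuous_map_funspace[OF cont] by auto
      show "two.box (topspace (bX B2)) \<in> Ob (nbs two.S)" by (auto simp: two.Ob_S)
    qed
  qed
qed

lemma bmap_seq_nth:
  "length (bmap_seq (A, B) (fE, fX, fY, fG)) = 5" "bmap_seq (A, B) (fE, fX, fY, fG) ! 0 = fE"
  "bmap_seq (A, B) (fE, fX, fY, fG) ! 1 = pmap (bX B) (bY B) fX fY"
  "bmap_seq (A, B) (fE, fX, fY, fG) ! 2 = fX" "bmap_seq (A, B) (fE, fX, fY, fG) ! 3 = fY"
  "bmap_seq (A, B) (fE, fX, fY, fG) ! 4 = fG"
  by (simp_all add: bmap_seq_def)

lemma lcs_morphism_bmap_seq:
  assumes B: "protobundle B1" "protobundle B2" and A1: "bundle_atlas B1 A1"
    and M: "map msp M1 = bun_spaces B1" "map msp M2 = bun_spaces B2"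
    and f: "bundle_map (A1, B1) (A2, B2) (fE, fX, fY, fG)"
    and L: "local_coordinate_space N1 bun_sig \<lparr>lN = N1, lM = M1, lA = A1, lF = bun_F B1, lSig = bun_sig\<rparr>"
      "local_coordinate_space N2 bun_sig \<lparr>lN = N2, lM = M2, lA = A2, lF = bun_F B2, lSig = bun_sig\<rparr>"
  shows "lcs_morphism bun_sig \<lparr>lN = N1, lM = M1, lA = A1, lF = bun_F B1, lSig = bun_sig\<rparr>
     \<lparr>lN = N2, lM = M2, lA = A2, lF = bun_F B2, lSig = bun_sig\<rparr> (bmap_seq (A1, B1) (fE, fX, fY, fG))"
proof -
  interpret one: pbundle B1 by unfold_locales (rule B(1))
  interpret two: pbundle B2 by unfold_locales (rule B(2))
  let ?fs = "bmap_seq (A1, B1) (fE, fX, fY, fG)" and ?f1 = "pmap (bX B1) (bY B1) fX fY"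
  note F = f[unfolded bundle_map_iff] and mem = bundle_map_components[OF f]
  have cE: "continuous_map (bE B1) (bE B2) fE" and cX: "continuous_map (bX B1) (bX B2) fX"
    and cY: "continuous_map (bY B1) (bY B2) fY" and cG: "cont_hom (bG B1) (bG B2) fG"
    and fpi: "\<And>u. u \<in> topspace (bE B1) \<Longrightarrow> bpi B2 (fE u) = fX (bpi B1 u)"
    and frho: "\<And>y g. y \<in> topspace (bY B1) \<Longrightarrow> g \<in> topspace (gtop (bG B1)) \<Longrightarrow>
      brho B2 (fY y, fG g) = fY (brho B1 (y, g))"
    and loc: "local_product_map (A1, B1) (A2, B2) fE ?f1"
    using F by blast+
  note hG = cont_homD[OF cG one.tgroup]
  note pts = bun_spaces_pts[OF M(1)] bun_spaces_pts[OF M(2)]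
  have map1: "?f1 p \<in> topspace (pprod (bX B2) (bY B2))" if "p \<in> topspace (pprod (bX B1) (bY B1))" for p
    using continuous_map_funspace[OF continuous_map_pmap[OF cX cY]] that by blast
  have maps: "\<forall>i<5. ?fs ! i \<in> pts (M1 ! i) \<rightarrow> pts (M2 ! i)"
    unfolding all_less_5 pts bmap_seq_nth using mem map1 by blast
  have mf: "\<forall>i<5. model_function (msp (M1 ! i)) (msp (M2 ! i)) (?fs ! i)"
    unfolding all_less_5 bun_spaces_nth[OF M(1)] bun_spaces_nth[OF M(2)] bmap_seq_nth
    using model_function_pmap[OF B cX cY] model_function_triv mem cE cX cY hG(1) by blast
  then have cont: "\<forall>i<5. ?fs ! i \<in> extensional (pts (M1 ! i)) \<and>
      continuous_map (top_of (M1 ! i)) (top_of (M2 ! i)) (?fs ! i)"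
    unfolding model_function_def pts_def top_of_def by blast
  have dom: "sig_dom (bun_M B1) s = sig_dom M1 s" "sig_dom (bun_M B2) s = sig_dom M2 s"
    if "\<forall>i\<in>set s. i < 5" for s
    using sig_dom_eq_bun_M[OF M(1), of s] sig_dom_eq_bun_M[OF M(2), of s] that by simp_all
  have arg: "(\<lambda>i\<in>{..<length s - 1}. (?fs ! (s ! i)) (x i)) \<in> sig_dom M2 s"
    if s: "\<forall>i\<in>set s. i < 5" and x: "x \<in> sig_dom M1 s" for s x
  proof -
    have "(?fs ! (s ! i)) (x i) \<in> pts (M2 ! (s ! i))" if i: "i < length s - 1" for i
    proof -
      have "s ! i < 5" using s i by simp
      then have "?fs ! (s ! i) \<in> pts (M1 ! (s ! i)) \<rightarrow> pts (M2 ! (s ! i))" using maps by blast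
      moreover have "x i \<in> pts (M1 ! (s ! i))" using x i by (auto simp: sig_dom_def)
      ultimately show ?thesis by blast
    qed
    then show ?thesis by (simp add: sig_dom_def)
  qed
  have comp: "x i \<in> pts (M1 ! (s ! i))" if "x \<in> sig_dom M1 s" "i < length s - 1" for x s i
    using that by (auto simp: sig_dom_def)
  have "fX ((bun_F B1 ! 0) x) = (bun_F B2 ! 0) (\<lambda>i\<in>{..<length [0, 2::nat] - 1}. (?fs ! ([0, 2] ! i)) (x i))"
    if x: "x \<in> sig_dom M1 [0, 2]" for x
  proof -
    have "x 0 \<in> topspace (bE B1)" using comp[OF x, of 0] by (simp add: pts)
    then show ?thesis
      using x arg[OF _ x] by (simp add: bun_F_nth dom bmap_seq_nth fpi)
  qed
  moreover have "fX ((bun_F B1 ! 1) x) = (bun_F B2 ! 1) (\<lambda>i\<in>{..<length [1, 2::nat] - 1}. (?fs ! ([1, 2] ! i)) (x i))"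
    if x: "x \<in> sig_dom M1 [1, 2]" for x
  proof -
    have "x 0 \<in> ptimes (topspace (bX B1)) (topspace (bY B1))" using comp[OF x, of 0] pts by simp
    then have "pfst (?f1 (x 0)) = fX (pfst (x 0))" by (auto elim!: ptimesE)
    then show ?thesis
      using x arg[OF _ x] by (simp add: bun_F_nth dom bmap_seq_nth del: One_nat_def)
  qed
  moreover have "fY ((bun_F B1 ! 2) x) = (bun_F B2 ! 2) (\<lambda>i\<in>{..<length [1, 3::nat] - 1}. (?fs ! ([1, 3] ! i)) (x i))"
    if x: "x \<in> sig_dom M1 [1, 3]" for x
  proof -
    have "x 0 \<in> ptimes (topspace (bX B1)) (topspace (bY B1))" using comp[OF x, of 0] pts by simp
    then have "psnd (?f1 (x 0)) = fY (psnd (x 0))" by (auto elim!: ptimesE)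
    then show ?thesis
      using x arg[OF _ x] by (simp add: bun_F_nth dom bmap_seq_nth del: One_nat_def)
  qed
  moreover have "fG ((bun_F B1 ! 3) x) = (bun_F B2 ! 3) (\<lambda>i\<in>{..<length [4, 4, 4::nat] - 1}. (?fs ! ([4, 4, 4] ! i)) (x i))"
    if x: "x \<in> sig_dom M1 [4, 4, 4]" for x
  proof -
    have "x 0 \<in> topspace (gtop (bG B1))" "x 1 \<in> topspace (gtop (bG B1))"
      using comp[OF x, of 0] comp[OF x, of 1] by (simp_all add: pts)
    then show ?thesis
      using x arg[OF _ x] by (simp add: bun_F_nth dom bmap_seq_nth hG(2))
  qed
  moreover have "fY ((bun_F B1 ! 4) x) = (bun_F B2 ! 4) (\<lambda>i\<in>{..<length [3, 4, 3::nat] - 1}. (?fs ! ([3, 4, 3] ! i)) (x i))"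
    if x: "x \<in> sig_dom M1 [3, 4, 3]" for x
  proof -
    have "x 0 \<in> topspace (bY B1)" "x 1 \<in> topspace (gtop (bG B1))"
      using comp[OF x, of 0] comp[OF x, of 1] by (simp_all add: pts)
    then show ?thesis
      using x arg[OF _ x] by (simp add: bun_F_nth dom bmap_seq_nth frho)
  qed
  ultimately have sig: "\<forall>\<gamma><5. \<forall>x\<in>sig_dom M1 (bun_sig ! \<gamma>). (?fs ! last (bun_sig ! \<gamma>)) ((bun_F B1 ! \<gamma>) x) =
      (bun_F B2 ! \<gamma>) (\<lambda>i\<in>{..<length (bun_sig ! \<gamma>) - 1}. (?fs ! (bun_sig ! \<gamma> ! i)) (x i))"
    unfolding all_less_5 bun_sig_nth by (simp only: last.simps bmap_seq_nth list.simps simp_thms if_True if_False) blast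
  show ?thesis
    unfolding lcs_morphism_def lcs.simps length_bun_sig bmap_seq_nth(1)
    using L bun_spaces_nth(1)[OF M(1)] bun_spaces_nth(1)[OF M(2)] cont mf sig
      m_atlas_morphism_if_local_product_map[OF B A1 cX cY loc]
    by (simp only: bun_spaces_nth(2,3)[OF M(1)] bun_spaces_nth(2,3)[OF M(2)] bmap_seq_nth(2,3)) blast
qed

text \<open>
  A protobundle can be recovered from its local coordinate space: the spaces, the group and the action
  are part of the coordinate object, and the projection is determined on its
  domain by the first of the functions, hence everywhere, being extensional.
\<close>

lemma inj_on_lcs_objI:
  assumes BB: "\<And>B. B \<in> \<B> \<Longrightarrow> protobundle B"
    and eq: "\<And>A B A' B'. B \<in> \<B> \<Longrightarrow> B' \<in> \<B> \<Longrightarrow> Fo (A, B) = Fo (A', B') \<Longrightarrow>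
      A = A' \<and> triv (bE B) = triv (bE B') \<and> coord_obj B = coord_obj B' \<and> bun_F B = bun_F B'"
  shows "inj_on Fo (Ob (Bun \<B>))"
proof (rule inj_onI)
  fix a a' assume aa': "a \<in> Ob (Bun \<B>)" "a' \<in> Ob (Bun \<B>)" "Fo a = Fo a'"
  obtain A B A' B' where ab: "a = (A, B)" "a' = (A', B')" by (cases a; cases a')
  have B: "B \<in> \<B>" "B' \<in> \<B>" using aa' by (simp_all add: ab)
  interpret one: pbundle B by unfold_locales (rule BB[OF B(1)])
  interpret two: pbundle B' by unfold_locales (rule BB[OF B(2)])
  have *: "A = A'" "triv (bE B) = triv (bE B')" "coord_obj B = coord_obj B'" "bun_F B = bun_F B'"
    using eq[OF B, of A A'] aa'(3) by (simp_all add: ab)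
  have E: "bE B = bE B'" using arg_cong[OF *(2), of spc] by simp
  have rest: "bX B = bX B'" "bY B = bY B'" "bG B = bG B'" "brho B = brho B'"
    using *(3) by (simp_all add: coord_obj_def)
  have "bpi B u = bpi B' u" for u
  proof (cases "u \<in> topspace (bE B)")
    case True
    let ?x = "\<lambda>i\<in>{..<length [0, 2::nat] - 1}. u"
    have "?x \<in> sig_dom (bun_M B) [0, 2]" "?x \<in> sig_dom (bun_M B') [0, 2]"
      using True E by (simp_all add: sig_dom_def bun_M_def pts_def top_of_def)
    then have "(bun_F B ! 0) ?x = bpi B u" "(bun_F B' ! 0) ?x = bpi B' u"
      by (simp_all add: bun_F_nth)
    then show ?thesis using *(4) by simp
  next
    case False
    then have "u \<notin> topspace (bE B')" using E by simp
    then show ?thesis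
      using extensional_arb[OF one.pi_extensional False] extensional_arb[OF two.pi_extensional] by simp
  qed
  then have "bpi B = bpi B'" by blast
  then show "a = a'"
    using E rest *(1) by (simp add: ab)
qed

lemma lcs_comp_bmap_seq:
  assumes M: "map msp M1 = bun_spaces B1" and f: "bundle_map (A1, B1) (A2, B2) (fE, fX, fY, fG)"
  shows "map (\<lambda>\<alpha>. compose (pts (M1 ! \<alpha>)) (bmap_seq (A2, B2) (gE, gX, gY, gG) ! \<alpha>)
      (bmap_seq (A1, B1) (fE, fX, fY, fG) ! \<alpha>)) [0..<length M1] =
    bmap_seq (A1, B1) (compose (topspace (bE B1)) gE fE, compose (topspace (bX B1)) gX fX,
     compose (topspace (bY B1)) gY fY, compose (topspace (gtop (bG B1))) gG fG)"
proof -
  have cX: "continuous_map (bX B1) (bX B2) fX" and cY: "continuous_map (bY B1) (bY B2) fY"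
    using f unfolding bundle_map_iff by blast+
  have *: "[0..<5] = [0, 1, 2, 3, 4::nat]" by (simp add: upt_rec)
  show ?thesis
    unfolding bun_spaces_nth(1)[OF M] * list.map bun_spaces_pts[OF M] bmap_seq_nth
    unfolding bmap_seq_def prod.case pmap_compose[OF cX cY] ..
qed


lemma lcs_obj_in_fields: "lcs_obj_in N (A, B) =
    \<lparr>lN = N, lM = map triv_ident (bun_M B), lA = A, lF = bun_F B, lSig = bun_sig\<rparr>"
  by (simp add: lcs_obj_in_def)

lemma lcs_obj_fields: "lcs_obj (A, B) =
    \<lparr>lN = bun_S B, lM = bun_M B, lA = A, lF = bun_F B, lSig = bun_sig\<rparr>"
  by (simp add: lcs_obj_def)

lemma inj_on_lcs_obj:
  assumes BB: "\<And>B. B \<in> \<B> \<Longrightarrow> protobundle B"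
  shows "inj_on lcs_obj (Ob (Bun \<B>))"
  by (rule inj_on_lcs_objI[OF BB]) (auto simp: lcs_obj_fields bun_M_def)

lemma inj_on_lcs_obj_in:
  assumes BB: "\<And>B. B \<in> \<B> \<Longrightarrow> protobundle B"
  shows "inj_on (lcs_obj_in N) (Ob (Bun \<B>))"
  by (rule inj_on_lcs_objI[OF BB]) (auto simp: lcs_obj_in_fields bun_M_def coord_obj_def)

lemma lcs_comp_lcs_arr:
  assumes "(f, a, b) \<in> Ar (Bun \<B>)"
  shows "lcs_comp (lcs_arr (g, b, c)) (lcs_arr (f, a, b)) = lcs_arr (bun_comp (g, b, c) (f, a, b))"
    and "lcs_comp (lcs_arr_in N (g, b, c)) (lcs_arr_in N (f, a, b)) = lcs_arr_in N (bun_comp (g, b, c) (f, a, b))"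
proof -
  obtain A1 B1 A2 B2 where ab: "a = (A1, B1)" "b = (A2, B2)"
    by (cases a; cases b)
  obtain fE fX fY fG gE gX gY gG where fg: "f = (fE, fX, fY, fG)" "g = (gE, gX, gY, gG)"
    by (cases f; cases g)
  have f: "bundle_map (A1, B1) (A2, B2) (fE, fX, fY, fG)"
    using assms by (simp add: Ar_Bun ab fg)
  show "lcs_comp (lcs_arr (g, b, c)) (lcs_arr (f, a, b)) = lcs_arr (bun_comp (g, b, c) (f, a, b))"
    using lcs_comp_bmap_seq[OF map_msp_bun_M(1) f, of gE gX gY gG]
    by (simp add: ab fg lcs_arr_def lcs_comp_def bun_comp_def lcs_obj_fields)
  show "lcs_comp (lcs_arr_in N (g, b, c)) (lcs_arr_in N (f, a, b)) = lcs_arr_in N (bun_comp (g, b, c) (f, a, b))"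
    using lcs_comp_bmap_seq[OF map_msp_bun_M(2) f, of gE gX gY gG]
    by (simp add: ab fg lcs_arr_in_def lcs_comp_def bun_comp_def lcs_obj_in_fields del: length_map)
qed

lemma is_functor_lcs:
  assumes BB: "\<And>B. B \<in> \<B> \<Longrightarrow> protobundle B"
  shows "is_functor bun_comp (Bun \<B>) lcs_comp (LCS_Bun \<B>) lcs_obj lcs_arr"
    and "is_functor bun_comp (Bun \<B>) lcs_comp (LCS_Bun_in N \<B>) (lcs_obj_in N) (lcs_arr_in N)"
proof -
  show "is_functor bun_comp (Bun \<B>) lcs_comp (LCS_Bun \<B>) lcs_obj lcs_arr"
    unfolding LCS_Bun_def
    by (rule is_functor_image_cat[OF category_Bun[OF BB] inj_on_lcs_obj[OF BB]], assumption, assumption)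
       (simp add: lcs_arr_def, rule lcs_comp_lcs_arr(1))
  show "is_functor bun_comp (Bun \<B>) lcs_comp (LCS_Bun_in N \<B>) (lcs_obj_in N) (lcs_arr_in N)"
    unfolding LCS_Bun_in_def
    by (rule is_functor_image_cat[OF category_Bun[OF BB] inj_on_lcs_obj_in[OF BB]], assumption, assumption)
       (simp add: lcs_arr_in_def, rule lcs_comp_lcs_arr(2))
qed

lemma bmap_seq_id_bmap: "bmap_seq (A, B) (id_bmap B) = id_seq B"
  by (simp add: bmap_seq_def id_bmap_def id_seq_def pmap_ident)

lemma identity_arrow_lcs:
  assumes BB: "\<And>B. B \<in> \<B> \<Longrightarrow> protobundle B" and a: "(A, B) \<in> Ob (Bun \<B>)"
  shows "identity_arrow lcs_comp (LCS_Bun \<B>) (lcs_obj (A, B)) (id_seq B, lcs_obj (A, B), lcs_obj (A, B))"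
    and "identity_arrow lcs_comp (LCS_Bun_in N \<B>) (lcs_obj_in N (A, B))
      (id_seq B, lcs_obj_in N (A, B), lcs_obj_in N (A, B))"
proof -
  note ident = identity_arrow_Bun[OF BB a]
  have "identity_arrow lcs_comp (LCS_Bun \<B>) (lcs_obj (A, B)) (lcs_arr (id_bmap B, (A, B), (A, B)))"
    using is_functor_lcs(1)[OF BB] a ident unfolding is_functor_def by blast
  then show "identity_arrow lcs_comp (LCS_Bun \<B>) (lcs_obj (A, B)) (id_seq B, lcs_obj (A, B), lcs_obj (A, B))"
    by (simp add: lcs_arr_def bmap_seq_id_bmap)
  have "identity_arrow lcs_comp (LCS_Bun_in N \<B>) (lcs_obj_in N (A, B)) (lcs_arr_in N (id_bmap B, (A, B), (A, B)))"
    using is_functor_lcs(2)[OF BB] a ident unfolding is_functor_def by blast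
  then show "identity_arrow lcs_comp (LCS_Bun_in N \<B>) (lcs_obj_in N (A, B))
      (id_seq B, lcs_obj_in N (A, B), lcs_obj_in N (A, B))"
    by (simp add: lcs_arr_in_def bmap_seq_id_bmap)
qed

lemma model_function_category_if_grho:
  assumes "grho_model_category C"
  shows "model_function_category C"
proof -
  obtain P where P: "\<And>a. a \<in> P \<Longrightarrow> grho_obj a" and sub: "subcategory pts C (grho_cat P)"
    using assms unfolding grho_model_category_def by blast
  have obj: "\<not> is_top a \<and> model_space (msp a)" if "a \<in> Ob C" for a
  proof -
    have "grho_obj a" using P sub that unfolding subcategory_def grho_cat_def by auto
    then show ?thesis by (cases a) (simp_all add: grho_model_space_def)
  qed
  have "model_function (msp a) (msp b) f" if "(f, a, b) \<in> Ar C" for f a b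
  proof -
    have "grho_morphism a b f" using sub that unfolding subcategory_def grho_cat_def by auto
    then show ?thesis by (cases a; cases b) simp_all
  qed
  with obj sub show ?thesis
    unfolding model_function_category_def subcategory_def by blast
qed

lemma grho_morphism_pmap:
  assumes B: "protobundle B1" "protobundle B2" and f: "bundle_map (A1, B1) (A2, B2) (fE, fX, fY, fG)"
  shows "grho_morphism (coord_obj B1) (coord_obj B2) (pmap (bX B1) (bY B1) fX fY)"
proof -
  interpret one: pbundle B1 by unfold_locales (rule B(1))
  have cX: "continuous_map (bX B1) (bX B2) fX" and cY: "continuous_map (bY B1) (bY B2) fY"
    and cG: "cont_hom (bG B1) (bG B2) fG"
    and frho: "\<And>y g. y \<in> topspace (bY B1) \<Longrightarrow> g \<in> topspace (gtop (bG B1)) \<Longrightarrow>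
      brho B2 (fY y, fG g) = fY (brho B1 (y, g))"
    using f unfolding bundle_map_iff by blast+
  have "pmap (bX B1) (bY B1) fX fY (act (brho B1) p g) = act (brho B2) (pmap (bX B1) (bY B1) fX fY p) (fG g)"
    if "p \<in> ptimes (topspace (bX B1)) (topspace (bY B1))" "g \<in> topspace (gtop (bG B1))" for p g
    using that by (auto simp: act_def frho one.action_closed elim!: ptimesE)
  then show ?thesis
    unfolding coord_obj_def using model_function_pmap[OF B cX cY] cG by auto
qed

lemma full_subcategory_Ob: "full_subcategory P C D \<Longrightarrow> a \<in> Ob C \<Longrightarrow> a \<in> Ob D"
  and full_subcategory_Ar: "full_subcategory P C D \<Longrightarrow> t \<in> Ar C \<Longrightarrow> t \<in> Ar D"
  unfolding full_subcategory_def subcategory_def by blast+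

theorem theorem11p60:
  fixes EE XX YY :: "'a point topology set"
    and GG :: "'a point tgroup set"
    and BB :: "'a protobundle set"
    and cE cXYG cX cY cG :: "'a ocat"
    and MM :: "'a ocat list"
  assumes GG: "\<And>G. G \<in> GG \<Longrightarrow> topological_group G"
    and BB: "\<And>B. B \<in> BB \<Longrightarrow> protobundle B \<and> bE B \<in> EE \<and> bX B \<in> XX \<and> bY B \<in> YY \<and> bG B \<in> GG"
    and MM: "MM = [cE, cXYG, cX, cY, cG]"
    and model_cats: "model_category cE" "model_category cX" "model_category cY" "model_category cG"
    and grho_cat: "grho_model_category cXYG"
    and full_E: "full_subcategory pts (triv_cat EE) cE"
    and full_XYG: "full_subcategory pts (triv_bun_cat BB) cXYG"
    and full_X: "full_subcategory pts (triv_cat XX) cX"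
    and full_Y: "full_subcategory pts (triv_cat YY) cY"
    and full_G: "full_subcategory pts (triv_cat (gtop ` GG)) cG"
  shows
    "(\<forall>(A, B) \<in> Ob (Bun BB).
        local_coordinate_space (bun_S B) bun_sig (lcs_obj (A, B)) \<and>
        local_coordinate_space MM bun_sig (lcs_obj_in MM (A, B))) \<and>
     (category lcs_comp (LCS_Bun BB) \<and> category lcs_comp (LCS_Bun_in MM BB) \<and>
      (\<forall>(A, B) \<in> Ob (Bun BB).
         identity_arrow lcs_comp (LCS_Bun BB) (lcs_obj (A, B))
           (id_seq B, lcs_obj (A, B), lcs_obj (A, B)) \<and>
         identity_arrow lcs_comp (LCS_Bun_in MM BB) (lcs_obj_in MM (A, B))
           (id_seq B, lcs_obj_in MM (A, B), lcs_obj_in MM (A, B)))) \<and>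
     (\<forall>a \<in> Ob (Bun BB). \<forall>b \<in> Ob (Bun BB). \<forall>f. bundle_map a b f \<longrightarrow>
        lcs_morphism bun_sig (lcs_obj a) (lcs_obj b) (bmap_seq a f) \<and>
        strict_lcs_morphism bun_sig (lcs_obj_in MM a) (lcs_obj_in MM b) (bmap_seq a f)) \<and>
     (is_functor bun_comp (Bun BB) lcs_comp (LCS_Bun BB) lcs_obj lcs_arr \<and>
      is_functor bun_comp (Bun BB) lcs_comp (LCS_Bun_in MM BB) (lcs_obj_in MM) (lcs_arr_in MM))"
proof -
  have pb: "protobundle B" if "B \<in> BB" for B
    using BB[OF that] by blast
  have MM_nth: "length MM = 5" "MM ! 0 = cE" "MM ! 1 = cXYG" "MM ! 2 = cX" "MM ! 3 = cY" "MM ! 4 = cG"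
    by (simp_all add: MM)
  have mfc: "model_function_category cE" "model_function_category cXYG" "model_function_category cX"
    "model_function_category cY" "model_function_category cG"
    using model_cats model_function_category_if_grho[OF grho_cat] unfolding model_category_def by blast+
  have M_nth: "map triv_ident (bun_M B) ! 0 = ModObj (triv (bE B))"
    "map triv_ident (bun_M B) ! 1 = coord_obj B" "map triv_ident (bun_M B) ! 2 = ModObj (triv (bX B))"
    "map triv_ident (bun_M B) ! 3 = ModObj (triv (bY B))"
    "map triv_ident (bun_M B) ! 4 = ModObj (triv (gtop (bG B)))" for B :: "'a protobundle"
    by (simp_all add: bun_M_def coord_obj_def)
  have triv_Ob: "ModObj (triv T) \<in> Ob (triv_cat \<S>)" if "T \<in> \<S>" for T :: "'a point topology" and \<S>
    using that by (simp add: triv_cat_def)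
  have triv_Ar: "(f, ModObj (triv S), ModObj (triv T)) \<in> Ar (triv_cat \<S>)"
    if "S \<in> \<S>" "T \<in> \<S>" "f \<in> extensional (topspace S)" "continuous_map S T f"
    for f and S T :: "'a point topology" and \<S>
    using that by (auto simp: triv_cat_def)
  have lcs1: "local_coordinate_space (bun_S B) bun_sig (lcs_obj (A, B))"
    and lcs2: "local_coordinate_space MM bun_sig (lcs_obj_in MM (A, B))"
    if a: "(A, B) \<in> Ob (Bun BB)" for A B
  proof -
    have B: "B \<in> BB" and A: "maximal_bundle_atlas B A" using a by simp_all
    interpret pbundle B by unfold_locales (rule pb[OF B])
    show "local_coordinate_space (bun_S B) bun_sig (lcs_obj (A, B))"
      by (rule local_coordinate_space_singletons[OF A])
    show "local_coordinate_space MM bun_sig (lcs_obj_in MM (A, B))"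
      unfolding lcs_obj_in_fields
    proof (rule local_coordinate_space_bun[OF map_msp_bun_M(2) A])
      show "length MM = 5" by (rule MM_nth)
      show "\<forall>\<alpha><5. topological_category (MM ! \<alpha>) \<or> model_function_category (MM ! \<alpha>)"
        "model_function_category (MM ! 1)"
        unfolding all_less_5 MM_nth using mfc by blast+
      have "coord_obj B \<in> Ob (triv_bun_cat BB)" using B by (simp add: triv_bun_cat_def grho_cat_def)
      then show "\<forall>\<alpha><5. map triv_ident (bun_M B) ! \<alpha> \<in> Ob (MM ! \<alpha>)"
        unfolding all_less_5 MM_nth M_nth
        using BB[OF B] full_subcategory_Ob[OF full_E triv_Ob[of "bE B"]] full_subcategory_Ob[OF full_XYG]
          full_subcategory_Ob[OF full_X triv_Ob[of "bX B"]] full_subcategory_Ob[OF full_Y triv_Ob[of "bY B"]]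
          full_subcategory_Ob[OF full_G triv_Ob[of "gtop (bG B)"]]
        by simp
    qed
  qed
  have mor: "lcs_morphism bun_sig (lcs_obj a) (lcs_obj b) (bmap_seq a f)"
    "strict_lcs_morphism bun_sig (lcs_obj_in MM a) (lcs_obj_in MM b) (bmap_seq a f)"
    if a: "a \<in> Ob (Bun BB)" and b: "b \<in> Ob (Bun BB)" and f: "bundle_map a b f" for a b f
  proof -
    obtain A1 B1 A2 B2 where ab: "a = (A1, B1)" "b = (A2, B2)" by (cases a; cases b)
    obtain fE fX fY fG where fs: "f = (fE, fX, fY, fG)" by (cases f)
    have B: "B1 \<in> BB" "B2 \<in> BB" and A: "bundle_atlas B1 A1"
      using a b maximal_bundle_atlasD by (auto simp: ab)
    note f' = f[unfolded ab fs]
    note m = lcs_morphism_bmap_seq[OF pb[OF B(1)] pb[OF B(2)] A _ _ f']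
    show "lcs_morphism bun_sig (lcs_obj a) (lcs_obj b) (bmap_seq a f)"
      unfolding ab fs lcs_obj_fields
      by (rule m[OF map_msp_bun_M(1) map_msp_bun_M(1)
            lcs1[OF a[unfolded ab], unfolded lcs_obj_fields] lcs1[OF b[unfolded ab], unfolded lcs_obj_fields]])
    have "lcs_morphism bun_sig (lcs_obj_in MM a) (lcs_obj_in MM b) (bmap_seq a f)"
      unfolding ab fs lcs_obj_in_fields
      by (rule m[OF map_msp_bun_M(2) map_msp_bun_M(2)
            lcs2[OF a[unfolded ab], unfolded lcs_obj_in_fields] lcs2[OF b[unfolded ab], unfolded lcs_obj_in_fields]])
    moreover have "\<forall>\<alpha><5. (bmap_seq (A1, B1) (fE, fX, fY, fG) ! \<alpha>, map triv_ident (bun_M B1) ! \<alpha>,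
        map triv_ident (bun_M B2) ! \<alpha>) \<in> Ar (MM ! \<alpha>)"
      unfolding all_less_5 MM_nth M_nth bmap_seq_nth
    proof (intro conjI)
      note F = f'[unfolded bundle_map_iff cont_hom_def]
      note B1 = BB[OF B(1)] and B2 = BB[OF B(2)]
      show "(fE, ModObj (triv (bE B1)), ModObj (triv (bE B2))) \<in> Ar cE"
        by (rule full_subcategory_Ar[OF full_E triv_Ar]) (use F B1 B2 in blast)+
      show "(fX, ModObj (triv (bX B1)), ModObj (triv (bX B2))) \<in> Ar cX"
        by (rule full_subcategory_Ar[OF full_X triv_Ar]) (use F B1 B2 in blast)+
      show "(fY, ModObj (triv (bY B1)), ModObj (triv (bY B2))) \<in> Ar cY"
        by (rule full_subcategory_Ar[OF full_Y triv_Ar]) (use F B1 B2 in blast)+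
      show "(fG, ModObj (triv (gtop (bG B1))), ModObj (triv (gtop (bG B2)))) \<in> Ar cG"
        by (rule full_subcategory_Ar[OF full_G triv_Ar]) (use F B1 B2 in blast)+
      have "(pmap (bX B1) (bY B1) fX fY, coord_obj B1, coord_obj B2) \<in> Ar (triv_bun_cat BB)"
        using B grho_morphism_pmap[OF pb[OF B(1)] pb[OF B(2)] f'] by (simp add: triv_bun_cat_def grho_cat_def)
      then show "(pmap (bX B1) (bY B1) fX fY, coord_obj B1, coord_obj B2) \<in> Ar cXYG"
        by (rule full_subcategory_Ar[OF full_XYG])
    qed
    ultimately show "strict_lcs_morphism bun_sig (lcs_obj_in MM a) (lcs_obj_in MM b) (bmap_seq a f)"
      unfolding strict_lcs_morphism_def ab fs lcs_obj_in_fields lcs.simps bmap_seq_nth(1) by blast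
  qed
  have fun1: "is_functor bun_comp (Bun BB) lcs_comp (LCS_Bun BB) lcs_obj lcs_arr"
    and fun2: "is_functor bun_comp (Bun BB) lcs_comp (LCS_Bun_in MM BB) (lcs_obj_in MM) (lcs_arr_in MM)"
    using is_functor_lcs[OF pb] by blast+
  have cat: "category lcs_comp (LCS_Bun BB)" "category lcs_comp (LCS_Bun_in MM BB)"
    using fun1 fun2 unfolding is_functor_def by blast+
  show ?thesis
  proof (intro conjI fun1 fun2 cat)
    show "\<forall>(A, B) \<in> Ob (Bun BB).
        local_coordinate_space (bun_S B) bun_sig (lcs_obj (A, B)) \<and>
        local_coordinate_space MM bun_sig (lcs_obj_in MM (A, B))"
      by (intro ballI case_prodI2 conjI; rule lcs1 lcs2; simp)
    show "\<forall>(A, B) \<in> Ob (Bun BB).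
         identity_arrow lcs_comp (LCS_Bun BB) (lcs_obj (A, B))
           (id_seq B, lcs_obj (A, B), lcs_obj (A, B)) \<and>
         identity_arrow lcs_comp (LCS_Bun_in MM BB) (lcs_obj_in MM (A, B))
           (id_seq B, lcs_obj_in MM (A, B), lcs_obj_in MM (A, B))"
      by (intro ballI case_prodI2 conjI; rule identity_arrow_lcs[OF pb]; simp)
    show "\<forall>a \<in> Ob (Bun BB). \<forall>b \<in> Ob (Bun BB). \<forall>f. bundle_map a b f \<longrightarrow>
        lcs_morphism bun_sig (lcs_obj a) (lcs_obj b) (bmap_seq a f) \<and>
        strict_lcs_morphism bun_sig (lcs_obj_in MM a) (lcs_obj_in MM b) (bmap_seq a f)"
      by (intro ballI allI impI conjI; rule mor)
  qed
qed

end
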